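(* Let $\mathcal{C}$ be a rigid $\otimes$-category with universal rigid abelian $\otimes$-category $\lambda_{\mathcal{C}}:\mathcal{C}\to T(\mathcal{C})$. The faithful $\otimes$-functors from $\mathcal{C}$ to connected rigid abelian $\otimes$-categories are classified by those maximal ideals $M\in\operatorname{Spec}Z(T(\mathcal{C}))$ such that the composition $$\mathcal{C}\xrightarrow{\lambda_{\mathcal{C}}}T(\mathcal{C})\to T(\mathcal{C})/\!\!/M$$ is faithful; that is, for every faithful $\otimes$-functor $G:\mathcal{C}\to\mathcal{B}$ with $\mathcal{B}$ a connected rigid abelian $\otimes$-category, there is a unique such $M$ such that the exact $\otimes$-functor $T(\mathcal{C})\to\mathcal{B}$ induced by $G$ factors (faithfully) through $T(\mathcal{C})/\!\!/M$. This set of maximal ideals is closed in $\operatorname{Spec}Z(T(\mathcal{C}))$, hence compact (and may be empty).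
   Context: A $\otimes$-category is an additive symmetric monoidal category with unit $\mathbf{1}$ and biadditive tensor product; it is rigid if every object has a dual; a rigid abelian $\otimes$-category is one whose underlying category is abelian. A $\otimes$-functor is a strong symmetric monoidal unital additive functor. $Z(\mathcal{A})=\operatorname{End}_{\mathcal{A}}(\mathbf{1})$; a rigid abelian $\otimes$-category $\mathcal{A}$ is connected if $Z(\mathcal{A})$ is a field. The $\otimes$-functor $\lambda_{\mathcal{C}}:\mathcal{C}\to T(\mathcal{C})$ to a rigid abelian $\otimes$-category is $2$-universal: for each rigid abelian $\otimes$-category $\mathcal{B}$, composition with $\lambda_{\mathcal{C}}$ is an equivalence from the groupoid of exact $\otimes$-functors $T(\mathcal{C})\to\mathcal{B}$ to the groupoid of $\otimes$-functors $\mathcal{C}\to\mathcal{B}$ (morphisms being $\otimes$-natural isomorphisms). For any rigid abelian $\otimes$-category $\mathcal{A}$, the ring $Z(\mathcal{A})$ is absolutely flat, so all its primes are maximal. For an ideal $I$ of $Z(\mathcal{A})$, $\mathcal{A}/\!\!/I$ is the Serre quotient of $\mathcal{A}$ by the Serre subcategory $\{A\mid e(A)\in I\}$ (stable under tensoring with any object), where $e(A)\in Z(\mathcal{A})$ is the idempotent with image $\operatorname{Supp}(A)$ and kernel $\operatorname{Ker}(\mathbf{1}\to A^\vee\otimes A)$; here $\mathbf{1}\to A^\vee\otimes A$ is the adjoint of $1_A$ and $\operatorname{Supp}(A)$ is the unique complement of its kernel in $\mathbf{1}$ (every subobject of $\mathbf{1}$ has a unique complement). The functors $\mathcal{C}\to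 T(\mathcal{C})/\!\!/M$ for the maximal ideals $M$ of the statement are called the local abelian $\otimes$-envelopes of $\mathcal{C}$. *)

theory Defs
  imports "HOL-Algebra.Ideal" "HOL-Analysis.Abstract_Topology"
begin

section \<open>Categories with tensor structure\<close>

text \<open>The record carries the raw data; all axioms are in the locales below.
  \<open>Comp A g f\<close> is the composite of \<open>g\<close> after \<open>f\<close>, and \<open>TenO\<close>, \<open>TenA\<close> are the tensor product
  on objects and on arrows. Addition and zero arrows are part of the data (in an additive
  category they are determined by the composition). Values outside \<open>Ob\<close>, \<open>Arr\<close> or on
  non-composable arrows are irrelevant.\<close>

record ('o, 'm) tcat =
  Ob :: "'o set"
  Arr :: "'m set"
  Dom :: "'m \<Rightarrow> 'o"
  Cod :: "'m \<Rightarrow> 'o"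
  Id :: "'o \<Rightarrow> 'm"
  Comp :: "'m \<Rightarrow> 'm \<Rightarrow> 'm" (infixl "\<cdot>\<index>" 70)
  Zero :: "'o \<Rightarrow> 'o \<Rightarrow> 'm"
  Add :: "'m \<Rightarrow> 'm \<Rightarrow> 'm" (infixl "\<oplus>\<^sub>a\<index>" 65)
  Unit :: "'o"
  TenO :: "'o \<Rightarrow> 'o \<Rightarrow> 'o" (infixl "\<otimes>\<^sub>o\<index>" 75)
  TenA :: "'m \<Rightarrow> 'm \<Rightarrow> 'm" (infixl "\<otimes>\<^sub>a\<index>" 75)
  Assoc :: "'o \<Rightarrow> 'o \<Rightarrow> 'o \<Rightarrow> 'm"
  LUnit :: "'o \<Rightarrow> 'm"
  RUnit :: "'o \<Rightarrow> 'm"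
  Sym :: "'o \<Rightarrow> 'o \<Rightarrow> 'm"

definition Hom :: "('o, 'm) tcat \<Rightarrow> 'o \<Rightarrow> 'o \<Rightarrow> 'm set" where
  "Hom A X Y = {f \<in> Arr A. Dom A f = X \<and> Cod A f = Y}"

definition hom_group :: "('o, 'm) tcat \<Rightarrow> 'o \<Rightarrow> 'o \<Rightarrow> 'm monoid" where
  "hom_group A X Y = \<lparr>carrier = Hom A X Y, mult = Add A, one = Zero A X Y\<rparr>"

definition is_iso :: "('o, 'm) tcat \<Rightarrow> 'm \<Rightarrow> bool" where
  "is_iso A f \<longleftrightarrow> f \<in> Arr A \<and>
     (\<exists>g \<in> Hom A (Cod A f) (Dom A f). g \<cdot>\<^bsub>A\<^esub> f = Id A (Dom A f) \<and> f \<cdot>\<^bsub>A\<^esub> g = Id A (Cod A f))"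

locale category =
  fixes A :: "('o, 'm) tcat" (structure)
  assumes dom_Ob: "f \<in> Arr A \<Longrightarrow> Dom A f \<in> Ob A"
    and cod_Ob: "f \<in> Arr A \<Longrightarrow> Cod A f \<in> Ob A"
    and id_hom: "X \<in> Ob A \<Longrightarrow> Id A X \<in> Hom A X X"
    and comp_hom: "\<lbrakk>f \<in> Hom A X Y; g \<in> Hom A Y Z\<rbrakk> \<Longrightarrow> g \<cdot> f \<in> Hom A X Z"
    and comp_id_right: "f \<in> Hom A X Y \<Longrightarrow> f \<cdot> Id A X = f"
    and comp_id_left: "f \<in> Hom A X Y \<Longrightarrow> Id A Y \<cdot> f = f"
    and comp_assoc: "\<lbrakk>f \<in> Hom A X Y; g \<in> Hom A Y Z; h \<in> Hom A Z W\<rbrakk>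
      \<Longrightarrow> (h \<cdot> g) \<cdot> f = h \<cdot> (g \<cdot> f)"

definition is_zero_object :: "('o, 'm) tcat \<Rightarrow> 'o \<Rightarrow> bool" where
  "is_zero_object A Z \<longleftrightarrow> Z \<in> Ob A \<and>
     (\<forall>X \<in> Ob A. (\<exists>!f. f \<in> Hom A X Z) \<and> (\<exists>!f. f \<in> Hom A Z X))"

definition is_biproduct ::
  "('o, 'm) tcat \<Rightarrow> 'o \<Rightarrow> 'o \<Rightarrow> 'o \<Rightarrow> 'm \<Rightarrow> 'm \<Rightarrow> 'm \<Rightarrow> 'm \<Rightarrow> bool" where
  "is_biproduct A X Y S i j p q \<longleftrightarrow>
     i \<in> Hom A X S \<and> j \<in> Hom A Y S \<and> p \<in> Hom A S X \<and> q \<in> Hom A S Y \<and>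
     p \<cdot>\<^bsub>A\<^esub> i = Id A X \<and> q \<cdot>\<^bsub>A\<^esub> j = Id A Y \<and>
     p \<cdot>\<^bsub>A\<^esub> j = Zero A Y X \<and> q \<cdot>\<^bsub>A\<^esub> i = Zero A X Y \<and>
     (i \<cdot>\<^bsub>A\<^esub> p) \<oplus>\<^sub>a\<^bsub>A\<^esub> (j \<cdot>\<^bsub>A\<^esub> q) = Id A S"

locale additive_category = category +
  assumes hom_comm_group: "\<lbrakk>X \<in> Ob A; Y \<in> Ob A\<rbrakk> \<Longrightarrow> comm_group (hom_group A X Y)"
    and comp_add_right: "\<lbrakk>f \<in> Hom A X Y; f' \<in> Hom A X Y; g \<in> Hom A Y Z\<rbrakk>
      \<Longrightarrow> g \<cdot> (f \<oplus>\<^sub>a f') = (g \<cdot> f) \<oplus>\<^sub>a (g \<cdot> f')"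
    and comp_add_left: "\<lbrakk>f \<in> Hom A X Y; g \<in> Hom A Y Z; g' \<in> Hom A Y Z\<rbrakk>
      \<Longrightarrow> (g \<oplus>\<^sub>a g') \<cdot> f = (g \<cdot> f) \<oplus>\<^sub>a (g' \<cdot> f)"
    and zero_object: "\<exists>Z. is_zero_object A Z"
    and biproduct: "\<lbrakk>X \<in> Ob A; Y \<in> Ob A\<rbrakk> \<Longrightarrow> \<exists>S i j p q. is_biproduct A X Y S i j p q"

text \<open>An additive symmetric monoidal category with biadditive tensor product. The axioms listed
  are bifunctoriality, naturality of the constraints, the pentagon, the triangle, one hexagon
  (the other one follows from symmetry) and the symmetry condition.\<close>

locale tensor_category = additive_category +
  assumes unit_Ob: "Unit A \<in> Ob A"
    and tenO_Ob: "\<lbrakk>X \<in> Ob A; Y \<in> Ob A\<rbrakk> \<Longrightarrow> X \<otimes>\<^sub>o Y \<in> Ob A"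
    and tenA_hom: "\<lbrakk>f \<in> Hom A X X'; g \<in> Hom A Y Y'\<rbrakk>
      \<Longrightarrow> f \<otimes>\<^sub>a g \<in> Hom A (X \<otimes>\<^sub>o Y) (X' \<otimes>\<^sub>o Y')"
    and ten_id: "\<lbrakk>X \<in> Ob A; Y \<in> Ob A\<rbrakk> \<Longrightarrow> Id A X \<otimes>\<^sub>a Id A Y = Id A (X \<otimes>\<^sub>o Y)"
    and ten_comp: "\<lbrakk>f \<in> Hom A X X'; f' \<in> Hom A X' X''; g \<in> Hom A Y Y'; g' \<in> Hom A Y' Y''\<rbrakk>
      \<Longrightarrow> (f' \<cdot> f) \<otimes>\<^sub>a (g' \<cdot> g) = (f' \<otimes>\<^sub>a g') \<cdot> (f \<otimes>\<^sub>a g)"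
    and ten_add_left: "\<lbrakk>f \<in> Hom A X X'; f' \<in> Hom A X X'; g \<in> Hom A Y Y'\<rbrakk>
      \<Longrightarrow> (f \<oplus>\<^sub>a f') \<otimes>\<^sub>a g = (f \<otimes>\<^sub>a g) \<oplus>\<^sub>a (f' \<otimes>\<^sub>a g)"
    and ten_add_right: "\<lbrakk>f \<in> Hom A X X'; g \<in> Hom A Y Y'; g' \<in> Hom A Y Y'\<rbrakk>
      \<Longrightarrow> f \<otimes>\<^sub>a (g \<oplus>\<^sub>a g') = (f \<otimes>\<^sub>a g) \<oplus>\<^sub>a (f \<otimes>\<^sub>a g')"
    and assoc_hom: "\<lbrakk>X \<in> Ob A; Y \<in> Ob A; Z \<in> Ob A\<rbrakk>
      \<Longrightarrow> Assoc A X Y Z \<in> Hom A (X \<otimes>\<^sub>o Y \<otimes>\<^sub>o Z) (X \<otimes>\<^sub>o (Y \<otimes>\<^sub>o Z))"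
    and assoc_iso: "\<lbrakk>X \<in> Ob A; Y \<in> Ob A; Z \<in> Ob A\<rbrakk> \<Longrightarrow> is_iso A (Assoc A X Y Z)"
    and assoc_natural: "\<lbrakk>f \<in> Hom A X X'; g \<in> Hom A Y Y'; h \<in> Hom A Z Z'\<rbrakk>
      \<Longrightarrow> Assoc A X' Y' Z' \<cdot> (f \<otimes>\<^sub>a g \<otimes>\<^sub>a h) = (f \<otimes>\<^sub>a (g \<otimes>\<^sub>a h)) \<cdot> Assoc A X Y Z"
    and lunit_hom: "X \<in> Ob A \<Longrightarrow> LUnit A X \<in> Hom A (Unit A \<otimes>\<^sub>o X) X"
    and lunit_iso: "X \<in> Ob A \<Longrightarrow> is_iso A (LUnit A X)"
    and lunit_natural: "f \<in> Hom A X X'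
      \<Longrightarrow> LUnit A X' \<cdot> (Id A (Unit A) \<otimes>\<^sub>a f) = f \<cdot> LUnit A X"
    and runit_hom: "X \<in> Ob A \<Longrightarrow> RUnit A X \<in> Hom A (X \<otimes>\<^sub>o Unit A) X"
    and runit_iso: "X \<in> Ob A \<Longrightarrow> is_iso A (RUnit A X)"
    and runit_natural: "f \<in> Hom A X X'
      \<Longrightarrow> RUnit A X' \<cdot> (f \<otimes>\<^sub>a Id A (Unit A)) = f \<cdot> RUnit A X"
    and sym_hom: "\<lbrakk>X \<in> Ob A; Y \<in> Ob A\<rbrakk> \<Longrightarrow> Sym A X Y \<in> Hom A (X \<otimes>\<^sub>o Y) (Y \<otimes>\<^sub>o X)"
    and sym_natural: "\<lbrakk>f \<in> Hom A X X'; g \<in> Hom A Y Y'\<rbrakk>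
      \<Longrightarrow> Sym A X' Y' \<cdot> (f \<otimes>\<^sub>a g) = (g \<otimes>\<^sub>a f) \<cdot> Sym A X Y"
    and sym_sym: "\<lbrakk>X \<in> Ob A; Y \<in> Ob A\<rbrakk> \<Longrightarrow> Sym A Y X \<cdot> Sym A X Y = Id A (X \<otimes>\<^sub>o Y)"
    and pentagon: "\<lbrakk>X \<in> Ob A; Y \<in> Ob A; Z \<in> Ob A; W \<in> Ob A\<rbrakk>
      \<Longrightarrow> (Id A X \<otimes>\<^sub>a Assoc A Y Z W) \<cdot> Assoc A X (Y \<otimes>\<^sub>o Z) W \<cdot> (Assoc A X Y Z \<otimes>\<^sub>a Id A W)
        = Assoc A X Y (Z \<otimes>\<^sub>o W) \<cdot> Assoc A (X \<otimes>\<^sub>o Y) Z W"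
    and triangle: "\<lbrakk>X \<in> Ob A; Y \<in> Ob A\<rbrakk>
      \<Longrightarrow> (Id A X \<otimes>\<^sub>a LUnit A Y) \<cdot> Assoc A X (Unit A) Y = RUnit A X \<otimes>\<^sub>a Id A Y"
    and hexagon: "\<lbrakk>X \<in> Ob A; Y \<in> Ob A; Z \<in> Ob A\<rbrakk>
      \<Longrightarrow> Assoc A Y Z X \<cdot> Sym A X (Y \<otimes>\<^sub>o Z) \<cdot> Assoc A X Y Z
        = (Id A Y \<otimes>\<^sub>a Sym A X Z) \<cdot> Assoc A Y X Z \<cdot> (Sym A X Y \<otimes>\<^sub>a Id A Z)"

text \<open>\<open>is_dual A X D ev coev\<close>: \<open>D\<close> is a dual of \<open>X\<close> with evaluation \<open>X \<otimes> D \<rightarrow> 1\<close> and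
  coevaluation \<open>1 \<rightarrow> D \<otimes> X\<close>, the latter being the adjoint of the identity of \<open>X\<close>. The two
  equations are the triangle identities with the constraints made explicit; to avoid inverses
  of the unit constraints, these are moved to the other side.\<close>

definition is_dual :: "('o, 'm) tcat \<Rightarrow> 'o \<Rightarrow> 'o \<Rightarrow> 'm \<Rightarrow> 'm \<Rightarrow> bool" where
  "is_dual A X D ev coev \<longleftrightarrow>
     X \<in> Ob A \<and> D \<in> Ob A \<and>
     ev \<in> Hom A (X \<otimes>\<^sub>o\<^bsub>A\<^esub> D) (Unit A) \<and> coev \<in> Hom A (Unit A) (D \<otimes>\<^sub>o\<^bsub>A\<^esub> X) \<and>
     (\<exists>a \<in> Hom A (X \<otimes>\<^sub>o\<^bsub>A\<^esub> (D \<otimes>\<^sub>o\<^bsub>A\<^esub> X)) (X \<otimes>\<^sub>o\<^bsub>A\<^esub> D \<otimes>\<^sub>o\<^bsub>A\<^esub> X).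
        a \<cdot>\<^bsub>A\<^esub> Assoc A X D X = Id A (X \<otimes>\<^sub>o\<^bsub>A\<^esub> D \<otimes>\<^sub>o\<^bsub>A\<^esub> X) \<and>
        LUnit A X \<cdot>\<^bsub>A\<^esub> (ev \<otimes>\<^sub>a\<^bsub>A\<^esub> Id A X) \<cdot>\<^bsub>A\<^esub> a \<cdot>\<^bsub>A\<^esub> (Id A X \<otimes>\<^sub>a\<^bsub>A\<^esub> coev) = RUnit A X) \<and>
     RUnit A D \<cdot>\<^bsub>A\<^esub> (Id A D \<otimes>\<^sub>a\<^bsub>A\<^esub> ev) \<cdot>\<^bsub>A\<^esub> Assoc A D X D \<cdot>\<^bsub>A\<^esub> (coev \<otimes>\<^sub>a\<^bsub>A\<^esub> Id A D) = LUnit A D"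

locale rigid_tensor_category = tensor_category +
  assumes rigid: "X \<in> Ob A \<Longrightarrow> \<exists>D ev coev. is_dual A X D ev coev"

section \<open>Abelian categories\<close>

definition is_mono :: "('o, 'm) tcat \<Rightarrow> 'm \<Rightarrow> bool" where
  "is_mono A m \<longleftrightarrow> m \<in> Arr A \<and>
     (\<forall>W. \<forall>f \<in> Hom A W (Dom A m). \<forall>g \<in> Hom A W (Dom A m). m \<cdot>\<^bsub>A\<^esub> f = m \<cdot>\<^bsub>A\<^esub> g \<longrightarrow> f = g)"

definition is_epi :: "('o, 'm) tcat \<Rightarrow> 'm \<Rightarrow> bool" where
  "is_epi A p \<longleftrightarrow> p \<in> Arr A \<and>
     (\<forall>W. \<forall>f \<in> Hom A (Cod A p) W. \<forall>g \<in> Hom A (Cod A p) W. f \<cdot>\<^bsub>A\<^esub> p = g \<cdot>\<^bsub>A\<^esub> p \<longrightarrow> f = g)"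

definition is_kernel :: "('o, 'm) tcat \<Rightarrow> 'm \<Rightarrow> 'm \<Rightarrow> bool" where
  "is_kernel A k f \<longleftrightarrow>
     f \<in> Arr A \<and> k \<in> Hom A (Dom A k) (Dom A f) \<and>
     f \<cdot>\<^bsub>A\<^esub> k = Zero A (Dom A k) (Cod A f) \<and>
     (\<forall>W. \<forall>g \<in> Hom A W (Dom A f). f \<cdot>\<^bsub>A\<^esub> g = Zero A W (Cod A f)
        \<longrightarrow> (\<exists>!u. u \<in> Hom A W (Dom A k) \<and> k \<cdot>\<^bsub>A\<^esub> u = g))"

definition is_cokernel :: "('o, 'm) tcat \<Rightarrow> 'm \<Rightarrow> 'm \<Rightarrow> bool" where
  "is_cokernel A c f \<longleftrightarrow>
     f \<in> Arr A \<and> c \<in> Hom A (Cod A f) (Cod A c) \<and>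
     c \<cdot>\<^bsub>A\<^esub> f = Zero A (Dom A f) (Cod A c) \<and>
     (\<forall>W. \<forall>g \<in> Hom A (Cod A f) W. g \<cdot>\<^bsub>A\<^esub> f = Zero A (Dom A f) W
        \<longrightarrow> (\<exists>!u. u \<in> Hom A (Cod A c) W \<and> u \<cdot>\<^bsub>A\<^esub> c = g))"

locale rigid_abelian_category = rigid_tensor_category +
  assumes kernel: "f \<in> Arr A \<Longrightarrow> \<exists>k. is_kernel A k f"
    and cokernel: "f \<in> Arr A \<Longrightarrow> \<exists>c. is_cokernel A c f"
    and mono_normal: "is_mono A m \<Longrightarrow> \<exists>f. is_kernel A m f"
    and epi_normal: "is_epi A p \<Longrightarrow> \<exists>f. is_cokernel A p f"

definition Z_ring :: "('o, 'm) tcat \<Rightarrow> 'm ring" where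
  "Z_ring A = \<lparr>carrier = Hom A (Unit A) (Unit A), mult = Comp A, one = Id A (Unit A),
     zero = Zero A (Unit A) (Unit A), add = Add A\<rparr>"

locale connected_rigid_abelian_category = rigid_abelian_category +
  assumes connected: "field (Z_ring A)"

section \<open>Tensor functors\<close>

text \<open>\<open>FMu F X Y\<close> is the structure isomorphism \<open>F X \<otimes> F Y \<rightarrow> F (X \<otimes> Y)\<close> and \<open>FEps F\<close> is
  \<open>1 \<rightarrow> F 1\<close>.\<close>

record ('o, 'm, 'p, 'q) tfun =
  FOb :: "'o \<Rightarrow> 'p"
  FArr :: "'m \<Rightarrow> 'q"
  FMu :: "'o \<Rightarrow> 'o \<Rightarrow> 'q"
  FEps :: "'q"

locale tensor_functor = A: tensor_category A + B: tensor_category B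
  for A :: "('o, 'm) tcat" and B :: "('p, 'q) tcat" +
  fixes F :: "('o, 'm, 'p, 'q) tfun"
  assumes ob: "X \<in> Ob A \<Longrightarrow> FOb F X \<in> Ob B"
    and arr: "f \<in> Hom A X Y \<Longrightarrow> FArr F f \<in> Hom B (FOb F X) (FOb F Y)"
    and pres_id: "X \<in> Ob A \<Longrightarrow> FArr F (Id A X) = Id B (FOb F X)"
    and pres_comp: "\<lbrakk>f \<in> Hom A X Y; g \<in> Hom A Y Z\<rbrakk>
      \<Longrightarrow> FArr F (g \<cdot>\<^bsub>A\<^esub> f) = FArr F g \<cdot>\<^bsub>B\<^esub> FArr F f"
    and pres_add: "\<lbrakk>f \<in> Hom A X Y; g \<in> Hom A X Y\<rbrakk>
      \<Longrightarrow> FArr F (f \<oplus>\<^sub>a\<^bsub>A\<^esub> g) = FArr F f \<oplus>\<^sub>a\<^bsub>B\<^esub> FArr F g"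
    and mu_hom: "\<lbrakk>X \<in> Ob A; Y \<in> Ob A\<rbrakk>
      \<Longrightarrow> FMu F X Y \<in> Hom B (FOb F X \<otimes>\<^sub>o\<^bsub>B\<^esub> FOb F Y) (FOb F (X \<otimes>\<^sub>o\<^bsub>A\<^esub> Y))"
    and mu_iso: "\<lbrakk>X \<in> Ob A; Y \<in> Ob A\<rbrakk> \<Longrightarrow> is_iso B (FMu F X Y)"
    and mu_natural: "\<lbrakk>f \<in> Hom A X X'; g \<in> Hom A Y Y'\<rbrakk>
      \<Longrightarrow> FMu F X' Y' \<cdot>\<^bsub>B\<^esub> (FArr F f \<otimes>\<^sub>a\<^bsub>B\<^esub> FArr F g) = FArr F (f \<otimes>\<^sub>a\<^bsub>A\<^esub> g) \<cdot>\<^bsub>B\<^esub> FMu F X Y"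
    and eps_hom: "FEps F \<in> Hom B (Unit B) (FOb F (Unit A))"
    and eps_iso: "is_iso B (FEps F)"
    and mu_assoc: "\<lbrakk>X \<in> Ob A; Y \<in> Ob A; Z \<in> Ob A\<rbrakk>
      \<Longrightarrow> FArr F (Assoc A X Y Z) \<cdot>\<^bsub>B\<^esub> FMu F (X \<otimes>\<^sub>o\<^bsub>A\<^esub> Y) Z \<cdot>\<^bsub>B\<^esub> (FMu F X Y \<otimes>\<^sub>a\<^bsub>B\<^esub> Id B (FOb F Z))
        = FMu F X (Y \<otimes>\<^sub>o\<^bsub>A\<^esub> Z) \<cdot>\<^bsub>B\<^esub> (Id B (FOb F X) \<otimes>\<^sub>a\<^bsub>B\<^esub> FMu F Y Z)
            \<cdot>\<^bsub>B\<^esub> Assoc B (FOb F X) (FOb F Y) (FOb F Z)"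
    and mu_lunit: "X \<in> Ob A
      \<Longrightarrow> FArr F (LUnit A X) \<cdot>\<^bsub>B\<^esub> FMu F (Unit A) X \<cdot>\<^bsub>B\<^esub> (FEps F \<otimes>\<^sub>a\<^bsub>B\<^esub> Id B (FOb F X))
        = LUnit B (FOb F X)"
    and mu_runit: "X \<in> Ob A
      \<Longrightarrow> FArr F (RUnit A X) \<cdot>\<^bsub>B\<^esub> FMu F X (Unit A) \<cdot>\<^bsub>B\<^esub> (Id B (FOb F X) \<otimes>\<^sub>a\<^bsub>B\<^esub> FEps F)
        = RUnit B (FOb F X)"
    and mu_sym: "\<lbrakk>X \<in> Ob A; Y \<in> Ob A\<rbrakk>
      \<Longrightarrow> FArr F (Sym A X Y) \<cdot>\<^bsub>B\<^esub> FMu F X Y = FMu F Y X \<cdot>\<^bsub>B\<^esub> Sym B (FOb F X) (FOb F Y)"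

text \<open>Exactness is preservation of short exact sequences.\<close>

locale exact_tensor_functor =
  tensor_functor A B F + A: rigid_abelian_category A + B: rigid_abelian_category B
  for A :: "('o, 'm) tcat" and B :: "('p, 'q) tcat" and F :: "('o, 'm, 'p, 'q) tfun" +
  assumes exact: "\<lbrakk>is_kernel A k p; is_cokernel A p k\<rbrakk>
    \<Longrightarrow> is_kernel B (FArr F k) (FArr F p) \<and> is_cokernel B (FArr F p) (FArr F k)"

definition faithful :: "('o, 'm) tcat \<Rightarrow> ('o, 'm, 'p, 'q) tfun \<Rightarrow> bool" where
  "faithful A F \<longleftrightarrow> (\<forall>X \<in> Ob A. \<forall>Y \<in> Ob A. inj_on (FArr F) (Hom A X Y))"

text \<open>\<open>comp_tfun D G F\<close> is \<open>G\<close> after \<open>F\<close>; \<open>D\<close> is the target of \<open>G\<close>.\<close>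

definition comp_tfun :: "('r, 's) tcat \<Rightarrow> ('p, 'q, 'r, 's) tfun \<Rightarrow> ('o, 'm, 'p, 'q) tfun
    \<Rightarrow> ('o, 'm, 'r, 's) tfun" where
  "comp_tfun D G F = \<lparr>FOb = FOb G \<circ> FOb F, FArr = FArr G \<circ> FArr F,
     FMu = (\<lambda>X Y. FArr G (FMu F X Y) \<cdot>\<^bsub>D\<^esub> FMu G (FOb F X) (FOb F Y)),
     FEps = FArr G (FEps F) \<cdot>\<^bsub>D\<^esub> FEps G\<rparr>"

locale tensor_nat_iso =
  F: tensor_functor A B F + G: tensor_functor A B G
  for A :: "('o, 'm) tcat" and B :: "('p, 'q) tcat"
    and F :: "('o, 'm, 'p, 'q) tfun" and G :: "('o, 'm, 'p, 'q) tfun" +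
  fixes \<eta> :: "'o \<Rightarrow> 'q"
  assumes component: "X \<in> Ob A \<Longrightarrow> \<eta> X \<in> Hom B (FOb F X) (FOb G X)"
    and component_iso: "X \<in> Ob A \<Longrightarrow> is_iso B (\<eta> X)"
    and natural: "f \<in> Hom A X Y \<Longrightarrow> \<eta> Y \<cdot>\<^bsub>B\<^esub> FArr F f = FArr G f \<cdot>\<^bsub>B\<^esub> \<eta> X"
    and monoidal: "\<lbrakk>X \<in> Ob A; Y \<in> Ob A\<rbrakk>
      \<Longrightarrow> \<eta> (X \<otimes>\<^sub>o\<^bsub>A\<^esub> Y) \<cdot>\<^bsub>B\<^esub> FMu F X Y = FMu G X Y \<cdot>\<^bsub>B\<^esub> (\<eta> X \<otimes>\<^sub>a\<^bsub>B\<^esub> \<eta> Y)"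
    and unital: "\<eta> (Unit A) \<cdot>\<^bsub>B\<^esub> FEps F = FEps G"

definition tensor_isomorphic :: "('o, 'm) tcat \<Rightarrow> ('p, 'q) tcat
    \<Rightarrow> ('o, 'm, 'p, 'q) tfun \<Rightarrow> ('o, 'm, 'p, 'q) tfun \<Rightarrow> bool" where
  "tensor_isomorphic A B F G \<longleftrightarrow> (\<exists>\<eta>. tensor_nat_iso A B F G \<eta>)"

section \<open>The universal rigid abelian tensor category\<close>

text \<open>Composition with \<open>L\<close> is an equivalence from the groupoid of exact tensor functors
  \<open>T \<rightarrow> B\<close> to the groupoid of tensor functors \<open>C \<rightarrow> B\<close>, i.e. it is essentially surjective
  and fully faithful. The components of a natural isomorphism only matter on objects.\<close>

definition precomp_essentially_surjective where
  "precomp_essentially_surjective C T L B \<longleftrightarrow>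
     (\<forall>G. tensor_functor C B G
        \<longrightarrow> (\<exists>F. exact_tensor_functor T B F \<and> tensor_isomorphic C B (comp_tfun B F L) G))"

definition precomp_fully_faithful where
  "precomp_fully_faithful C T L B \<longleftrightarrow>
     (\<forall>F F' \<theta>. exact_tensor_functor T B F \<and> exact_tensor_functor T B F' \<and>
        tensor_nat_iso C B (comp_tfun B F L) (comp_tfun B F' L) \<theta>
        \<longrightarrow> (\<exists>\<eta>. tensor_nat_iso T B F F' \<eta> \<and> (\<forall>X \<in> Ob C. \<eta> (FOb L X) = \<theta> X) \<and>
              (\<forall>\<eta>'. tensor_nat_iso T B F F' \<eta>' \<and> (\<forall>X \<in> Ob C. \<eta>' (FOb L X) = \<theta> X)
                 \<longrightarrow> (\<forall>Y \<in> Ob T. \<eta>' Y = \<eta> Y))))"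

text \<open>Types play the role of universes: the test categories \<open>B\<close> range over all rigid abelian
  tensor categories whose objects and arrows are taken from the two types passed as arguments.\<close>

definition two_universal :: "'p itself \<Rightarrow> 'q itself \<Rightarrow> ('a, 'b) tcat \<Rightarrow> ('c, 'd) tcat
    \<Rightarrow> ('a, 'b, 'c, 'd) tfun \<Rightarrow> bool" where
  "two_universal _ _ C T L \<longleftrightarrow>
     rigid_abelian_category T \<and> tensor_functor C T L \<and>
     (\<forall>B :: ('p, 'q) tcat. rigid_abelian_category B
        \<longrightarrow> precomp_essentially_surjective C T L B \<and> precomp_fully_faithful C T L B)"

section \<open>Serre quotients\<close>

text \<open>Arrows of the Serre quotient of \<open>A\<close> by \<open>S\<close> are the arrows of the localization of \<open>A\<close> at the
  arrows with kernel and cokernel in \<open>S\<close>, described by the calculus of fractions: a roof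
  \<open>(s, f)\<close> with \<open>s : W \<rightarrow> X\<close> in that class and \<open>f : W \<rightarrow> Y\<close> represents \<open>f \<circ> s\<^sup>-\<^sup>1 : X \<rightarrow> Y\<close>.\<close>

definition serre_weq :: "('o, 'm) tcat \<Rightarrow> 'o set \<Rightarrow> 'm set" where
  "serre_weq A S = {s \<in> Arr A. (\<exists>k. is_kernel A k s \<and> Dom A k \<in> S) \<and>
                               (\<exists>c. is_cokernel A c s \<and> Cod A c \<in> S)}"

definition roofs :: "('o, 'm) tcat \<Rightarrow> 'o set \<Rightarrow> ('m \<times> 'm) set" where
  "roofs A S = {(s, f). s \<in> serre_weq A S \<and> f \<in> Arr A \<and> Dom A s = Dom A f}"

definition roof_rel :: "('o, 'm) tcat \<Rightarrow> 'o set \<Rightarrow> (('m \<times> 'm) \<times> ('m \<times> 'm)) set" where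
  "roof_rel A S = {((s, f), (s', f')). (s, f) \<in> roofs A S \<and> (s', f') \<in> roofs A S \<and>
     Cod A s = Cod A s' \<and> Cod A f = Cod A f' \<and>
     (\<exists>W. \<exists>u \<in> Hom A W (Dom A s). \<exists>v \<in> Hom A W (Dom A s').
        s \<cdot>\<^bsub>A\<^esub> u = s' \<cdot>\<^bsub>A\<^esub> v \<and> s \<cdot>\<^bsub>A\<^esub> u \<in> serre_weq A S \<and> f \<cdot>\<^bsub>A\<^esub> u = f' \<cdot>\<^bsub>A\<^esub> v)}"

definition fraction :: "('o, 'm) tcat \<Rightarrow> 'o set \<Rightarrow> 'm \<Rightarrow> 'm \<Rightarrow> ('m \<times> 'm) set" where
  "fraction A S s f = roof_rel A S `` {(s, f)}"

definition quot_arr :: "('o, 'm) tcat \<Rightarrow> 'o set \<Rightarrow> 'm \<Rightarrow> ('m \<times> 'm) set" where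
  "quot_arr A S f = fraction A S (Id A (Dom A f)) f"

text \<open>As usual for operations on equivalence classes, the unions below are unions of equal
  classes, over all choices of representatives and of the auxiliary Ore squares.\<close>

definition quot_comp ::
  "('o, 'm) tcat \<Rightarrow> 'o set \<Rightarrow> ('m \<times> 'm) set \<Rightarrow> ('m \<times> 'm) set \<Rightarrow> ('m \<times> 'm) set" where
  "quot_comp A S d c = \<Union> {fraction A S (s \<cdot>\<^bsub>A\<^esub> t') (g \<cdot>\<^bsub>A\<^esub> f') | s f t g t' f' W.
     (s, f) \<in> c \<and> (t, g) \<in> d \<and>
     t' \<in> Hom A W (Dom A s) \<and> t' \<in> serre_weq A S \<and> f' \<in> Hom A W (Dom A t) \<and>
     f \<cdot>\<^bsub>A\<^esub> t' = t \<cdot>\<^bsub>A\<^esub> f'}"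

definition quot_add ::
  "('o, 'm) tcat \<Rightarrow> 'o set \<Rightarrow> ('m \<times> 'm) set \<Rightarrow> ('m \<times> 'm) set \<Rightarrow> ('m \<times> 'm) set" where
  "quot_add A S c d =
     \<Union> {fraction A S (s \<cdot>\<^bsub>A\<^esub> u) ((f \<cdot>\<^bsub>A\<^esub> u) \<oplus>\<^sub>a\<^bsub>A\<^esub> (g \<cdot>\<^bsub>A\<^esub> v)) | s f t g u v W.
     (s, f) \<in> c \<and> (t, g) \<in> d \<and> u \<in> Hom A W (Dom A s) \<and> v \<in> Hom A W (Dom A t) \<and>
     s \<cdot>\<^bsub>A\<^esub> u = t \<cdot>\<^bsub>A\<^esub> v \<and> s \<cdot>\<^bsub>A\<^esub> u \<in> serre_weq A S}"

definition quot_ten ::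
  "('o, 'm) tcat \<Rightarrow> 'o set \<Rightarrow> ('m \<times> 'm) set \<Rightarrow> ('m \<times> 'm) set \<Rightarrow> ('m \<times> 'm) set" where
  "quot_ten A S c d = \<Union> {fraction A S (s \<otimes>\<^sub>a\<^bsub>A\<^esub> t) (f \<otimes>\<^sub>a\<^bsub>A\<^esub> g) | s f t g.
     (s, f) \<in> c \<and> (t, g) \<in> d}"

definition serre_quotient :: "('o, 'm) tcat \<Rightarrow> 'o set \<Rightarrow> ('o, ('m \<times> 'm) set) tcat" where
  "serre_quotient A S = \<lparr>
     Ob = Ob A,
     Arr = roofs A S // roof_rel A S,
     Dom = (\<lambda>c. THE X. \<exists>(s, f) \<in> c. X = Cod A s),
     Cod = (\<lambda>c. THE Y. \<exists>(s, f) \<in> c. Y = Cod A f),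
     Id = (\<lambda>X. quot_arr A S (Id A X)),
     Comp = quot_comp A S,
     Zero = (\<lambda>X Y. quot_arr A S (Zero A X Y)),
     Add = quot_add A S,
     Unit = Unit A,
     TenO = TenO A,
     TenA = quot_ten A S,
     Assoc = (\<lambda>X Y Z. quot_arr A S (Assoc A X Y Z)),
     LUnit = (\<lambda>X. quot_arr A S (LUnit A X)),
     RUnit = (\<lambda>X. quot_arr A S (RUnit A X)),
     Sym = (\<lambda>X Y. quot_arr A S (Sym A X Y))\<rparr>"

definition serre_proj :: "('o, 'm) tcat \<Rightarrow> 'o set \<Rightarrow> ('o, 'm, 'o, ('m \<times> 'm) set) tfun" where
  "serre_proj A S = \<lparr>
     FOb = (\<lambda>X. X),
     FArr = quot_arr A S,
     FMu = (\<lambda>X Y. quot_arr A S (Id A (X \<otimes>\<^sub>o\<^bsub>A\<^esub> Y))),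
     FEps = quot_arr A S (Id A (Unit A))\<rparr>"

section \<open>The quotient by an ideal of the endomorphism ring of the unit\<close>

definition is_image :: "('o, 'm) tcat \<Rightarrow> 'm \<Rightarrow> 'm \<Rightarrow> bool" where
  "is_image A i f \<longleftrightarrow> f \<in> Arr A \<and> is_mono A i \<and>
     (\<exists>p \<in> Hom A (Dom A f) (Dom A i). is_epi A p \<and> i \<cdot>\<^bsub>A\<^esub> p = f)"

definition complementary :: "('o, 'm) tcat \<Rightarrow> 'm \<Rightarrow> 'm \<Rightarrow> bool" where
  "complementary A k s \<longleftrightarrow> Cod A k = Cod A s \<and>
     (\<exists>p q. is_biproduct A (Dom A k) (Dom A s) (Cod A k) k s p q)"

text \<open>The idempotent \<open>e(X)\<close>: here \<open>k\<close> is the kernel of \<open>1 \<rightarrow> D \<otimes> X\<close> and \<open>s\<close> is \<open>Supp(X) \<rightarrow> 1\<close>.\<close>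

definition supp_idem :: "('o, 'm) tcat \<Rightarrow> 'o \<Rightarrow> 'm" where
  "supp_idem A X = (THE e. e \<in> carrier (Z_ring A) \<and> e \<cdot>\<^bsub>A\<^esub> e = e \<and>
     (\<exists>D ev coev k s. is_dual A X D ev coev \<and> is_kernel A k coev \<and> complementary A k s \<and>
        is_image A s e \<and> is_kernel A k e))"

definition supp_subcat :: "('o, 'm) tcat \<Rightarrow> 'm set \<Rightarrow> 'o set" where
  "supp_subcat A I = {X \<in> Ob A. supp_idem A X \<in> I}"

definition ideal_quotient :: "('o, 'm) tcat \<Rightarrow> 'm set \<Rightarrow> ('o, ('m \<times> 'm) set) tcat" where
  "ideal_quotient A I = serre_quotient A (supp_subcat A I)"

definition ideal_proj :: "('o, 'm) tcat \<Rightarrow> 'm set \<Rightarrow> ('o, 'm, 'o, ('m \<times> 'm) set) tfun" where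
  "ideal_proj A I = serre_proj A (supp_subcat A I)"

definition local_envelope :: "('c, 'd) tcat \<Rightarrow> ('a, 'b, 'c, 'd) tfun \<Rightarrow> 'd set
    \<Rightarrow> ('a, 'b, 'c, ('d \<times> 'd) set) tfun" where
  "local_envelope T L M = comp_tfun (ideal_quotient T M) (ideal_proj T M) L"

definition envelope_ideals ::
  "('a, 'b) tcat \<Rightarrow> ('c, 'd) tcat \<Rightarrow> ('a, 'b, 'c, 'd) tfun \<Rightarrow> 'd set set" where
  "envelope_ideals C T L =
     {M. maximalideal M (Z_ring T) \<and> faithful C (local_envelope T L M)}"

definition factors_faithfully ::
  "('c, 'd) tcat \<Rightarrow> 'd set \<Rightarrow> ('p, 'q) tcat \<Rightarrow> ('c, 'd, 'p, 'q) tfun \<Rightarrow> bool" where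
  "factors_faithfully T M B F \<longleftrightarrow>
     (\<exists>H. exact_tensor_functor (ideal_quotient T M) B H \<and> faithful (ideal_quotient T M) H \<and>
        tensor_isomorphic T B F (comp_tfun B H (ideal_proj T M)))"

section \<open>The prime spectrum with the Zariski topology\<close>

definition prime_nonvanishing :: "('m, 'x) ring_scheme \<Rightarrow> 'm set \<Rightarrow> 'm set set" where
  "prime_nonvanishing R I = {P. primeideal P R \<and> \<not> I \<subseteq> P}"

definition zariski :: "('m, 'x) ring_scheme \<Rightarrow> 'm set topology" where
  "zariski R = topology (\<lambda>U. \<exists>I \<subseteq> carrier R. U = prime_nonvanishing R I)"

lemma prime_nonvanishing_Int:
  assumes "I \<subseteq> carrier R" "J \<subseteq> carrier R"
  shows "\<exists>K \<subseteq> carrier R. prime_nonvanishing R I \<inter> prime_nonvanishing R J = prime_nonvanishing R K"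
proof (cases "\<exists>P. primeideal P R")
  case False
  then have "prime_nonvanishing R K = {}" for K
    by (simp add: prime_nonvanishing_def)
  then show ?thesis by blast
next
  case True
  then obtain P0 where "primeideal P0 R" by blast
  then interpret cring R by (simp add: primeideal_def)
  define K where "K = {x \<otimes>\<^bsub>R\<^esub> y | x y. x \<in> I \<and> y \<in> J}"
  have K: "K \<subseteq> carrier R"
  proof
    fix z assume "z \<in> K"
    then obtain x y where "z = x \<otimes>\<^bsub>R\<^esub> y" "x \<in> I" "y \<in> J"
      unfolding K_def by blast
    then show "z \<in> carrier R" using assms by (simp add: subset_iff)
  qed
  have eq: "K \<subseteq> P \<longleftrightarrow> I \<subseteq> P \<or> J \<subseteq> P" if P: "primeideal P R" for P
  proof -
    interpret P: primeideal P R by (fact P)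
    have "I \<subseteq> P \<or> J \<subseteq> P" if "K \<subseteq> P"
    proof (rule ccontr)
      assume "\<not> (I \<subseteq> P \<or> J \<subseteq> P)"
      then obtain x y where xy: "x \<in> I" "x \<notin> P" "y \<in> J" "y \<notin> P" by blast
      then have "x \<otimes>\<^bsub>R\<^esub> y \<in> P" using \<open>K \<subseteq> P\<close> unfolding K_def by blast
      moreover have "x \<in> carrier R" "y \<in> carrier R" using xy assms by auto
      ultimately show False using P.I_prime xy by blast
    qed
    moreover have "z \<in> P" if z: "z \<in> K" and IJ: "I \<subseteq> P \<or> J \<subseteq> P" for z
    proof -
      obtain x y where xy: "z = x \<otimes>\<^bsub>R\<^esub> y" "x \<in> I" "y \<in> J"
        using z unfolding K_def by blast
      then have "x \<in> carrier R" "y \<in> carrier R" using assms by auto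
      with xy IJ show ?thesis using P.I_l_closed P.I_r_closed by (metis subsetD)
    qed
    ultimately show ?thesis by blast
  qed
  have "prime_nonvanishing R I \<inter> prime_nonvanishing R J = prime_nonvanishing R K"
  proof (rule Set.set_eqI)
    show "P \<in> prime_nonvanishing R I \<inter> prime_nonvanishing R J \<longleftrightarrow> P \<in> prime_nonvanishing R K" for P
      using eq[of P] unfolding prime_nonvanishing_def Int_iff mem_Collect_eq by blast
  qed
  with K show ?thesis by blast
qed

lemma prime_nonvanishing_Union:
  "(\<Union>I\<in>\<I>. prime_nonvanishing R I) = prime_nonvanishing R (\<Union>\<I>)"
  unfolding prime_nonvanishing_def by (simp add: set_eq_iff Sup_le_iff)

lemma openin_zariski_iff:
  "openin (zariski R) U \<longleftrightarrow> (\<exists>I \<subseteq> carrier R. U = prime_nonvanishing R I)"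
proof -
  let ?op = "\<lambda>U. \<exists>I \<subseteq> carrier R. U = prime_nonvanishing R I"
  have "?op (U \<inter> V)" if "?op U" "?op V" for U V
  proof -
    from that obtain I J where "I \<subseteq> carrier R" "U = prime_nonvanishing R I"
      "J \<subseteq> carrier R" "V = prime_nonvanishing R J" by metis
    then show ?thesis using prime_nonvanishing_Int[of I R J] by simp
  qed
  moreover have "?op (\<Union>\<U>)" if "\<forall>U\<in>\<U>. ?op U" for \<U>
  proof -
    let ?\<I> = "{I. I \<subseteq> carrier R \<and> prime_nonvanishing R I \<in> \<U>}"
    have "\<Union>\<U> = (\<Union>I\<in>?\<I>. prime_nonvanishing R I)"
    proof (rule Set.set_eqI, rule iffI)
      fix P assume "P \<in> \<Union>\<U>"
      then obtain U where "U \<in> \<U>" "P \<in> U" by blast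
      moreover from this that obtain I where "I \<subseteq> carrier R" "U = prime_nonvanishing R I"
        by metis
      ultimately show "P \<in> (\<Union>I\<in>?\<I>. prime_nonvanishing R I)"
        by (intro UN_I[of I]) simp_all
    next
      fix P assume "P \<in> (\<Union>I\<in>?\<I>. prime_nonvanishing R I)"
      then show "P \<in> \<Union>\<U>" by blast
    qed
    also have "\<dots> = prime_nonvanishing R (\<Union>?\<I>)"
      by (rule prime_nonvanishing_Union)
    finally show ?thesis by (intro exI[of _ "\<Union>?\<I>"]) blast
  qed
  ultimately have "istopology ?op"
    unfolding istopology_def by (intro conjI allI impI)
  then show ?thesis by (simp add: zariski_def topology_inverse')
qed

lemma prime_nonvanishing_carrier: "prime_nonvanishing R (carrier R) = {P. primeideal P R}"
proof -
  have "\<not> carrier R \<subseteq> P" if "primeideal P R" for P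
  proof -
    interpret primeideal P R by (fact that)
    show ?thesis using I_notcarr a_subset by blast
  qed
  then show ?thesis by (auto simp: prime_nonvanishing_def)
qed

lemma topspace_zariski: "topspace (zariski R) = {P. primeideal P R}"
proof
  have "openin (zariski R) (prime_nonvanishing R (carrier R))"
    using openin_zariski_iff by blast
  then show "{P. primeideal P R} \<subseteq> topspace (zariski R)"
    unfolding prime_nonvanishing_carrier by (rule openin_subset)
  obtain I where "topspace (zariski R) = prime_nonvanishing R I"
    using openin_topspace[of "zariski R"] unfolding openin_zariski_iff by blast
  then show "topspace (zariski R) \<subseteq> {P. primeideal P R}"
    by (simp add: prime_nonvanishing_def subset_iff)
qed

end

theory Submission
  imports Defs "HOL-Algebra.Ring_Divisibility"
begin

text \<open>Write \<open>Z = Z(T)\<close>; it acts on all Hom groups and the action is central. Right exactness of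
  \<open>\<otimes>\<close> splits every epimorphism \<open>1 \<rightarrow> V\<close>, so \<open>Z\<close> is von Neumann regular and its primes are maximal,
  and \<open>w e(X) = 0\<close> iff \<open>w\<close> kills \<open>X\<close>. Hence \<open>e(X) \<in> M\<close> iff \<open>X\<close> is killed by some idempotent
  \<open>w\<close> with \<open>1 - w \<in> M\<close>, and an arrow with such a kernel and cokernel is invertible modulo the
  congruence \<open>f \<approx> g \<longleftrightarrow> (\<exists>w. w f = w g)\<close>. So \<open>T // M\<close> is the quotient of \<open>T\<close> by this
  congruence, the projection is full, and the axioms of a connected rigid abelian tensor category
  can be checked on representatives.

  For an exact \<open>F : T \<rightarrow> B\<close> with \<open>B\<close> connected, the kernel \<open>M\<close> of \<open>Z \<rightarrow> Z(B)\<close> is prime. If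
  \<open>F f = 0\<close>, the support of the image of \<open>f\<close> lies in \<open>M\<close>, so \<open>F\<close> factors faithfully through
  \<open>T // M\<close>; conversely a faithful factorization through \<open>T // M'\<close> recovers \<open>M'\<close> as the same
  kernel. Finally, \<open>C \<rightarrow> T // M\<close> is faithful iff \<open>M\<close> contains all idempotents that equalize the
  images of two distinct parallel arrows of \<open>C\<close>, which is a closed condition.\<close>

section \<open>Abelian categories and duality of categories\<close>

text \<open>Regularity lets idempotents stand in for ideals: if \<open>z = z x z\<close>, then
  \<open>x z\<close> is an idempotent generating the ideal of \<open>z\<close>. Hence every ideal
  \<open>M\<close> of \<open>Z\<close> is generated by its idempotents, and killing \<open>M\<close>
  amounts to inverting the idempotents \<open>w\<close> with \<open>1 - w\<close> in
  \<open>M\<close>. An inverted idempotent becomes 1, so no new arrows arise; this is why a fraction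
  in the Serre quotient is always represented by an arrow of \<open>T\<close>. The monoidal
  computations do not appeal to a coherence theorem. Where two composites of constraints would have
  to be compared, their discrepancy is kept as an unknown isomorphism or scalar, and centrality of
  the action or mere invertibility disposes of it. The universal property enters twice: essential
  surjectivity supplies an \<open>F\<close> inducing \<open>G\<close>, and full faithfulness makes
  any two such \<open>F\<close> isomorphic, so that all of them have the same kernel
  \<open>M\<close> on \<open>Z\<close>. Faithfulness of \<open>G\<close> passes to the local
  envelope at \<open>M\<close> because \<open>F\<close> maps the inverted idempotents to 1: arrows
  identified modulo \<open>M\<close> already have equal images under \<open>G\<close>.\<close>

lemma Hom_iff: "f \<in> Hom A X Y \<longleftrightarrow> f \<in> Arr A \<and> Dom A f = X \<and> Cod A f = Y"
  by (auto simp: Hom_def)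

text \<open>\<open>is_iso\<close> only asserts that an inverse exists. A chosen inverse is a term,
  which formulas such as the action of scalars below require.\<close>

definition inv_arr :: "('o, 'm) tcat \<Rightarrow> 'm \<Rightarrow> 'm" where
  "inv_arr A f = (SOME g. g \<in> Hom A (Cod A f) (Dom A f) \<and>
     g \<cdot>\<^bsub>A\<^esub> f = Id A (Dom A f) \<and> f \<cdot>\<^bsub>A\<^esub> g = Id A (Cod A f))"

context category
begin

lemma Dom_Ob [simp]: "f \<in> Arr A \<Longrightarrow> Dom A f \<in> Ob A"
  and Cod_Ob [simp]: "f \<in> Arr A \<Longrightarrow> Cod A f \<in> Ob A"
  by (simp_all add: dom_Ob cod_Ob)

lemma Id_simps [simp]:
  "X \<in> Ob A \<Longrightarrow> Id A X \<in> Arr A"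
  "X \<in> Ob A \<Longrightarrow> Dom A (Id A X) = X"
  "X \<in> Ob A \<Longrightarrow> Cod A (Id A X) = X"
  using id_hom by (auto simp: Hom_iff)

lemma Comp_simps [simp]:
  assumes "f \<in> Arr A" "g \<in> Arr A" "Dom A g = Cod A f"
  shows "g \<cdot> f \<in> Arr A" "Dom A (g \<cdot> f) = Dom A f" "Cod A (g \<cdot> f) = Cod A g"
  using comp_hom[of f "Dom A f" "Cod A f" g "Cod A g"] assms by (auto simp: Hom_iff)

lemma Comp_Id [simp]:
  "f \<in> Arr A \<Longrightarrow> Dom A f = X \<Longrightarrow> f \<cdot> Id A X = f"
  "f \<in> Arr A \<Longrightarrow> Cod A f = X \<Longrightarrow> Id A X \<cdot> f = f"
  using comp_id_right[of f X] comp_id_left[of f _ X] by (auto simp: Hom_iff)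

lemma Comp_assoc:
  assumes "f \<in> Arr A" "g \<in> Arr A" "h \<in> Arr A" "Dom A g = Cod A f" "Dom A h = Cod A g"
  shows "(h \<cdot> g) \<cdot> f = h \<cdot> (g \<cdot> f)"
  using comp_assoc[of f "Dom A f" "Cod A f" g "Cod A g" h "Cod A h"] assms
  by (auto simp: Hom_iff)

text \<open>Turns an equation for a two-fold composite into a rewrite rule for right-nested
  composites, the normal form produced by \<open>Comp_assoc\<close>.\<close>

lemma Comp_assoc_eq:
  assumes "h \<cdot> g = k" "f \<in> Arr A" "g \<in> Arr A" "h \<in> Arr A" "Dom A g = Cod A f" "Dom A h = Cod A g"
  shows "h \<cdot> (g \<cdot> f) = k \<cdot> f"
  using Comp_assoc[of f g h] assms by simp

lemma is_isoI:
  assumes "f \<in> Arr A" "g \<in> Arr A" "Dom A g = Cod A f" "Cod A g = Dom A f"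
    "g \<cdot> f = Id A (Dom A f)" "f \<cdot> g = Id A (Cod A f)"
  shows "is_iso A f"
  unfolding is_iso_def using assms by (auto simp: Hom_iff)

lemma is_iso_Arr: "is_iso A f \<Longrightarrow> f \<in> Arr A"
  by (simp add: is_iso_def)

lemma inv_arr:
  assumes "is_iso A f"
  shows "inv_arr A f \<in> Arr A" "Dom A (inv_arr A f) = Cod A f" "Cod A (inv_arr A f) = Dom A f"
    "inv_arr A f \<cdot> f = Id A (Dom A f)" "f \<cdot> inv_arr A f = Id A (Cod A f)"
proof -
  have "\<exists>g. g \<in> Hom A (Cod A f) (Dom A f) \<and> g \<cdot> f = Id A (Dom A f) \<and> f \<cdot> g = Id A (Cod A f)"
    using assms by (auto simp: is_iso_def)
  from someI_ex[OF this] show "inv_arr A f \<in> Arr A" "Dom A (inv_arr A f) = Cod A f"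
    "Cod A (inv_arr A f) = Dom A f" "inv_arr A f \<cdot> f = Id A (Dom A f)"
    "f \<cdot> inv_arr A f = Id A (Cod A f)"
    by (auto simp: inv_arr_def Hom_iff)
qed

lemma inv_arr_cancel:
  assumes "is_iso A f" "h \<in> Arr A"
  shows "Cod A h = Dom A f \<Longrightarrow> inv_arr A f \<cdot> (f \<cdot> h) = h"
    "Cod A h = Cod A f \<Longrightarrow> f \<cdot> (inv_arr A f \<cdot> h) = h"
  using inv_arr[OF assms(1)] is_iso_Arr[OF assms(1)] assms(2)
  by (simp_all add: Comp_assoc_eq)

lemma is_iso_inv_arr:
  assumes "is_iso A f"
  shows "is_iso A (inv_arr A f)"
  using is_isoI[of "inv_arr A f" f] inv_arr[OF assms] is_iso_Arr[OF assms] by simp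

lemma is_iso_Id: "X \<in> Ob A \<Longrightarrow> is_iso A (Id A X)"
  by (rule is_isoI[of _ "Id A X"]) simp_all

lemma is_iso_Comp:
  assumes "is_iso A f" "is_iso A g" "Dom A g = Cod A f"
  shows "is_iso A (g \<cdot> f)"
  by (rule is_isoI[of _ "inv_arr A f \<cdot> inv_arr A g"])
    (use assms inv_arr[OF assms(1)] inv_arr[OF assms(2)] is_iso_Arr[OF assms(1)]
      is_iso_Arr[OF assms(2)] in \<open>simp_all add: Comp_assoc inv_arr_cancel\<close>)

lemma iso_cancel_left:
  assumes "is_iso A f" "g \<in> Arr A" "h \<in> Arr A" "Cod A g = Dom A f" "Cod A h = Dom A f"
  shows "f \<cdot> g = f \<cdot> h \<longleftrightarrow> g = h"
  using assms inv_arr_cancel(1) by metis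

lemma iso_cancel_right:
  assumes "is_iso A f" "g \<in> Arr A" "h \<in> Arr A" "Dom A g = Cod A f" "Dom A h = Cod A f"
  shows "g \<cdot> f = h \<cdot> f \<longleftrightarrow> g = h"
proof
  assume "g \<cdot> f = h \<cdot> f"
  then have "(g \<cdot> f) \<cdot> inv_arr A f = (h \<cdot> f) \<cdot> inv_arr A f" by simp
  then show "g = h"
    using assms inv_arr[OF assms(1)] is_iso_Arr[OF assms(1)] by (simp add: Comp_assoc)
qed simp

lemma is_monoD:
  assumes "is_mono A m" "m \<cdot> f = m \<cdot> g" "f \<in> Arr A" "g \<in> Arr A" "Dom A f = Dom A g"
    "Cod A f = Dom A m" "Cod A g = Dom A m"
  shows "f = g"
  using assms unfolding is_mono_def by (auto simp: Hom_iff)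

lemma is_epiD:
  assumes "is_epi A p" "f \<cdot> p = g \<cdot> p" "f \<in> Arr A" "g \<in> Arr A" "Cod A f = Cod A g"
    "Dom A f = Cod A p" "Dom A g = Cod A p"
  shows "f = g"
  using assms unfolding is_epi_def by (auto simp: Hom_iff)

lemma is_mono_Comp:
  assumes "is_mono A m" "is_mono A n" "Dom A m = Cod A n"
  shows "is_mono A (m \<cdot> n)"
  unfolding is_mono_def
proof (intro conjI allI ballI impI)
  have mn: "m \<in> Arr A" "n \<in> Arr A" using assms by (simp_all add: is_mono_def)
  then show "m \<cdot> n \<in> Arr A" using assms(3) by simp
  fix W f g assume "f \<in> Hom A W (Dom A (m \<cdot> n))" "g \<in> Hom A W (Dom A (m \<cdot> n))"
    "m \<cdot> n \<cdot> f = m \<cdot> n \<cdot> g"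
  with mn assms(3) have a: "f \<in> Arr A" "g \<in> Arr A" "Dom A f = Dom A g" "Cod A f = Dom A n"
    "Cod A g = Dom A n" "m \<cdot> (n \<cdot> f) = m \<cdot> (n \<cdot> g)"
    by (simp_all add: Hom_iff Comp_assoc)
  then have "n \<cdot> f = n \<cdot> g"
    using is_monoD[OF assms(1) a(6)] mn assms(3) by simp
  then show "f = g" using is_monoD[OF assms(2)] a by blast
qed

lemma is_mono_if_left_inverse:
  assumes "m \<in> Arr A" "r \<in> Arr A" "Dom A r = Cod A m" "r \<cdot> m = Id A (Dom A m)"
  shows "is_mono A m"
  unfolding is_mono_def
proof (intro conjI allI ballI impI)
  fix W f g assume a: "f \<in> Hom A W (Dom A m)" "g \<in> Hom A W (Dom A m)" "m \<cdot> f = m \<cdot> g"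
  have "r \<cdot> (m \<cdot> f) = f" "r \<cdot> (m \<cdot> g) = g"
    using a(1,2) assms by (simp_all add: Hom_iff Comp_assoc_eq)
  with a(3) show "f = g" by metis
qed (fact assms)

lemma iso_is_mono: "is_iso A f \<Longrightarrow> is_mono A f"
  by (rule is_mono_if_left_inverse[of _ "inv_arr A f"]) (simp_all add: inv_arr is_iso_Arr)

end

text \<open>Only the fields on which the additive and abelian notions depend are reversed. The
  monoidal fields are left as they are, so \<open>opp A\<close> serves as an additive or abelian
  category and never as a tensor category.\<close>

definition opp :: "('o, 'm) tcat \<Rightarrow> ('o, 'm) tcat" where
  "opp A = A\<lparr>Dom := Cod A, Cod := Dom A, Comp := (\<lambda>g f. f \<cdot>\<^bsub>A\<^esub> g), Zero := (\<lambda>X Y. Zero A Y X)\<rparr>"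

lemma opp_simps [simp]:
  "Ob (opp A) = Ob A" "Arr (opp A) = Arr A" "Dom (opp A) = Cod A" "Cod (opp A) = Dom A"
  "Id (opp A) = Id A" "Comp (opp A) g f = f \<cdot>\<^bsub>A\<^esub> g" "Zero (opp A) X Y = Zero A Y X"
  "Add (opp A) = Add A"
  by (simp_all add: opp_def)

lemma opp_Hom [simp]: "Hom (opp A) X Y = Hom A Y X"
  by (auto simp: Hom_def)

lemma opp_mono_epi [simp]:
  "is_mono (opp A) f = is_epi A f" "is_epi (opp A) f = is_mono A f"
  "is_kernel (opp A) k f = is_cokernel A k f" "is_cokernel (opp A) k f = is_kernel A k f"
  by (simp_all add: is_mono_def is_epi_def is_kernel_def is_cokernel_def)

lemma opp_zero_object [simp]: "is_zero_object (opp A) Z = is_zero_object A Z"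
  by (simp add: is_zero_object_def conj_commute)

lemma opp_iso [simp]: "is_iso (opp A) f = is_iso A f"
  unfolding is_iso_def by (simp only: opp_simps opp_Hom) blast

lemma (in category) category_opp: "category (opp A)"
  by unfold_locales (auto simp: Hom_iff Comp_assoc)

context category
begin

interpretation opp: category "opp A" by (rule category_opp)

lemma iso_is_epi: "is_iso A f \<Longrightarrow> is_epi A f"
  using opp.iso_is_mono[of f] by simp

lemma is_epi_Comp:
  assumes "is_epi A q" "is_epi A p" "Dom A q = Cod A p"
  shows "is_epi A (q \<cdot> p)"
  using opp.is_mono_Comp[of p q] assms by simp

end

section \<open>Arithmetic of arrows, kernels and cokernels in an additive category\<close>

definition Neg :: "('o, 'm) tcat \<Rightarrow> 'm \<Rightarrow> 'm" where
  "Neg A f = inv\<^bsub>hom_group A (Dom A f) (Cod A f)\<^esub> f"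

definition Sub :: "('o, 'm) tcat \<Rightarrow> 'm \<Rightarrow> 'm \<Rightarrow> 'm" where
  "Sub A f g = f \<oplus>\<^sub>a\<^bsub>A\<^esub> Neg A g"

context additive_category
begin

lemma Zero_simps [simp]:
  assumes "X \<in> Ob A" "Y \<in> Ob A"
  shows "Zero A X Y \<in> Arr A" "Dom A (Zero A X Y) = X" "Cod A (Zero A X Y) = Y"
proof -
  interpret G: comm_group "hom_group A X Y" using assms by (rule hom_comm_group)
  show "Zero A X Y \<in> Arr A" "Dom A (Zero A X Y) = X" "Cod A (Zero A X Y) = Y"
    using G.one_closed by (auto simp: hom_group_def Hom_iff)
qed

lemma Add_simps [simp]:
  assumes "f \<in> Arr A" "g \<in> Arr A" "Dom A g = Dom A f" "Cod A g = Cod A f"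
  shows "f \<oplus>\<^sub>a g \<in> Arr A" "Dom A (f \<oplus>\<^sub>a g) = Dom A f" "Cod A (f \<oplus>\<^sub>a g) = Cod A f"
proof -
  interpret G: comm_group "hom_group A (Dom A f) (Cod A f)" using assms by (intro hom_comm_group) auto
  show "f \<oplus>\<^sub>a g \<in> Arr A" "Dom A (f \<oplus>\<^sub>a g) = Dom A f" "Cod A (f \<oplus>\<^sub>a g) = Cod A f"
    using G.m_closed[of f g] assms by (auto simp: hom_group_def Hom_iff)
qed

lemma Neg_simps [simp]:
  assumes "f \<in> Arr A"
  shows "Neg A f \<in> Arr A" "Dom A (Neg A f) = Dom A f" "Cod A (Neg A f) = Cod A f"
    "Neg A f \<oplus>\<^sub>a f = Zero A (Dom A f) (Cod A f)" "f \<oplus>\<^sub>a Neg A f = Zero A (Dom A f) (Cod A f)"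
proof -
  interpret G: comm_group "hom_group A (Dom A f) (Cod A f)" using assms by (intro hom_comm_group) auto
  show "Neg A f \<in> Arr A" "Dom A (Neg A f) = Dom A f" "Cod A (Neg A f) = Cod A f"
    "Neg A f \<oplus>\<^sub>a f = Zero A (Dom A f) (Cod A f)" "f \<oplus>\<^sub>a Neg A f = Zero A (Dom A f) (Cod A f)"
    using G.inv_closed[of f] G.l_inv[of f] G.r_inv[of f] assms
    by (auto simp: hom_group_def Hom_iff Neg_def)
qed

lemma Add_assoc:
  assumes "f \<in> Arr A" "g \<in> Arr A" "h \<in> Arr A" "Dom A g = Dom A f" "Cod A g = Cod A f"
    "Dom A h = Dom A f" "Cod A h = Cod A f"
  shows "f \<oplus>\<^sub>a g \<oplus>\<^sub>a h = f \<oplus>\<^sub>a (g \<oplus>\<^sub>a h)"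
proof -
  interpret G: comm_group "hom_group A (Dom A f) (Cod A f)" using assms by (intro hom_comm_group) auto
  show ?thesis using G.m_assoc[of f g h] assms by (auto simp: hom_group_def Hom_iff)
qed

lemma Add_commute:
  assumes "f \<in> Arr A" "g \<in> Arr A" "Dom A g = Dom A f" "Cod A g = Cod A f"
  shows "f \<oplus>\<^sub>a g = g \<oplus>\<^sub>a f"
proof -
  interpret G: comm_group "hom_group A (Dom A f) (Cod A f)" using assms by (intro hom_comm_group) auto
  show ?thesis using G.m_comm[of f g] assms by (auto simp: hom_group_def Hom_iff)
qed

lemma Add_left_commute:
  assumes "f \<in> Arr A" "g \<in> Arr A" "h \<in> Arr A" "Dom A g = Dom A f" "Cod A g = Cod A f"
    "Dom A h = Dom A f" "Cod A h = Cod A f"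
  shows "f \<oplus>\<^sub>a (g \<oplus>\<^sub>a h) = g \<oplus>\<^sub>a (f \<oplus>\<^sub>a h)"
  using assms Add_assoc[of f g h] Add_assoc[of g f h] Add_commute[of f g] by simp

lemmas Add_ac = Add_assoc Add_commute Add_left_commute

lemma Add_Zero [simp]:
  assumes "f \<in> Arr A" "Dom A f = X" "Cod A f = Y"
  shows "f \<oplus>\<^sub>a Zero A X Y = f" "Zero A X Y \<oplus>\<^sub>a f = f"
proof -
  interpret G: comm_group "hom_group A X Y" using assms by (intro hom_comm_group) auto
  show "f \<oplus>\<^sub>a Zero A X Y = f" "Zero A X Y \<oplus>\<^sub>a f = f"
    using G.l_one[of f] G.r_one[of f] assms by (auto simp: hom_group_def Hom_iff)
qed

lemma Add_cancel_left:
  assumes "f \<in> Arr A" "g \<in> Arr A" "h \<in> Arr A" "Dom A g = Dom A f" "Cod A g = Cod A f"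
    "Dom A h = Dom A f" "Cod A h = Cod A f"
  shows "f \<oplus>\<^sub>a g = f \<oplus>\<^sub>a h \<longleftrightarrow> g = h"
proof -
  interpret G: comm_group "hom_group A (Dom A f) (Cod A f)" using assms by (intro hom_comm_group) auto
  show ?thesis using G.Units_l_cancel[of f g h] G.Units_eq assms by (auto simp: hom_group_def Hom_iff)
qed

lemma Comp_Add_right:
  assumes "f \<in> Arr A" "f' \<in> Arr A" "g \<in> Arr A" "Dom A f' = Dom A f" "Cod A f' = Cod A f"
    "Dom A g = Cod A f"
  shows "g \<cdot> (f \<oplus>\<^sub>a f') = (g \<cdot> f) \<oplus>\<^sub>a (g \<cdot> f')"
  using comp_add_right[of f "Dom A f" "Cod A f" f' g "Cod A g"] assms by (auto simp: Hom_iff)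

lemma Comp_Add_left:
  assumes "f \<in> Arr A" "g' \<in> Arr A" "g \<in> Arr A" "Dom A g' = Dom A g" "Cod A g' = Cod A g"
    "Dom A g = Cod A f"
  shows "(g \<oplus>\<^sub>a g') \<cdot> f = (g \<cdot> f) \<oplus>\<^sub>a (g' \<cdot> f)"
  using comp_add_left[of f "Dom A f" "Cod A f" g "Cod A g" g'] assms by (auto simp: Hom_iff)

text \<open>An additive operation sends a zero arrow to an arrow equal to its own double. This is
  how composition, the tensor product and functors are shown to preserve zero arrows.\<close>

lemma Add_idem_Zero:
  assumes "f \<in> Arr A" "f \<oplus>\<^sub>a f = f" shows "f = Zero A (Dom A f) (Cod A f)"
  using Add_cancel_left[of f f "Zero A (Dom A f) (Cod A f)"] assms by simp

lemma Comp_Zero [simp]: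
  "g \<in> Arr A \<Longrightarrow> X \<in> Ob A \<Longrightarrow> Dom A g = Y \<Longrightarrow> g \<cdot> Zero A X Y = Zero A X (Cod A g)"
  "f \<in> Arr A \<Longrightarrow> X \<in> Ob A \<Longrightarrow> Cod A f = Y \<Longrightarrow> Zero A Y X \<cdot> f = Zero A (Dom A f) X"
proof -
  assume a: "g \<in> Arr A" "X \<in> Ob A" "Dom A g = Y"
  then have Y: "Y \<in> Ob A" by auto
  have "g \<cdot> Zero A X Y \<oplus>\<^sub>a g \<cdot> Zero A X Y = g \<cdot> Zero A X Y"
    using a Y by (simp flip: Comp_Add_right)
  from Add_idem_Zero[OF _ this] show "g \<cdot> Zero A X Y = Zero A X (Cod A g)"
    using a Y by simp
next
  assume a: "f \<in> Arr A" "X \<in> Ob A" "Cod A f = Y"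
  then have Y: "Y \<in> Ob A" by auto
  have "Zero A Y X \<cdot> f \<oplus>\<^sub>a Zero A Y X \<cdot> f = Zero A Y X \<cdot> f"
    using a Y by (simp flip: Comp_Add_left)
  from Add_idem_Zero[OF _ this] show "Zero A Y X \<cdot> f = Zero A (Dom A f) X"
    using a Y by simp
qed

lemma Neg_unique:
  assumes "f \<in> Arr A" "g \<in> Arr A" "Dom A g = Dom A f" "Cod A g = Cod A f"
    "f \<oplus>\<^sub>a g = Zero A (Dom A f) (Cod A f)"
  shows "g = Neg A f"
  using Add_cancel_left[of f g "Neg A f"] assms by simp

lemma Comp_Neg:
  assumes "f \<in> Arr A" "g \<in> Arr A" "Dom A g = Cod A f"
  shows "g \<cdot> Neg A f = Neg A (g \<cdot> f)" "Neg A g \<cdot> f = Neg A (g \<cdot> f)"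
  by (rule Neg_unique; use assms in \<open>simp flip: Comp_Add_right Comp_Add_left\<close>)+

lemma Sub_simps [simp]:
  assumes "f \<in> Arr A" "g \<in> Arr A" "Dom A g = Dom A f" "Cod A g = Cod A f"
  shows "Sub A f g \<in> Arr A" "Dom A (Sub A f g) = Dom A f" "Cod A (Sub A f g) = Cod A f"
  using assms by (simp_all add: Sub_def)

lemma Sub_Add:
  assumes "f \<in> Arr A" "g \<in> Arr A" "Dom A g = Dom A f" "Cod A g = Cod A f"
  shows "g \<oplus>\<^sub>a Sub A f g = f" "Sub A f g \<oplus>\<^sub>a g = f"
  using assms by (simp_all add: Sub_def Add_ac)

lemma Sub_eq_iff:
  assumes "f \<in> Arr A" "g \<in> Arr A" "h \<in> Arr A" "Dom A g = Dom A f" "Cod A g = Cod A f"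
    "Dom A h = Dom A f" "Cod A h = Cod A f"
  shows "Sub A f g = h \<longleftrightarrow> f = g \<oplus>\<^sub>a h"
  using assms Sub_Add(1)[of f g] Add_cancel_left[of g "Sub A f g" h] by auto

lemma Sub_eq_Zero_iff:
  assumes "f \<in> Arr A" "g \<in> Arr A" "Dom A g = Dom A f" "Cod A g = Cod A f"
    "X = Dom A f" "Y = Cod A f"
  shows "Sub A f g = Zero A X Y \<longleftrightarrow> f = g"
  using assms by (simp add: Sub_eq_iff)

lemma Comp_Sub:
  assumes "f \<in> Arr A" "f' \<in> Arr A" "g \<in> Arr A" "Dom A f' = Dom A f" "Cod A f' = Cod A f"
    "Dom A g = Cod A f"
  shows "g \<cdot> Sub A f f' = Sub A (g \<cdot> f) (g \<cdot> f')"
  using assms by (simp add: Sub_def Comp_Add_right Comp_Neg)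

lemma Sub_Comp:
  assumes "f \<in> Arr A" "g \<in> Arr A" "g' \<in> Arr A" "Dom A g' = Dom A g" "Cod A g' = Cod A g"
    "Dom A g = Cod A f"
  shows "Sub A g g' \<cdot> f = Sub A (g \<cdot> f) (g' \<cdot> f)"
  using assms by (simp add: Sub_def Comp_Add_left Comp_Neg)

lemma is_monoI:
  assumes "m \<in> Arr A"
    "\<And>f. f \<in> Arr A \<Longrightarrow> Cod A f = Dom A m \<Longrightarrow> m \<cdot> f = Zero A (Dom A f) (Cod A m)
      \<Longrightarrow> f = Zero A (Dom A f) (Dom A m)"
  shows "is_mono A m"
  unfolding is_mono_def
proof (intro conjI allI ballI impI)
  fix W f g assume "f \<in> Hom A W (Dom A m)" "g \<in> Hom A W (Dom A m)" "m \<cdot> f = m \<cdot> g"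
  then have a: "f \<in> Arr A" "g \<in> Arr A" "Dom A f = W" "Cod A f = Dom A m" "Dom A g = W"
    "Cod A g = Dom A m" "m \<cdot> Sub A f g = Zero A W (Cod A m)"
    using assms(1) by (auto simp: Hom_iff Comp_Sub Sub_eq_Zero_iff)
  then have "Sub A f g = Zero A W (Dom A m)"
    using assms(2)[of "Sub A f g"] by auto
  then show "f = g" using a by (simp add: Sub_eq_Zero_iff)
qed (fact assms)

lemma is_mono_Zero:
  assumes "is_mono A m" "f \<in> Arr A" "Cod A f = Dom A m" "m \<cdot> f = Zero A X Y" "X = Dom A f"
    "Y = Cod A m"
  shows "f = Zero A (Dom A f) (Dom A m)"
proof -
  have "m \<in> Arr A" using assms(1) by (simp add: is_mono_def)
  then show ?thesis using is_monoD[OF assms(1), of f "Zero A (Dom A f) (Dom A m)"] assms by simp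
qed

text \<open>Uniqueness of factorizations through \<open>k\<close> is monicity of \<open>k\<close>,
  which leaves only their existence to check.\<close>

lemma is_kernelI:
  assumes "f \<in> Arr A" "k \<in> Arr A" "Cod A k = Dom A f" "f \<cdot> k = Zero A (Dom A k) (Cod A f)"
    "is_mono A k"
    "\<And>g. g \<in> Arr A \<Longrightarrow> Cod A g = Dom A f \<Longrightarrow> f \<cdot> g = Zero A (Dom A g) (Cod A f)
      \<Longrightarrow> \<exists>u \<in> Arr A. Dom A u = Dom A g \<and> Cod A u = Dom A k \<and> k \<cdot> u = g"
  shows "is_kernel A k f"
  unfolding is_kernel_def
proof (intro conjI allI ballI impI)
  fix W g assume g: "g \<in> Hom A W (Dom A f)" "f \<cdot> g = Zero A W (Cod A f)"
  then obtain u where "u \<in> Arr A" "Dom A u = W" "Cod A u = Dom A k" "k \<cdot> u = g"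
    using assms(6)[of g] by (auto simp: Hom_iff)
  with is_monoD[OF assms(5)] show "\<exists>!u. u \<in> Hom A W (Dom A k) \<and> k \<cdot> u = g"
    by (intro ex1I[of _ u]) (auto simp: Hom_iff)
qed (use assms in \<open>auto simp: Hom_iff\<close>)

lemma is_kernelD:
  assumes "is_kernel A k f"
  shows "f \<in> Arr A" "k \<in> Arr A" "Cod A k = Dom A f" "f \<cdot> k = Zero A (Dom A k) (Cod A f)"
    "is_mono A k"
proof -
  show k: "f \<in> Arr A" "k \<in> Arr A" "Cod A k = Dom A f" "f \<cdot> k = Zero A (Dom A k) (Cod A f)"
    using assms by (auto simp: is_kernel_def Hom_iff)
  show "is_mono A k"
  proof (rule is_monoI)
    fix g assume g: "g \<in> Arr A" "Cod A g = Dom A k" "k \<cdot> g = Zero A (Dom A g) (Cod A k)"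
    \<comment> \<open>Both \<open>g\<close> and a zero arrow factor the zero arrow through
      \<open>k\<close>, so uniqueness identifies them.\<close>
    have "Zero A (Dom A g) (Dom A f) \<in> Hom A (Dom A g) (Dom A f)"
      "f \<cdot> Zero A (Dom A g) (Dom A f) = Zero A (Dom A g) (Cod A f)"
      using k g by (simp_all add: Hom_iff)
    then have "\<exists>!u. u \<in> Hom A (Dom A g) (Dom A k) \<and> k \<cdot> u = Zero A (Dom A g) (Dom A f)"
      using assms unfolding is_kernel_def by blast
    moreover have "g \<in> Hom A (Dom A g) (Dom A k)" "k \<cdot> g = Zero A (Dom A g) (Dom A f)"
      "Zero A (Dom A g) (Dom A k) \<in> Hom A (Dom A g) (Dom A k)"
      "k \<cdot> Zero A (Dom A g) (Dom A k) = Zero A (Dom A g) (Dom A f)"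
      using g k by (simp_all add: Hom_iff)
    ultimately show "g = Zero A (Dom A g) (Dom A k)" by blast
  qed (fact k)
qed

lemma is_kernel_factor:
  assumes "is_kernel A k f" "g \<in> Arr A" "Cod A g = Dom A f" "f \<cdot> g = Zero A (Dom A g) (Cod A f)"
  shows "\<exists>u \<in> Arr A. Dom A u = Dom A g \<and> Cod A u = Dom A k \<and> k \<cdot> u = g"
proof -
  have "g \<in> Hom A (Dom A g) (Dom A f)" using assms by (simp add: Hom_iff)
  then obtain u where "u \<in> Hom A (Dom A g) (Dom A k)" "k \<cdot> u = g"
    using assms(1,4) unfolding is_kernel_def by blast
  then show ?thesis by (intro bexI[of _ u]) (simp_all add: Hom_iff)
qed

lemma is_kernel_Comp_mono:
  assumes "is_kernel A k f" "is_mono A m" "Dom A m = Cod A f"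
  shows "is_kernel A k (m \<cdot> f)"
proof -
  note k = is_kernelD[OF assms(1)]
  have m: "m \<in> Arr A" using assms(2) by (simp add: is_mono_def)
  show ?thesis
  proof (rule is_kernelI)
    fix g assume g: "g \<in> Arr A" "Cod A g = Dom A (m \<cdot> f)" "m \<cdot> f \<cdot> g = Zero A (Dom A g) (Cod A (m \<cdot> f))"
    then have "f \<cdot> g = Zero A (Dom A g) (Cod A f)"
      using is_mono_Zero[OF assms(2), of "f \<cdot> g"] k m assms(3) by (simp add: Comp_assoc)
    with g k m assms(3) show "\<exists>u \<in> Arr A. Dom A u = Dom A g \<and> Cod A u = Dom A k \<and> k \<cdot> u = g"
      by (metis is_kernel_factor[OF assms(1)] Comp_simps(2))
  qed (use k m assms in \<open>simp_all add: Comp_assoc\<close>)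
qed

lemma is_kernel_cancel_mono:
  assumes "is_kernel A k (m \<cdot> f)" "is_mono A m" "f \<in> Arr A" "Dom A m = Cod A f"
  shows "is_kernel A k f"
proof -
  note k = is_kernelD[OF assms(1)]
  have m: "m \<in> Arr A" using assms(2) by (simp add: is_mono_def)
  show ?thesis
  proof (rule is_kernelI)
    show "f \<cdot> k = Zero A (Dom A k) (Cod A f)"
      using is_mono_Zero[OF assms(2), of "f \<cdot> k"] k m assms by (simp add: Comp_assoc)
    fix g assume "g \<in> Arr A" "Cod A g = Dom A f" "f \<cdot> g = Zero A (Dom A g) (Cod A f)"
    then show "\<exists>u \<in> Arr A. Dom A u = Dom A g \<and> Cod A u = Dom A k \<and> k \<cdot> u = g"
      using k m assms(3,4) is_kernel_factor[OF assms(1), of g]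
      by (metis Comp_assoc Comp_simps(2,3) Comp_Zero(1) dom_Ob)
  qed (use k m assms in simp_all)
qed

lemma is_kernel_iso_left:
  assumes "is_kernel A k f" "is_iso A b" "Cod A b = Dom A k"
  shows "is_kernel A (k \<cdot> b) f"
proof -
  note k = is_kernelD[OF assms(1)]
  note b = inv_arr[OF assms(2)] is_iso_Arr[OF assms(2)]
  show ?thesis
  proof (rule is_kernelI)
    show "is_mono A (k \<cdot> b)"
      using b k assms by (intro is_mono_Comp[OF _ iso_is_mono]) simp_all
    show "f \<cdot> (k \<cdot> b) = Zero A (Dom A (k \<cdot> b)) (Cod A f)"
      using k b assms Comp_assoc_eq[OF k(4), of b] by simp
    fix g assume g: "g \<in> Arr A" "Cod A g = Dom A f" "f \<cdot> g = Zero A (Dom A g) (Cod A f)"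
    then obtain u where "u \<in> Arr A" "Dom A u = Dom A g" "Cod A u = Dom A k" "k \<cdot> u = g"
      using is_kernel_factor[OF assms(1), of g] by metis
    with g b k assms show "\<exists>u \<in> Arr A. Dom A u = Dom A g \<and> Cod A u = Dom A (k \<cdot> b) \<and> k \<cdot> b \<cdot> u = g"
      by (intro bexI[of _ "inv_arr A b \<cdot> u"]) (simp_all add: Comp_assoc inv_arr_cancel)
  qed (use k b assms in simp_all)
qed

lemma is_kernel_unique:
  assumes "is_kernel A k f" "is_kernel A k' f"
  obtains b where "is_iso A b" "Dom A b = Dom A k'" "Cod A b = Dom A k" "k' = k \<cdot> b"
proof -
  note k = is_kernelD[OF assms(1)] and k' = is_kernelD[OF assms(2)]
  obtain b where b: "b \<in> Arr A" "Dom A b = Dom A k'" "Cod A b = Dom A k" "k \<cdot> b = k'"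
    using is_kernel_factor[OF assms(1), of k'] k' by metis
  obtain c where c: "c \<in> Arr A" "Dom A c = Dom A k" "Cod A c = Dom A k'" "k' \<cdot> c = k"
    using is_kernel_factor[OF assms(2), of k] k by metis
  have "c \<cdot> b = Id A (Dom A k')"
    by (rule is_monoD[OF k'(5)]) (use b c k' in \<open>simp_all add: Comp_assoc_eq\<close>)
  moreover have "b \<cdot> c = Id A (Dom A k)"
    by (rule is_monoD[OF k(5)]) (use b c k in \<open>simp_all add: Comp_assoc_eq\<close>)
  ultimately have "is_iso A b" using is_isoI[of b c] b c by simp
  with b that show thesis by metis
qed

lemma additive_category_opp: "additive_category (opp A)"
proof -
  interpret opp: category "opp A" by (rule category_opp)
  have "comm_group (hom_group (opp A) X Y)" if "X \<in> Ob A" "Y \<in> Ob A" for X Y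
    using hom_comm_group[OF that(2,1)] by (simp add: hom_group_def)
  moreover have "\<exists>S i j p q. is_biproduct (opp A) X Y S i j p q"
    if XY: "X \<in> Ob A" "Y \<in> Ob A" for X Y
  proof -
    obtain S i j p q where "is_biproduct A X Y S i j p q"
      using biproduct[OF XY] by blast
    then have "is_biproduct (opp A) X Y S p q i j"
      by (simp add: is_biproduct_def)
    then show ?thesis by blast
  qed
  moreover have "\<exists>Z. is_zero_object (opp A) Z"
    using zero_object by simp
  ultimately show ?thesis
    by (intro additive_category.intro additive_category_axioms.intro category_opp)
      (simp_all add: Hom_iff Comp_Add_left Comp_Add_right)
qed

end

context additive_category
begin

interpretation opp: additive_category "opp A" by (rule additive_category_opp)

lemma is_epiI:
  assumes "p \<in> Arr A"
    "\<And>f. f \<in> Arr A \<Longrightarrow> Dom A f = Cod A p \<Longrightarrow> f \<cdot> p = Zero A (Dom A p) (Cod A f)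
      \<Longrightarrow> f = Zero A (Cod A p) (Cod A f)"
  shows "is_epi A p"
  using opp.is_monoI[of p] assms by simp

lemma is_epi_Zero:
  assumes "is_epi A p" "f \<in> Arr A" "Dom A f = Cod A p" "f \<cdot> p = Zero A X Y" "X = Dom A p"
    "Y = Cod A f"
  shows "f = Zero A (Cod A p) (Cod A f)"
  using opp.is_mono_Zero[of p f Y X] assms by simp

lemma is_cokernelI:
  assumes "f \<in> Arr A" "c \<in> Arr A" "Dom A c = Cod A f" "c \<cdot> f = Zero A (Dom A f) (Cod A c)"
    "is_epi A c"
    "\<And>g. g \<in> Arr A \<Longrightarrow> Dom A g = Cod A f \<Longrightarrow> g \<cdot> f = Zero A (Dom A f) (Cod A g)
      \<Longrightarrow> \<exists>u \<in> Arr A. Cod A u = Cod A g \<and> Dom A u = Cod A c \<and> u \<cdot> c = g"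
  shows "is_cokernel A c f"
  using opp.is_kernelI[of f c] assms by simp

lemma is_cokernelD:
  assumes "is_cokernel A c f"
  shows "f \<in> Arr A" "c \<in> Arr A" "Dom A c = Cod A f" "c \<cdot> f = Zero A (Dom A f) (Cod A c)"
    "is_epi A c"
  using opp.is_kernelD[of c f] assms by simp_all

lemma is_cokernel_factor:
  assumes "is_cokernel A c f" "g \<in> Arr A" "Dom A g = Cod A f" "g \<cdot> f = Zero A (Dom A f) (Cod A g)"
  shows "\<exists>u \<in> Arr A. Cod A u = Cod A g \<and> Dom A u = Cod A c \<and> u \<cdot> c = g"
  using opp.is_kernel_factor[of c f g] assms by simp

lemma is_cokernel_Comp_epi:
  assumes "is_cokernel A c f" "is_epi A p" "Cod A p = Dom A f"
  shows "is_cokernel A c (f \<cdot> p)"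
  using opp.is_kernel_Comp_mono[of c f p] assms by simp

lemma is_cokernel_cancel_epi:
  assumes "is_cokernel A c (f \<cdot> p)" "is_epi A p" "f \<in> Arr A" "Cod A p = Dom A f"
  shows "is_cokernel A c f"
  using opp.is_kernel_cancel_mono[of c p f] assms by simp

lemma is_cokernel_iso_right:
  assumes "is_cokernel A c f" "is_iso A b" "Dom A b = Cod A c"
  shows "is_cokernel A (b \<cdot> c) f"
  using opp.is_kernel_iso_left[of c f b] assms by simp

lemma is_cokernel_unique:
  assumes "is_cokernel A c f" "is_cokernel A c' f"
  obtains b where "is_iso A b" "Cod A b = Cod A c'" "Dom A b = Cod A c" "c' = b \<cdot> c"
  using opp.is_kernel_unique[of c f c'] assms by auto

end

text \<open>The abelian axioms without tensor structure form a self-dual notion: it passes to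
  \<open>opp A\<close>, so each statement below yields its dual.\<close>

locale abelian_category = additive_category +
  assumes has_kernel: "f \<in> Arr A \<Longrightarrow> \<exists>k. is_kernel A k f"
    and has_cokernel: "f \<in> Arr A \<Longrightarrow> \<exists>c. is_cokernel A c f"
    and normal_mono: "is_mono A m \<Longrightarrow> \<exists>f. is_kernel A m f"
    and normal_epi: "is_epi A p \<Longrightarrow> \<exists>f. is_cokernel A p f"

lemma (in abelian_category) abelian_category_opp: "abelian_category (opp A)"
proof -
  interpret opp: additive_category "opp A" by (rule additive_category_opp)
  show ?thesis
    by unfold_locales (simp_all add: has_kernel has_cokernel normal_mono normal_epi)
qed

section \<open>Image factorization in an abelian category\<close>

context abelian_category
begin

text \<open>If \<open>m\<close> is a kernel of \<open>f\<close>, then \<open>f\<close> kills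
  \<open>m\<close> and hence factors through \<open>c\<close>. So whatever \<open>c\<close> kills is
  killed by \<open>f\<close> and factors through \<open>m\<close>.\<close>

lemma mono_kernel_of_cokernel:
  assumes "is_mono A m" "is_cokernel A c m"
  shows "is_kernel A m c"
proof -
  note c = is_cokernelD[OF assms(2)]
  obtain f where f: "is_kernel A m f" using normal_mono[OF assms(1)] by blast
  note m = is_kernelD[OF f]
  obtain f' where f': "f' \<in> Arr A" "Cod A f' = Cod A f" "Dom A f' = Cod A c" "f' \<cdot> c = f"
    using is_cokernel_factor[OF assms(2), of f] m by metis
  show ?thesis
  proof (rule is_kernelI)
    fix g assume g: "g \<in> Arr A" "Cod A g = Dom A c" "c \<cdot> g = Zero A (Dom A g) (Cod A c)"
    have "f \<cdot> g = Zero A (Dom A g) (Cod A f)" using Comp_assoc[of g c f'] g f' c by simp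
    then show "\<exists>u \<in> Arr A. Dom A u = Dom A g \<and> Cod A u = Dom A m \<and> m \<cdot> u = g"
      using is_kernel_factor[OF f, of g] g c m by metis
  qed (use c m in simp_all)
qed

text \<open>Suppose \<open>h p = 0\<close> and let \<open>n\<close> be the kernel of
  \<open>h\<close>, so that \<open>f\<close> factors through the mono \<open>m n\<close>, a kernel
  of some \<open>q\<close>. As \<open>q\<close> kills \<open>f\<close>, it factors through
  \<open>c\<close> and kills \<open>m\<close>. Thus \<open>m\<close> factors through
  \<open>m n\<close>, which gives a section of \<open>n\<close>, and \<open>h n = 0\<close> forces
  \<open>h = 0\<close>.\<close>

lemma epi_factor_through_image:
  assumes "is_cokernel A c f" "is_kernel A m c"
  obtains p where "is_epi A p" "Dom A p = Dom A f" "Cod A p = Dom A m" "f = m \<cdot> p"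
proof -
  note c = is_cokernelD[OF assms(1)]
  note m = is_kernelD[OF assms(2)]
  obtain p where p: "p \<in> Arr A" "Dom A p = Dom A f" "Cod A p = Dom A m" "m \<cdot> p = f"
    using is_kernel_factor[OF assms(2), of f] c by metis
  have "is_epi A p"
  proof (rule is_epiI)
    fix h assume h: "h \<in> Arr A" "Dom A h = Cod A p" "h \<cdot> p = Zero A (Dom A p) (Cod A h)"
    obtain n where n: "is_kernel A n h" using has_kernel h by blast
    note n' = is_kernelD[OF n]
    obtain p' where p': "p' \<in> Arr A" "Dom A p' = Dom A p" "Cod A p' = Dom A n" "n \<cdot> p' = p"
      using is_kernel_factor[OF n, of p] h p by metis
    have "is_mono A (m \<cdot> n)" using is_mono_Comp[OF m(5) n'(5)] n' h p by simp
    then obtain q where q: "is_kernel A (m \<cdot> n) q" using normal_mono by blast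
    note q' = is_kernelD[OF q]
    have mnp: "m \<cdot> n \<cdot> p' = f" using m n' p' p h by (simp add: Comp_assoc)
    have "q \<cdot> f = Zero A (Dom A f) (Cod A q)"
      using q' m n' p' p h by (simp flip: mnp Comp_assoc[of p' "m \<cdot> n" q])
    then obtain q'' where q'': "q'' \<in> Arr A" "Cod A q'' = Cod A q" "Dom A q'' = Cod A c" "q'' \<cdot> c = q"
      using is_cokernel_factor[OF assms(1), of q] q' m n' p h c by (metis Comp_simps(3))
    have "q \<cdot> m = Zero A (Dom A m) (Cod A q)" using Comp_assoc[of m c q''] q'' c m by simp
    then obtain r where r: "r \<in> Arr A" "Dom A r = Dom A m" "Cod A r = Dom A n" "m \<cdot> n \<cdot> r = m"
      using is_kernel_factor[OF q, of m] q' m n' h p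
      by (metis Comp_simps(2,3))
    have "n \<cdot> r = Id A (Dom A m)"
      by (rule is_monoD[OF m(5)]) (use r m n' h p in \<open>simp_all add: Comp_assoc\<close>)
    then show "h = Zero A (Cod A p) (Cod A h)" using Comp_assoc[of r n h] h n' r p by simp
  qed (use p in simp)
  with p that show thesis by metis
qed

interpretation opp: abelian_category "opp A" by (rule abelian_category_opp)

lemma epi_cokernel_of_kernel:
  assumes "is_epi A p" "is_kernel A k p"
  shows "is_cokernel A p k"
  using opp.mono_kernel_of_cokernel[of p k] assms by simp

lemma image_factorization:
  assumes "f \<in> Arr A"
  obtains k p m c where "f = m \<cdot> p" "is_mono A m" "is_epi A p" "Dom A m = Cod A p"
    "Dom A p = Dom A f" "Cod A m = Cod A f"
    "is_kernel A k f" "is_kernel A k p" "is_cokernel A p k"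
    "is_cokernel A c f" "is_cokernel A c m" "is_kernel A m c"
proof -
  obtain c where c: "is_cokernel A c f" using has_cokernel assms by blast
  obtain m where m: "is_kernel A m c" using has_kernel is_cokernelD[OF c] by blast
  obtain p where p: "is_epi A p" "Dom A p = Dom A f" "Cod A p = Dom A m" "f = m \<cdot> p"
    using epi_factor_through_image[OF c m] by metis
  have pA: "p \<in> Arr A" using p by (simp add: is_epi_def)
  note m' = is_kernelD[OF m]
  obtain k where k: "is_kernel A k f" using has_kernel assms by blast
  have kp: "is_kernel A k p" using is_kernel_cancel_mono[of k m p] k p pA m' by simp
  have "is_cokernel A c m" using is_cokernel_cancel_epi[of c m p] c p pA m' by simp
  then show thesis
    using that[of m p k c] p m m' c k kp is_cokernelD(3)[OF c]
      epi_cokernel_of_kernel[OF p(1) kp] by simp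
qed

end

sublocale rigid_abelian_category \<subseteq> abelian_category
  by unfold_locales (simp_all add: kernel cokernel mono_normal epi_normal)

section \<open>The action of the endomorphisms of the unit object\<close>

text \<open>The endomorphism \<open>z\<close> acts through \<open>1 \<otimes> Y\<close>, identified
  with \<open>Y\<close> by the left unit constraint, where \<open>Y\<close> is the codomain of
  \<open>f\<close>. With the action placed at the codomain, compatibility with precomposition is
  pure associativity; compatibility with postcomposition expresses naturality.\<close>

definition scal :: "('o, 'm) tcat \<Rightarrow> 'm \<Rightarrow> 'm \<Rightarrow> 'm" (infixr "\<star>\<index>" 72) where
  "z \<star>\<^bsub>A\<^esub> f = LUnit A (Cod A f) \<cdot>\<^bsub>A\<^esub> ((z \<otimes>\<^sub>a\<^bsub>A\<^esub> Id A (Cod A f)) \<cdot>\<^bsub>A\<^esub> (inv_arr A (LUnit A (Cod A f)) \<cdot>\<^bsub>A\<^esub> f))"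

definition scalars :: "('o, 'm) tcat \<Rightarrow> 'm set" where
  "scalars A = Hom A (Unit A) (Unit A)"

lemma Z_ring_simps [simp]:
  "carrier (Z_ring A) = scalars A" "monoid.mult (Z_ring A) = Comp A" "one (Z_ring A) = Id A (Unit A)"
  "zero (Z_ring A) = Zero A (Unit A) (Unit A)" "add (Z_ring A) = Add A"
  by (simp_all add: Z_ring_def scalars_def)

lemma scalarsI: "z \<in> Arr A \<Longrightarrow> Dom A z = Unit A \<Longrightarrow> Cod A z = Unit A \<Longrightarrow> z \<in> scalars A"
  by (simp add: scalars_def Hom_iff)

lemma scalarsD [simp]:
  assumes "z \<in> scalars A"
  shows "z \<in> Arr A" "Dom A z = Unit A" "Cod A z = Unit A"
  using assms by (auto simp: scalars_def Hom_iff)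

context tensor_category
begin

lemmas [simp] = unit_Ob tenO_Ob

lemma TenA_simps [simp]:
  assumes "f \<in> Arr A" "g \<in> Arr A"
  shows "f \<otimes>\<^sub>a g \<in> Arr A" "Dom A (f \<otimes>\<^sub>a g) = Dom A f \<otimes>\<^sub>o Dom A g"
    "Cod A (f \<otimes>\<^sub>a g) = Cod A f \<otimes>\<^sub>o Cod A g"
  using tenA_hom[of f "Dom A f" "Cod A f" g "Dom A g" "Cod A g"] assms by (auto simp: Hom_iff)

lemmas [simp] = ten_id

lemma Ten_Comp:
  assumes "f \<in> Arr A" "f' \<in> Arr A" "g \<in> Arr A" "g' \<in> Arr A" "Dom A f' = Cod A f" "Dom A g' = Cod A g"
  shows "(f' \<otimes>\<^sub>a g') \<cdot> (f \<otimes>\<^sub>a g) = (f' \<cdot> f) \<otimes>\<^sub>a (g' \<cdot> g)"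
  using ten_comp[of f "Dom A f" "Cod A f" f' "Cod A f'" g "Dom A g" "Cod A g" g' "Cod A g'"] assms
  by (simp add: Hom_iff)

lemma Ten_Add_left:
  assumes "f \<in> Arr A" "f' \<in> Arr A" "g \<in> Arr A" "Dom A f' = Dom A f" "Cod A f' = Cod A f"
  shows "(f \<oplus>\<^sub>a f') \<otimes>\<^sub>a g = (f \<otimes>\<^sub>a g) \<oplus>\<^sub>a (f' \<otimes>\<^sub>a g)"
  using ten_add_left[of f "Dom A f" "Cod A f" f' g "Dom A g" "Cod A g"] assms
  by (simp add: Hom_iff)

lemma Ten_Add_right:
  assumes "f \<in> Arr A" "g' \<in> Arr A" "g \<in> Arr A" "Dom A g' = Dom A g" "Cod A g' = Cod A g"
  shows "f \<otimes>\<^sub>a (g \<oplus>\<^sub>a g') = (f \<otimes>\<^sub>a g) \<oplus>\<^sub>a (f \<otimes>\<^sub>a g')"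
  using ten_add_right[of f "Dom A f" "Cod A f" g "Dom A g" "Cod A g" g'] assms
  by (simp add: Hom_iff)

lemma Ten_Zero:
  assumes "f \<in> Arr A" "X \<in> Ob A" "Y \<in> Ob A"
  shows "f \<otimes>\<^sub>a Zero A X Y = Zero A (Dom A f \<otimes>\<^sub>o X) (Cod A f \<otimes>\<^sub>o Y)"
    "Zero A X Y \<otimes>\<^sub>a f = Zero A (X \<otimes>\<^sub>o Dom A f) (Y \<otimes>\<^sub>o Cod A f)"
proof -
  have "f \<otimes>\<^sub>a Zero A X Y \<oplus>\<^sub>a f \<otimes>\<^sub>a Zero A X Y = f \<otimes>\<^sub>a Zero A X Y"
    using assms by (simp flip: Ten_Add_right)
  from Add_idem_Zero[OF _ this] show "f \<otimes>\<^sub>a Zero A X Y = Zero A (Dom A f \<otimes>\<^sub>o X) (Cod A f \<otimes>\<^sub>o Y)"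
    using assms by simp
  have "Zero A X Y \<otimes>\<^sub>a f \<oplus>\<^sub>a Zero A X Y \<otimes>\<^sub>a f = Zero A X Y \<otimes>\<^sub>a f"
    using assms by (simp flip: Ten_Add_left)
  from Add_idem_Zero[OF _ this] show "Zero A X Y \<otimes>\<^sub>a f = Zero A (X \<otimes>\<^sub>o Dom A f) (Y \<otimes>\<^sub>o Cod A f)"
    using assms by simp
qed

lemma Assoc_simps [simp]:
  assumes "X \<in> Ob A" "Y \<in> Ob A" "Z \<in> Ob A"
  shows "Assoc A X Y Z \<in> Arr A" "Dom A (Assoc A X Y Z) = X \<otimes>\<^sub>o Y \<otimes>\<^sub>o Z"
    "Cod A (Assoc A X Y Z) = X \<otimes>\<^sub>o (Y \<otimes>\<^sub>o Z)" "is_iso A (Assoc A X Y Z)"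
  using assoc_hom[OF assms] assoc_iso[OF assms] by (auto simp: Hom_iff)

lemma LUnit_simps [simp]:
  assumes "X \<in> Ob A"
  shows "LUnit A X \<in> Arr A" "Dom A (LUnit A X) = Unit A \<otimes>\<^sub>o X"
    "Cod A (LUnit A X) = X" "is_iso A (LUnit A X)"
  using lunit_hom[OF assms] lunit_iso[OF assms] by (auto simp: Hom_iff)

lemma RUnit_simps [simp]:
  assumes "X \<in> Ob A"
  shows "RUnit A X \<in> Arr A" "Dom A (RUnit A X) = X \<otimes>\<^sub>o Unit A"
    "Cod A (RUnit A X) = X" "is_iso A (RUnit A X)"
  using runit_hom[OF assms] runit_iso[OF assms] by (auto simp: Hom_iff)

lemma Sym_simps [simp]:
  assumes "X \<in> Ob A" "Y \<in> Ob A"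
  shows "Sym A X Y \<in> Arr A" "Dom A (Sym A X Y) = X \<otimes>\<^sub>o Y" "Cod A (Sym A X Y) = Y \<otimes>\<^sub>o X"
    "is_iso A (Sym A X Y)"
proof -
  show "Sym A X Y \<in> Arr A" "Dom A (Sym A X Y) = X \<otimes>\<^sub>o Y" "Cod A (Sym A X Y) = Y \<otimes>\<^sub>o X"
    using sym_hom[OF assms] by (auto simp: Hom_iff)
  then show "is_iso A (Sym A X Y)"
    using sym_hom[of Y X] assms by (intro is_isoI[of _ "Sym A Y X"]) (auto simp: Hom_iff sym_sym)
qed

lemma Assoc_natural:
  assumes "f \<in> Arr A" "g \<in> Arr A" "h \<in> Arr A"
  shows "Assoc A (Cod A f) (Cod A g) (Cod A h) \<cdot> (f \<otimes>\<^sub>a g \<otimes>\<^sub>a h)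
    = (f \<otimes>\<^sub>a (g \<otimes>\<^sub>a h)) \<cdot> Assoc A (Dom A f) (Dom A g) (Dom A h)"
  using assms by (intro assoc_natural) (auto simp: Hom_iff)

lemma LUnit_natural:
  "f \<in> Arr A \<Longrightarrow> LUnit A (Cod A f) \<cdot> (Id A (Unit A) \<otimes>\<^sub>a f) = f \<cdot> LUnit A (Dom A f)"
  by (intro lunit_natural) (auto simp: Hom_iff)

lemma RUnit_natural:
  "f \<in> Arr A \<Longrightarrow> RUnit A (Cod A f) \<cdot> (f \<otimes>\<^sub>a Id A (Unit A)) = f \<cdot> RUnit A (Dom A f)"
  by (intro runit_natural) (auto simp: Hom_iff)

lemma Sym_natural:
  "f \<in> Arr A \<Longrightarrow> g \<in> Arr A \<Longrightarrow>
    Sym A (Cod A f) (Cod A g) \<cdot> (f \<otimes>\<^sub>a g) = (g \<otimes>\<^sub>a f) \<cdot> Sym A (Dom A f) (Dom A g)"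
  by (intro sym_natural) (auto simp: Hom_iff)

lemma is_iso_Ten:
  assumes "is_iso A f" "is_iso A g"
  shows "is_iso A (f \<otimes>\<^sub>a g)"
  by (rule is_isoI[of _ "inv_arr A f \<otimes>\<^sub>a inv_arr A g"])
    (use inv_arr[OF assms(1)] inv_arr[OF assms(2)] is_iso_Arr[OF assms(1)] is_iso_Arr[OF assms(2)]
      in \<open>simp_all add: Ten_Comp\<close>)

lemma scalars_simps [simp]:
  "Id A (Unit A) \<in> scalars A" "Zero A (Unit A) (Unit A) \<in> scalars A"
  "z \<in> scalars A \<Longrightarrow> w \<in> scalars A \<Longrightarrow> z \<cdot> w \<in> scalars A"
  "z \<in> scalars A \<Longrightarrow> w \<in> scalars A \<Longrightarrow> z \<oplus>\<^sub>a w \<in> scalars A"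
  "z \<in> scalars A \<Longrightarrow> w \<in> scalars A \<Longrightarrow> Sub A z w \<in> scalars A"
  "z \<in> scalars A \<Longrightarrow> Neg A z \<in> scalars A"
  by (auto intro!: scalarsI)

text \<open>Eckmann--Hilton; the comparison of the two unit constraints at the unit object is absorbed
  by conjugation, so no coherence theorem is needed.\<close>

lemma scalars_commute:
  assumes z: "z \<in> scalars A" and w: "w \<in> scalars A"
  shows "z \<cdot> w = w \<cdot> z"
proof -
  let ?r = "RUnit A (Unit A)" and ?l = "LUnit A (Unit A)" and ?I = "Id A (Unit A)"
  note r = inv_arr[of ?r, simplified] and l = inv_arr[of ?l, simplified]
  \<comment> \<open>Conjugated so that \<open>?I \<otimes> w'\<close> becomes the conjugate of
    \<open>w\<close> by \<open>?r\<close>, just as \<open>z \<otimes> ?I\<close> is the conjugate of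
    \<open>z\<close> by \<open>?r\<close>.\<close>
  define w' where "w' = ?l \<cdot> (inv_arr A ?r \<cdot> (w \<cdot> (?r \<cdot> inv_arr A ?l)))"
  have w': "w' \<in> Arr A" "Dom A w' = Unit A" "Cod A w' = Unit A"
    using w r l by (simp_all add: w'_def)
  have 1: "z \<otimes>\<^sub>a ?I = inv_arr A ?r \<cdot> (z \<cdot> ?r)"
    using RUnit_natural[of z] z inv_arr_cancel(1)[of ?r "z \<otimes>\<^sub>a ?I"] by simp
  have "?I \<otimes>\<^sub>a w' = inv_arr A ?l \<cdot> (w' \<cdot> ?l)"
    using LUnit_natural[of w'] w' inv_arr_cancel(1)[of ?l "?I \<otimes>\<^sub>a w'"] by simp
  also have "\<dots> = inv_arr A ?r \<cdot> (w \<cdot> ?r)"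
    using w r l by (simp add: w'_def Comp_assoc inv_arr_cancel)
  finally have 2: "?I \<otimes>\<^sub>a w' = inv_arr A ?r \<cdot> (w \<cdot> ?r)" .
  have "(z \<otimes>\<^sub>a ?I) \<cdot> (?I \<otimes>\<^sub>a w') = (?I \<otimes>\<^sub>a w') \<cdot> (z \<otimes>\<^sub>a ?I)"
    using z w' by (simp add: Ten_Comp)
  then have "inv_arr A ?r \<cdot> ((z \<cdot> w) \<cdot> ?r) = inv_arr A ?r \<cdot> ((w \<cdot> z) \<cdot> ?r)"
    unfolding 1 2 using z w r by (simp add: Comp_assoc inv_arr_cancel)
  then show ?thesis
    using z w r by (simp add: iso_cancel_left is_iso_inv_arr iso_cancel_right)
qed

lemma inv_LUnit [simp]:
  assumes "X \<in> Ob A"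
  shows "inv_arr A (LUnit A X) \<in> Arr A" "Dom A (inv_arr A (LUnit A X)) = X"
    "Cod A (inv_arr A (LUnit A X)) = Unit A \<otimes>\<^sub>o X"
    "inv_arr A (LUnit A X) \<cdot> LUnit A X = Id A (Unit A \<otimes>\<^sub>o X)"
    "LUnit A X \<cdot> inv_arr A (LUnit A X) = Id A X"
  using inv_arr[of "LUnit A X"] assms by simp_all

lemma LUnit_cancel [simp]:
  assumes "X \<in> Ob A" "h \<in> Arr A"
  shows "Cod A h = Unit A \<otimes>\<^sub>o X \<Longrightarrow> inv_arr A (LUnit A X) \<cdot> (LUnit A X \<cdot> h) = h"
    "Cod A h = X \<Longrightarrow> LUnit A X \<cdot> (inv_arr A (LUnit A X) \<cdot> h) = h"
  using inv_arr_cancel[of "LUnit A X" h] assms by simp_all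

lemma inv_LUnit_natural:
  assumes "f \<in> Arr A"
  shows "inv_arr A (LUnit A (Cod A f)) \<cdot> f = (Id A (Unit A) \<otimes>\<^sub>a f) \<cdot> inv_arr A (LUnit A (Dom A f))"
proof -
  have "inv_arr A (LUnit A (Cod A f)) \<cdot> (f \<cdot> LUnit A (Dom A f)) \<cdot> inv_arr A (LUnit A (Dom A f))
    = inv_arr A (LUnit A (Cod A f)) \<cdot> f"
    using assms by (simp add: Comp_assoc)
  then show ?thesis using assms by (simp flip: LUnit_natural)
qed

lemma scal_simps [simp]:
  assumes "z \<in> scalars A" "f \<in> Arr A"
  shows "z \<star> f \<in> Arr A" "Dom A (z \<star> f) = Dom A f" "Cod A (z \<star> f) = Cod A f"
  using assms by (simp_all add: scal_def)

lemma scal_Comp_left: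
  assumes "z \<in> scalars A" "f \<in> Arr A" "g \<in> Arr A" "Dom A g = Cod A f"
  shows "(z \<star> g) \<cdot> f = z \<star> (g \<cdot> f)"
  using assms by (simp add: scal_def Comp_assoc)

text \<open>Naturality of the unit constraint turns \<open>g\<close> into
  \<open>1 \<otimes> g\<close>, which commutes with \<open>z \<otimes> 1\<close> by the interchange
  law.\<close>

lemma scal_Comp_right:
  assumes "z \<in> scalars A" "f \<in> Arr A" "g \<in> Arr A" "Dom A g = Cod A f"
  shows "g \<cdot> (z \<star> f) = z \<star> (g \<cdot> f)"
proof -
  let ?X = "Cod A f" and ?Y = "Cod A g" and ?I = "Id A (Unit A)"
  have "z \<star> (g \<cdot> f) = LUnit A ?Y \<cdot> ((z \<otimes>\<^sub>a Id A ?Y) \<cdot> ((inv_arr A (LUnit A ?Y) \<cdot> g) \<cdot> f))"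
    using assms by (simp add: scal_def Comp_assoc)
  also have "\<dots> = LUnit A ?Y \<cdot> (((z \<otimes>\<^sub>a Id A ?Y) \<cdot> (?I \<otimes>\<^sub>a g)) \<cdot> (inv_arr A (LUnit A ?X) \<cdot> f))"
    using assms by (simp add: inv_LUnit_natural Comp_assoc)
  also have "(z \<otimes>\<^sub>a Id A ?Y) \<cdot> (?I \<otimes>\<^sub>a g) = (?I \<otimes>\<^sub>a g) \<cdot> (z \<otimes>\<^sub>a Id A ?X)"
    using assms by (simp add: Ten_Comp)
  also have "LUnit A ?Y \<cdot> (((?I \<otimes>\<^sub>a g) \<cdot> (z \<otimes>\<^sub>a Id A ?X)) \<cdot> (inv_arr A (LUnit A ?X) \<cdot> f))
    = (LUnit A ?Y \<cdot> (?I \<otimes>\<^sub>a g)) \<cdot> ((z \<otimes>\<^sub>a Id A ?X) \<cdot> (inv_arr A (LUnit A ?X) \<cdot> f))"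
    using assms by (simp add: Comp_assoc)
  also have "\<dots> = g \<cdot> (z \<star> f)"
    using assms by (simp add: LUnit_natural scal_def Comp_assoc)
  finally show ?thesis by simp
qed

lemma scal_Id [simp]:
  assumes "f \<in> Arr A" shows "Id A (Unit A) \<star> f = f"
  using assms by (simp add: scal_def)

lemma scal_scal:
  assumes "z \<in> scalars A" "w \<in> scalars A" "f \<in> Arr A"
  shows "z \<star> (w \<star> f) = (z \<cdot> w) \<star> f"
proof -
  let ?X = "Cod A f"
  have "z \<star> (w \<star> f)
    = LUnit A ?X \<cdot> (((z \<otimes>\<^sub>a Id A ?X) \<cdot> (w \<otimes>\<^sub>a Id A ?X)) \<cdot> (inv_arr A (LUnit A ?X) \<cdot> f))"
    using assms by (simp add: scal_def Comp_assoc)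
  also have "\<dots> = (z \<cdot> w) \<star> f"
    using assms by (simp add: scal_def Ten_Comp)
  finally show ?thesis .
qed

lemma scal_Add_right:
  assumes "z \<in> scalars A" "f \<in> Arr A" "g \<in> Arr A" "Dom A g = Dom A f" "Cod A g = Cod A f"
  shows "z \<star> (f \<oplus>\<^sub>a g) = (z \<star> f) \<oplus>\<^sub>a (z \<star> g)"
  using assms by (simp add: scal_def Comp_Add_right)

lemma scal_Zero [simp]:
  assumes "z \<in> scalars A" "X \<in> Ob A" "Y \<in> Ob A"
  shows "z \<star> Zero A X Y = Zero A X Y"
  using assms by (simp add: scal_def)

lemma Zero_scal [simp]:
  assumes "f \<in> Arr A"
  shows "Zero A (Unit A) (Unit A) \<star> f = Zero A (Dom A f) (Cod A f)"
  using assms by (simp add: scal_def Ten_Zero)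

lemma scal_Neg:
  assumes "z \<in> scalars A" "f \<in> Arr A"
  shows "z \<star> Neg A f = Neg A (z \<star> f)"
  by (rule Neg_unique) (use assms in \<open>simp_all flip: scal_Add_right\<close>)

lemma scal_Sub:
  assumes "z \<in> scalars A" "f \<in> Arr A" "g \<in> Arr A" "Dom A g = Dom A f" "Cod A g = Cod A f"
  shows "z \<star> Sub A f g = Sub A (z \<star> f) (z \<star> g)"
  using assms by (simp add: Sub_def scal_Add_right scal_Neg)

text \<open>The action uses the left unit constraint, whereas \<open>z \<otimes> 1\<close> is a
  conjugate of \<open>z\<close> by the right one. The discrepancy of the two is itself a scalar, so
  it commutes with \<open>z\<close> and cancels.\<close>

lemma scal_scalars:
  assumes "z \<in> scalars A" "w \<in> scalars A"
  shows "z \<star> w = z \<cdot> w"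
proof -
  let ?r = "RUnit A (Unit A)" and ?l = "LUnit A (Unit A)" and ?I = "Id A (Unit A)"
  note r = inv_arr[of ?r, simplified]
  have "z \<otimes>\<^sub>a ?I = inv_arr A ?r \<cdot> (z \<cdot> ?r)"
    using RUnit_natural[of z] assms inv_arr_cancel(1)[of ?r "z \<otimes>\<^sub>a ?I"] by simp
  then have "z \<star> w = (?l \<cdot> inv_arr A ?r) \<cdot> z \<cdot> (?r \<cdot> inv_arr A ?l) \<cdot> w"
    using assms r by (simp add: scal_def Comp_assoc)
  also have "(?l \<cdot> inv_arr A ?r) \<cdot> z = z \<cdot> (?l \<cdot> inv_arr A ?r)"
    using assms r by (intro scalars_commute scalarsI) simp_all
  also have "z \<cdot> (?l \<cdot> inv_arr A ?r) \<cdot> (?r \<cdot> inv_arr A ?l) \<cdot> w = z \<cdot> w"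
    using assms r by (simp add: Comp_assoc inv_arr_cancel)
  finally show ?thesis .
qed

lemma scal_Id_Unit: "z \<in> scalars A \<Longrightarrow> z \<star> Id A (Unit A) = z"
  by (simp add: scal_scalars)

lemma Comp_scalar:
  assumes "z \<in> scalars A" "f \<in> Arr A" "Dom A f = Unit A"
  shows "f \<cdot> z = z \<star> f"
  using assms scal_Comp_right[of z "Id A (Unit A)" f] by (simp add: scal_Id_Unit)

lemma scalar_Comp:
  assumes "z \<in> scalars A" "f \<in> Arr A" "Cod A f = Unit A"
  shows "z \<cdot> f = z \<star> f"
  using assms scal_Comp_left[of z f "Id A (Unit A)"] by (simp add: scal_Id_Unit)

text \<open>Both \<open>\<lambda>\<^bsub>X \<otimes> Y\<^esub> \<alpha>\<close> and \<open>\<lambda>\<^bsub>X\<^esub> \<otimes> Y\<close> intertwine the action with \<open>(z \<otimes> X) \<otimes> Y\<close>; as the action is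
  central, it does not matter whether the two isomorphisms agree.\<close>

lemma scal_Ten_Id:
  assumes z: "z \<in> scalars A" and X: "X \<in> Ob A" and Y: "Y \<in> Ob A"
  shows "(z \<star> Id A X) \<otimes>\<^sub>a Id A Y = z \<star> Id A (X \<otimes>\<^sub>o Y)"
proof -
  let ?a = "LUnit A X \<otimes>\<^sub>a Id A Y" and ?\<alpha> = "Assoc A (Unit A) X Y"
  let ?b = "LUnit A (X \<otimes>\<^sub>o Y) \<cdot> ?\<alpha>" and ?s = "(z \<star> Id A X) \<otimes>\<^sub>a Id A Y"
    and ?t = "(z \<otimes>\<^sub>a Id A X) \<otimes>\<^sub>a Id A Y"
  have a: "is_iso A ?a" using X Y by (intro is_iso_Ten is_iso_Id) simp_all
  have b: "is_iso A ?b" using X Y by (intro is_iso_Comp) simp_all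
  note a' = inv_arr[OF a] is_iso_Arr[OF a]
  define \<phi> where "\<phi> = ?b \<cdot> inv_arr A ?a"
  have \<phi>: "is_iso A \<phi>"
    unfolding \<phi>_def by (intro is_iso_Comp is_iso_inv_arr a b) (use a' X Y in simp_all)
  have [simp]: "\<phi> \<in> Arr A" "Dom A \<phi> = X \<otimes>\<^sub>o Y" "Cod A \<phi> = X \<otimes>\<^sub>o Y"
    unfolding \<phi>_def using a' X Y by simp_all
  have 1: "?s \<cdot> ?a = ?a \<cdot> ?t"
    using z X Y by (simp add: Ten_Comp scal_def Comp_assoc)
  have 2: "z \<star> ?b = ?b \<cdot> ?t"
  proof -
    have "z \<star> ?b = LUnit A (X \<otimes>\<^sub>o Y) \<cdot> ((z \<otimes>\<^sub>a (Id A X \<otimes>\<^sub>a Id A Y)) \<cdot> ?\<alpha>)"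
      using z X Y by (simp add: scal_def Comp_assoc)
    also have "\<dots> = ?b \<cdot> ?t"
      using z X Y Assoc_natural[of z "Id A X" "Id A Y"] by (simp add: Comp_assoc)
    finally show ?thesis .
  qed
  have "\<phi> \<cdot> (z \<star> Id A (X \<otimes>\<^sub>o Y)) = z \<star> \<phi>"
    using z X Y by (simp add: scal_Comp_right)
  also have "\<dots> = ?b \<cdot> ?t \<cdot> inv_arr A ?a"
    using z X Y a' by (simp add: \<phi>_def flip: 2 scal_Comp_left)
  also have "?b \<cdot> ?t \<cdot> inv_arr A ?a = ?b \<cdot> inv_arr A ?a \<cdot> (?a \<cdot> ?t) \<cdot> inv_arr A ?a"
    using z X Y a' a by (simp add: Comp_assoc inv_arr_cancel)
  also have "\<dots> = \<phi> \<cdot> ?s"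
    using z X Y a' a by (simp add: \<phi>_def Comp_assoc inv_arr_cancel flip: 1)
  finally show ?thesis
    using iso_cancel_left[OF \<phi>] z X Y by simp
qed

lemma scal_Ten_left:
  assumes "z \<in> scalars A" "f \<in> Arr A" "g \<in> Arr A"
  shows "(z \<star> f) \<otimes>\<^sub>a g = z \<star> (f \<otimes>\<^sub>a g)"
proof -
  have "(z \<star> f) \<otimes>\<^sub>a g = ((z \<star> Id A (Cod A f)) \<otimes>\<^sub>a Id A (Cod A g)) \<cdot> (f \<otimes>\<^sub>a g)"
    using assms by (simp add: Ten_Comp scal_Comp_left)
  then show ?thesis using assms by (simp add: scal_Ten_Id scal_Comp_left)
qed

text \<open>The symmetry moves \<open>g\<close> to the left factor, where
  \<open>scal_Ten_left\<close> applies; centrality carries the scalar back past the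
  symmetry.\<close>

lemma scal_Ten_right:
  assumes "z \<in> scalars A" "f \<in> Arr A" "g \<in> Arr A"
  shows "f \<otimes>\<^sub>a (z \<star> g) = z \<star> (f \<otimes>\<^sub>a g)"
proof -
  have "Sym A (Cod A f) (Cod A g) \<cdot> (f \<otimes>\<^sub>a (z \<star> g)) = Sym A (Cod A f) (Cod A g) \<cdot> (z \<star> (f \<otimes>\<^sub>a g))"
    using assms Sym_natural[of f "z \<star> g"] Sym_natural[of f g]
    by (simp add: scal_Ten_left scal_Comp_left scal_Comp_right)
  then show ?thesis
    using iso_cancel_left[of "Sym A (Cod A f) (Cod A g)"] assms by simp
qed

lemma Z_ring_cring: "cring (Z_ring A)"
proof -
  have "\<exists>w \<in> scalars A. w \<oplus>\<^sub>a z = Zero A (Unit A) (Unit A)" if "z \<in> scalars A" for z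
    using that by (intro bexI[of _ "Neg A z"]) simp_all
  then have "abelian_group (Z_ring A)"
    by (intro abelian_groupI) (simp_all add: Add_ac)
  moreover have "comm_monoid (Z_ring A)"
    by (rule comm_monoidI) (auto simp: Comp_assoc intro: scalars_commute)
  ultimately show ?thesis
    by (rule cringI) (simp add: Comp_Add_left)
qed

end

section \<open>Right exactness of the tensor product\<close>

context tensor_category
begin

declare inv_arr [simp] inv_arr_cancel [simp]

lemma is_isoD_factor:
  assumes "is_iso A (f \<cdot> g)" "is_iso A g" "f \<in> Arr A" "Dom A f = Cod A g"
  shows "is_iso A f"
proof -
  have "is_iso A ((f \<cdot> g) \<cdot> inv_arr A g)"
    using assms is_iso_Arr[OF assms(2)]
    by (intro is_iso_Comp[OF is_iso_inv_arr[OF assms(2)] assms(1)]) simp_all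
  moreover have "(f \<cdot> g) \<cdot> inv_arr A g = f"
    using assms is_iso_Arr[OF assms(2)] by (simp add: Comp_assoc)
  ultimately show ?thesis by simp
qed

lemma is_dualD:
  assumes "is_dual A X D ev coev"
  shows "X \<in> Ob A" "D \<in> Ob A" "ev \<in> Arr A" "Dom A ev = X \<otimes>\<^sub>o D" "Cod A ev = Unit A"
    "coev \<in> Arr A" "Dom A coev = Unit A" "Cod A coev = D \<otimes>\<^sub>o X"
    "LUnit A X \<cdot> ((ev \<otimes>\<^sub>a Id A X) \<cdot> (inv_arr A (Assoc A X D X) \<cdot> (Id A X \<otimes>\<^sub>a coev))) = RUnit A X"
    "RUnit A D \<cdot> ((Id A D \<otimes>\<^sub>a ev) \<cdot> (Assoc A D X D \<cdot> (coev \<otimes>\<^sub>a Id A D))) = LUnit A D"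
proof -
  show [simp]: "X \<in> Ob A" "D \<in> Ob A" "ev \<in> Arr A" "Dom A ev = X \<otimes>\<^sub>o D" "Cod A ev = Unit A"
    "coev \<in> Arr A" "Dom A coev = Unit A" "Cod A coev = D \<otimes>\<^sub>o X"
    using assms by (auto simp: is_dual_def Hom_iff)
  obtain a where a: "a \<in> Hom A (X \<otimes>\<^sub>o (D \<otimes>\<^sub>o X)) (X \<otimes>\<^sub>o D \<otimes>\<^sub>o X)"
    "a \<cdot> Assoc A X D X = Id A (X \<otimes>\<^sub>o D \<otimes>\<^sub>o X)"
    "LUnit A X \<cdot> (ev \<otimes>\<^sub>a Id A X) \<cdot> a \<cdot> (Id A X \<otimes>\<^sub>a coev) = RUnit A X"
    using assms unfolding is_dual_def by blast
  have aA: "a \<in> Arr A" "Dom A a = X \<otimes>\<^sub>o (D \<otimes>\<^sub>o X)" "Cod A a = X \<otimes>\<^sub>o D \<otimes>\<^sub>o X"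
    using a(1) by (auto simp: Hom_iff)
  have "a \<cdot> Assoc A X D X = inv_arr A (Assoc A X D X) \<cdot> Assoc A X D X" using a(2) by simp
  \<comment> \<open>The definition only makes \<open>a\<close> a left inverse of the associator;
    since the associator is invertible, \<open>a\<close> is its inverse.\<close>
  then have "a = inv_arr A (Assoc A X D X)"
    using iso_cancel_right[of "Assoc A X D X" a "inv_arr A (Assoc A X D X)"] aA by simp
  then show "LUnit A X \<cdot> ((ev \<otimes>\<^sub>a Id A X) \<cdot> (inv_arr A (Assoc A X D X) \<cdot> (Id A X \<otimes>\<^sub>a coev))) = RUnit A X"
    using a(3) aA by (simp add: Comp_assoc)
  show "RUnit A D \<cdot> ((Id A D \<otimes>\<^sub>a ev) \<cdot> (Assoc A D X D \<cdot> (coev \<otimes>\<^sub>a Id A D))) = LUnit A D"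
    using assms by (simp add: is_dual_def Comp_assoc)
qed

lemma inv_Assoc_natural:
  assumes "f \<in> Arr A" "g \<in> Arr A" "h \<in> Arr A"
  shows "inv_arr A (Assoc A (Cod A f) (Cod A g) (Cod A h)) \<cdot> (f \<otimes>\<^sub>a (g \<otimes>\<^sub>a h))
    = (f \<otimes>\<^sub>a g \<otimes>\<^sub>a h) \<cdot> inv_arr A (Assoc A (Dom A f) (Dom A g) (Dom A h))"
proof -
  let ?\<alpha> = "Assoc A (Cod A f) (Cod A g) (Cod A h)" and ?\<beta> = "Assoc A (Dom A f) (Dom A g) (Dom A h)"
  have "inv_arr A ?\<alpha> \<cdot> ((f \<otimes>\<^sub>a (g \<otimes>\<^sub>a h)) \<cdot> ?\<beta>) \<cdot> inv_arr A ?\<beta> = inv_arr A ?\<alpha> \<cdot> (f \<otimes>\<^sub>a (g \<otimes>\<^sub>a h))"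
    using assms by (simp add: Comp_assoc)
  then show ?thesis using assms by (simp add: Comp_assoc flip: Assoc_natural)
qed

text \<open>With \<open>untranspose\<close>, the two directions of the adjunction between
  \<open>X \<otimes> -\<close> and \<open>D \<otimes> -\<close>: an arrow
  \<open>X \<otimes> P \<rightarrow> W\<close> corresponds to one
  \<open>P \<rightarrow> D \<otimes> W\<close>.\<close>

definition transpose :: "'a \<Rightarrow> 'a \<Rightarrow> 'b \<Rightarrow> 'a \<Rightarrow> 'b \<Rightarrow> 'b" where
  "transpose X D coev P h =
     (Id A D \<otimes>\<^sub>a h) \<cdot> (Assoc A D X P \<cdot> ((coev \<otimes>\<^sub>a Id A P) \<cdot> inv_arr A (LUnit A P)))"

definition untranspose :: "'a \<Rightarrow> 'a \<Rightarrow> 'b \<Rightarrow> 'a \<Rightarrow> 'b \<Rightarrow> 'b" where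
  "untranspose X D ev W g =
     LUnit A W \<cdot> ((ev \<otimes>\<^sub>a Id A W) \<cdot> (inv_arr A (Assoc A X D W) \<cdot> (Id A X \<otimes>\<^sub>a g)))"

context
  fixes X D ev coev
  assumes dual: "is_dual A X D ev coev"
begin

lemmas dual_simps [simp] = is_dualD(1-8)[OF dual]

lemma transpose_simps [simp]:
  assumes "h \<in> Arr A" "Dom A h = X \<otimes>\<^sub>o P" "P \<in> Ob A"
  shows "transpose X D coev P h \<in> Arr A" "Dom A (transpose X D coev P h) = P"
    "Cod A (transpose X D coev P h) = D \<otimes>\<^sub>o Cod A h"
  using assms by (simp_all add: transpose_def)

lemma untranspose_simps [simp]:
  assumes "g \<in> Arr A" "Cod A g = D \<otimes>\<^sub>o W" "W \<in> Ob A"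
  shows "untranspose X D ev W g \<in> Arr A" "Dom A (untranspose X D ev W g) = X \<otimes>\<^sub>o Dom A g"
    "Cod A (untranspose X D ev W g) = W"
  using assms by (simp_all add: untranspose_def)

lemma transpose_natural:
  assumes "h \<in> Arr A" "Dom A h = X \<otimes>\<^sub>o Cod A i" "i \<in> Arr A"
  shows "transpose X D coev (Cod A i) h \<cdot> i = transpose X D coev (Dom A i) (h \<cdot> (Id A X \<otimes>\<^sub>a i))"
proof -
  let ?P = "Cod A i" and ?U = "Dom A i" and ?I = "Id A (Unit A)"
  have "transpose X D coev ?P h \<cdot> i
    = (Id A D \<otimes>\<^sub>a h) \<cdot> (Assoc A D X ?P \<cdot> (((coev \<otimes>\<^sub>a Id A ?P) \<cdot> (?I \<otimes>\<^sub>a i)) \<cdot> inv_arr A (LUnit A ?U)))"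
    using assms inv_LUnit_natural[of i] by (simp add: transpose_def Comp_assoc)
  also have "(coev \<otimes>\<^sub>a Id A ?P) \<cdot> (?I \<otimes>\<^sub>a i) = ((Id A D \<otimes>\<^sub>a Id A X) \<otimes>\<^sub>a i) \<cdot> (coev \<otimes>\<^sub>a Id A ?U)"
    using assms by (simp add: Ten_Comp)
  also have "(Id A D \<otimes>\<^sub>a h) \<cdot> (Assoc A D X ?P \<cdot> (\<dots> \<cdot> inv_arr A (LUnit A ?U)))
    = (Id A D \<otimes>\<^sub>a h) \<cdot> ((Assoc A D X ?P \<cdot> (Id A D \<otimes>\<^sub>a Id A X \<otimes>\<^sub>a i)) \<cdot> ((coev \<otimes>\<^sub>a Id A ?U) \<cdot> inv_arr A (LUnit A ?U)))"
    using assms by (simp add: Comp_assoc)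
  also have "Assoc A D X ?P \<cdot> (Id A D \<otimes>\<^sub>a Id A X \<otimes>\<^sub>a i) = (Id A D \<otimes>\<^sub>a (Id A X \<otimes>\<^sub>a i)) \<cdot> Assoc A D X ?U"
    using Assoc_natural[of "Id A D" "Id A X" i] assms by simp
  also have "(Id A D \<otimes>\<^sub>a h) \<cdot> ((Id A D \<otimes>\<^sub>a (Id A X \<otimes>\<^sub>a i)) \<cdot> Assoc A D X ?U \<cdot> ((coev \<otimes>\<^sub>a Id A ?U) \<cdot> inv_arr A (LUnit A ?U)))
    = ((Id A D \<otimes>\<^sub>a h) \<cdot> (Id A D \<otimes>\<^sub>a (Id A X \<otimes>\<^sub>a i))) \<cdot> (Assoc A D X ?U \<cdot> ((coev \<otimes>\<^sub>a Id A ?U) \<cdot> inv_arr A (LUnit A ?U)))"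
    using assms by (simp add: Comp_assoc)
  also have "\<dots> = transpose X D coev ?U (h \<cdot> (Id A X \<otimes>\<^sub>a i))"
    using assms by (simp add: transpose_def Ten_Comp)
  finally show ?thesis .
qed

lemma transpose_Zero:
  assumes "P \<in> Ob A" "W \<in> Ob A"
  shows "transpose X D coev P (Zero A (X \<otimes>\<^sub>o P) W) = Zero A P (D \<otimes>\<^sub>o W)"
  using assms by (simp add: transpose_def Ten_Zero)

lemma untranspose_Zero:
  assumes "P \<in> Ob A" "W \<in> Ob A"
  shows "untranspose X D ev W (Zero A P (D \<otimes>\<^sub>o W)) = Zero A (X \<otimes>\<^sub>o P) W"
  using assms by (simp add: untranspose_def Ten_Zero)

lemma untranspose_natural:
  assumes "g \<in> Arr A" "Cod A g = D \<otimes>\<^sub>o W" "W \<in> Ob A" "i \<in> Arr A" "Dom A g = Cod A i"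
  shows "untranspose X D ev W (g \<cdot> i) = untranspose X D ev W g \<cdot> (Id A X \<otimes>\<^sub>a i)"
proof -
  have "Id A X \<otimes>\<^sub>a (g \<cdot> i) = (Id A X \<otimes>\<^sub>a g) \<cdot> (Id A X \<otimes>\<^sub>a i)"
    using assms by (simp add: Ten_Comp)
  then show ?thesis using assms by (simp add: untranspose_def Comp_assoc)
qed

lemma untranspose_Comp:
  assumes "g \<in> Arr A" "h \<in> Arr A" "Cod A g = D \<otimes>\<^sub>o Dom A h"
  shows "untranspose X D ev (Cod A h) ((Id A D \<otimes>\<^sub>a h) \<cdot> g) = h \<cdot> untranspose X D ev (Dom A h) g"
proof -
  let ?W = "Cod A h" and ?V = "Dom A h" and ?I = "Id A (Unit A)"
  have "Id A X \<otimes>\<^sub>a ((Id A D \<otimes>\<^sub>a h) \<cdot> g) = (Id A X \<otimes>\<^sub>a (Id A D \<otimes>\<^sub>a h)) \<cdot> (Id A X \<otimes>\<^sub>a g)"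
    using assms by (simp add: Ten_Comp)
  then have "untranspose X D ev ?W ((Id A D \<otimes>\<^sub>a h) \<cdot> g)
    = LUnit A ?W \<cdot> ((ev \<otimes>\<^sub>a Id A ?W) \<cdot> ((inv_arr A (Assoc A X D ?W) \<cdot> (Id A X \<otimes>\<^sub>a (Id A D \<otimes>\<^sub>a h))) \<cdot> (Id A X \<otimes>\<^sub>a g)))"
    using assms by (simp add: untranspose_def Comp_assoc)
  also have "inv_arr A (Assoc A X D ?W) \<cdot> (Id A X \<otimes>\<^sub>a (Id A D \<otimes>\<^sub>a h))
    = (Id A (X \<otimes>\<^sub>o D) \<otimes>\<^sub>a h) \<cdot> inv_arr A (Assoc A X D ?V)"
    using inv_Assoc_natural[of "Id A X" "Id A D" h] assms by simp
  also have "LUnit A ?W \<cdot> ((ev \<otimes>\<^sub>a Id A ?W) \<cdot> (\<dots> \<cdot> (Id A X \<otimes>\<^sub>a g)))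
    = LUnit A ?W \<cdot> (((ev \<otimes>\<^sub>a Id A ?W) \<cdot> (Id A (X \<otimes>\<^sub>o D) \<otimes>\<^sub>a h)) \<cdot> (inv_arr A (Assoc A X D ?V) \<cdot> (Id A X \<otimes>\<^sub>a g)))"
    using assms by (simp add: Comp_assoc)
  also have "(ev \<otimes>\<^sub>a Id A ?W) \<cdot> (Id A (X \<otimes>\<^sub>o D) \<otimes>\<^sub>a h) = (?I \<otimes>\<^sub>a h) \<cdot> (ev \<otimes>\<^sub>a Id A ?V)"
    using assms by (simp add: Ten_Comp)
  also have "LUnit A ?W \<cdot> (\<dots> \<cdot> (inv_arr A (Assoc A X D ?V) \<cdot> (Id A X \<otimes>\<^sub>a g)))
    = (LUnit A ?W \<cdot> (?I \<otimes>\<^sub>a h)) \<cdot> ((ev \<otimes>\<^sub>a Id A ?V) \<cdot> (inv_arr A (Assoc A X D ?V) \<cdot> (Id A X \<otimes>\<^sub>a g)))"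
    using assms by (simp add: Comp_assoc)
  also have "\<dots> = h \<cdot> untranspose X D ev ?V g"
    using assms by (simp add: LUnit_natural untranspose_def Comp_assoc)
  finally show ?thesis .
qed

text \<open>The following isomorphism is in fact the identity, but this would need a further coherence
  argument.\<close>

definition twist :: "'a \<Rightarrow> 'b" where
  "twist P = untranspose X D ev (X \<otimes>\<^sub>o P) (transpose X D coev P (Id A (X \<otimes>\<^sub>o P)))"

lemma twist_simps [simp]:
  assumes "P \<in> Ob A"
  shows "twist P \<in> Arr A" "Dom A (twist P) = X \<otimes>\<^sub>o P" "Cod A (twist P) = X \<otimes>\<^sub>o P"
  using assms by (simp_all add: twist_def)

text \<open>A Yoneda argument: by naturality in the target, the round trip is determined by its
  value at the identity of \<open>X \<otimes> P\<close>, which is \<open>twist P\<close>.\<close>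

lemma untranspose_transpose:
  assumes "h \<in> Arr A" "Dom A h = X \<otimes>\<^sub>o P" "P \<in> Ob A"
  shows "untranspose X D ev (Cod A h) (transpose X D coev P h) = h \<cdot> twist P"
proof -
  have "transpose X D coev P h = (Id A D \<otimes>\<^sub>a h) \<cdot> transpose X D coev P (Id A (X \<otimes>\<^sub>o P))"
    using assms by (simp add: transpose_def)
  then show ?thesis using assms by (simp add: twist_def untranspose_Comp)
qed

lemma twist_natural:
  assumes "i \<in> Arr A"
  shows "twist (Cod A i) \<cdot> (Id A X \<otimes>\<^sub>a i) = (Id A X \<otimes>\<^sub>a i) \<cdot> twist (Dom A i)"
proof -
  let ?P = "Cod A i" and ?U = "Dom A i"
  have "twist ?P \<cdot> (Id A X \<otimes>\<^sub>a i)
    = untranspose X D ev (X \<otimes>\<^sub>o ?P) (transpose X D coev ?P (Id A (X \<otimes>\<^sub>o ?P)) \<cdot> i)"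
    using assms by (simp add: twist_def untranspose_natural)
  also have "\<dots> = untranspose X D ev (X \<otimes>\<^sub>o ?P) (transpose X D coev ?U (Id A X \<otimes>\<^sub>a i))"
    using assms transpose_natural[of "Id A (X \<otimes>\<^sub>o ?P)" i] by simp
  also have "\<dots> = (Id A X \<otimes>\<^sub>a i) \<cdot> twist ?U"
    using assms untranspose_transpose[of "Id A X \<otimes>\<^sub>a i" ?U] by simp
  finally show ?thesis .
qed

text \<open>Up to associators and unit constraints, \<open>twist P\<close> is the zig-zag of
  \<open>X\<close> tensored with \<open>P\<close>. The zig-zag is invertible by the triangle
  identity, and the pentagon provides the comparison; so \<open>twist P\<close> followed after one
  isomorphism equals another.\<close>

lemma twist_iso:
  assumes P [simp]: "P \<in> Ob A"
  shows "is_iso A (twist P)"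
proof -
  let ?XP = "X \<otimes>\<^sub>o P" and ?I = "Id A (Unit A)"
  let ?a1 = "Assoc A X D ?XP" and ?a2 = "Assoc A (X \<otimes>\<^sub>o D) X P" and ?a3 = "Assoc A X (D \<otimes>\<^sub>o X) P"
    and ?t = "Assoc A X D X" and ?d = "Assoc A D X P" and ?u = "Assoc A X (Unit A) P"
    and ?c = "Id A X \<otimes>\<^sub>a coev" and ?e = "ev \<otimes>\<^sub>a Id A X"
  \<comment> \<open>The zig-zag of \<open>X\<close> stripped of its unit constraints; the triangle
    identity makes it the inverse of \<open>LUnit A X\<close> after
    \<open>RUnit A X\<close>.\<close>
  define s where "s = ?e \<cdot> (inv_arr A ?t \<cdot> ?c)"
  have s [simp]: "s \<in> Arr A" "Dom A s = X \<otimes>\<^sub>o Unit A" "Cod A s = Unit A \<otimes>\<^sub>o X"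
    by (simp_all add: s_def)
  have "inv_arr A (LUnit A X) \<cdot> RUnit A X = s"
    unfolding is_dualD(9)[OF dual, symmetric] s_def by simp
  then have s_iso: "is_iso A s"
    by (metis is_iso_Comp is_iso_inv_arr dual_simps(1) LUnit_simps(4) RUnit_simps(3,4) inv_LUnit(2))
  \<comment> \<open>The pentagon for \<open>X\<close>, \<open>D\<close>, \<open>X\<close>,
    \<open>P\<close>, with the associator of \<open>X\<close>, \<open>D\<close>, \<open>X\<close>
    moved to the other side.\<close>
  have pent: "(Id A X \<otimes>\<^sub>a ?d) \<cdot> ?a3 = ?a1 \<cdot> (?a2 \<cdot> (inv_arr A ?t \<otimes>\<^sub>a Id A P))"
  proof -
    have "((Id A X \<otimes>\<^sub>a ?d) \<cdot> ?a3 \<cdot> (?t \<otimes>\<^sub>a Id A P)) \<cdot> (inv_arr A ?t \<otimes>\<^sub>a Id A P)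
      = ?a1 \<cdot> ?a2 \<cdot> (inv_arr A ?t \<otimes>\<^sub>a Id A P)"
      by (simp add: pentagon)
    then show ?thesis by (simp add: Comp_assoc Ten_Comp)
  qed
  have 1: "(Id A X \<otimes>\<^sub>a (coev \<otimes>\<^sub>a Id A P)) \<cdot> ?u = ?a3 \<cdot> (?c \<otimes>\<^sub>a Id A P)"
    using Assoc_natural[of "Id A X" coev "Id A P"] by simp
  have 2: "(ev \<otimes>\<^sub>a Id A ?XP) \<cdot> ?a2 = Assoc A (Unit A) X P \<cdot> (?e \<otimes>\<^sub>a Id A P)"
    using Assoc_natural[of ev "Id A X" "Id A P"] by simp
  have "Id A X \<otimes>\<^sub>a (?d \<cdot> ((coev \<otimes>\<^sub>a Id A P) \<cdot> inv_arr A (LUnit A P)))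
    = (Id A X \<otimes>\<^sub>a ?d) \<cdot> ((Id A X \<otimes>\<^sub>a (coev \<otimes>\<^sub>a Id A P)) \<cdot> (Id A X \<otimes>\<^sub>a inv_arr A (LUnit A P)))"
    by (simp add: Ten_Comp)
  then have "twist P \<cdot> ((Id A X \<otimes>\<^sub>a LUnit A P) \<cdot> ?u)
    = LUnit A ?XP \<cdot> ((ev \<otimes>\<^sub>a Id A ?XP) \<cdot> (inv_arr A ?a1 \<cdot> ((Id A X \<otimes>\<^sub>a ?d) \<cdot>
       ((Id A X \<otimes>\<^sub>a (coev \<otimes>\<^sub>a Id A P)) \<cdot> (((Id A X \<otimes>\<^sub>a inv_arr A (LUnit A P)) \<cdot> (Id A X \<otimes>\<^sub>a LUnit A P)) \<cdot> ?u)))))"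
    by (simp add: twist_def untranspose_def transpose_def Comp_assoc)
  also have "(Id A X \<otimes>\<^sub>a inv_arr A (LUnit A P)) \<cdot> (Id A X \<otimes>\<^sub>a LUnit A P) = Id A (X \<otimes>\<^sub>o (Unit A \<otimes>\<^sub>o P))"
    by (simp add: Ten_Comp)
  also have "LUnit A ?XP \<cdot> ((ev \<otimes>\<^sub>a Id A ?XP) \<cdot> (inv_arr A ?a1 \<cdot> ((Id A X \<otimes>\<^sub>a ?d) \<cdot>
       ((Id A X \<otimes>\<^sub>a (coev \<otimes>\<^sub>a Id A P)) \<cdot> (Id A (X \<otimes>\<^sub>o (Unit A \<otimes>\<^sub>o P)) \<cdot> ?u)))))
    = LUnit A ?XP \<cdot> ((ev \<otimes>\<^sub>a Id A ?XP) \<cdot> (inv_arr A ?a1 \<cdot> (((Id A X \<otimes>\<^sub>a ?d) \<cdot> ?a3) \<cdot> (?c \<otimes>\<^sub>a Id A P))))"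
    by (simp add: 1 Comp_assoc)
  also have "\<dots> = LUnit A ?XP \<cdot> (((ev \<otimes>\<^sub>a Id A ?XP) \<cdot> ?a2) \<cdot> ((inv_arr A ?t \<otimes>\<^sub>a Id A P) \<cdot> (?c \<otimes>\<^sub>a Id A P)))"
    unfolding pent by (simp add: Comp_assoc)
  also have "\<dots> = LUnit A ?XP \<cdot> (Assoc A (Unit A) X P \<cdot> ((?e \<otimes>\<^sub>a Id A P) \<cdot> ((inv_arr A ?t \<otimes>\<^sub>a Id A P) \<cdot> (?c \<otimes>\<^sub>a Id A P))))"
    unfolding 2 by (simp add: Comp_assoc)
  also have "(?e \<otimes>\<^sub>a Id A P) \<cdot> ((inv_arr A ?t \<otimes>\<^sub>a Id A P) \<cdot> (?c \<otimes>\<^sub>a Id A P)) = s \<otimes>\<^sub>a Id A P"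
    by (simp add: Ten_Comp s_def)
  finally have eq: "twist P \<cdot> ((Id A X \<otimes>\<^sub>a LUnit A P) \<cdot> ?u)
    = LUnit A ?XP \<cdot> (Assoc A (Unit A) X P \<cdot> (s \<otimes>\<^sub>a Id A P))" .
  have "is_iso A (LUnit A ?XP \<cdot> (Assoc A (Unit A) X P \<cdot> (s \<otimes>\<^sub>a Id A P)))"
    by (intro is_iso_Comp is_iso_Ten s_iso is_iso_Id) simp_all
  moreover have "is_iso A ((Id A X \<otimes>\<^sub>a LUnit A P) \<cdot> ?u)"
    by (intro is_iso_Comp is_iso_Ten is_iso_Id) simp_all
  ultimately show ?thesis
    unfolding eq[symmetric] by (rule is_isoD_factor) simp_all
qed

text \<open>The functor \<open>X \<otimes> -\<close> has a right adjoint and therefore preserves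
  cokernels. Test arrows are transposed, handled with the cokernel \<open>p\<close>, and transposed
  back at the price of a natural isomorphism \<open>twist\<close>.\<close>

lemma Ten_cokernel_if_dual:
  assumes p: "is_cokernel A p i"
  shows "is_cokernel A (Id A X \<otimes>\<^sub>a p) (Id A X \<otimes>\<^sub>a i)"
proof -
  note p' [simp] = is_cokernelD(1-3)[OF p]
  let ?U = "Dom A i" and ?P = "Cod A i" and ?Q = "Cod A p"
  show ?thesis
  proof (rule is_cokernelI)
    show "(Id A X \<otimes>\<^sub>a p) \<cdot> (Id A X \<otimes>\<^sub>a i) = Zero A (Dom A (Id A X \<otimes>\<^sub>a i)) (Cod A (Id A X \<otimes>\<^sub>a p))"
      using is_cokernelD(4)[OF p] by (simp add: Ten_Comp Ten_Zero)
    show "is_epi A (Id A X \<otimes>\<^sub>a p)"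
    proof (rule is_epiI)
      fix g assume g: "g \<in> Arr A" "Dom A g = Cod A (Id A X \<otimes>\<^sub>a p)"
        "g \<cdot> (Id A X \<otimes>\<^sub>a p) = Zero A (Dom A (Id A X \<otimes>\<^sub>a p)) (Cod A g)"
      have "transpose X D coev ?Q g \<cdot> p = Zero A ?P (D \<otimes>\<^sub>o Cod A g)"
        using g transpose_natural[of g p] transpose_Zero[of ?P "Cod A g"] by simp
      then have "transpose X D coev ?Q g = Zero A ?Q (D \<otimes>\<^sub>o Cod A g)"
        using is_epi_Zero[OF is_cokernelD(5)[OF p], of "transpose X D coev ?Q g"] g by simp
      then have "g \<cdot> twist ?Q = Zero A (X \<otimes>\<^sub>o ?Q) (Cod A g)"
        using g untranspose_Zero[of ?Q "Cod A g"] by (simp flip: untranspose_transpose)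
      then show "g = Zero A (Cod A (Id A X \<otimes>\<^sub>a p)) (Cod A g)"
        using is_epi_Zero[OF iso_is_epi[OF twist_iso[of ?Q]], of g] g by simp
    qed simp
    fix h assume h: "h \<in> Arr A" "Dom A h = Cod A (Id A X \<otimes>\<^sub>a i)"
      "h \<cdot> (Id A X \<otimes>\<^sub>a i) = Zero A (Dom A (Id A X \<otimes>\<^sub>a i)) (Cod A h)"
    \<comment> \<open>Compensates in advance for the \<open>twist\<close> that transposing back and
      forth introduces.\<close>
    define k where "k = h \<cdot> inv_arr A (twist ?P)"
    have k [simp]: "k \<in> Arr A" "Dom A k = X \<otimes>\<^sub>o ?P" "Cod A k = Cod A h" "k \<cdot> twist ?P = h"
      using h by (simp_all add: k_def twist_iso Comp_assoc)
    have "k \<cdot> (Id A X \<otimes>\<^sub>a i) \<cdot> twist ?U = h \<cdot> (Id A X \<otimes>\<^sub>a i)"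
      using h by (simp add: Comp_assoc Comp_assoc_eq[OF k(4)] flip: twist_natural)
    also have "\<dots> = Zero A (X \<otimes>\<^sub>o ?U) (Cod A h)"
      using h by simp
    finally have "k \<cdot> (Id A X \<otimes>\<^sub>a i) = Zero A (X \<otimes>\<^sub>o ?U) (Cod A h)"
      using is_epi_Zero[OF iso_is_epi[OF twist_iso[of ?U]], of "k \<cdot> (Id A X \<otimes>\<^sub>a i)"] h by simp
    then have "transpose X D coev ?P k \<cdot> i = Zero A ?U (D \<otimes>\<^sub>o Cod A h)"
      using h transpose_Zero[of ?U "Cod A h"] by (simp add: transpose_natural)
    then obtain g where g: "g \<in> Arr A" "Cod A g = D \<otimes>\<^sub>o Cod A h" "Dom A g = ?Q"
      "g \<cdot> p = transpose X D coev ?P k"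
      using is_cokernel_factor[OF p, of "transpose X D coev ?P k"] h by auto
    have "untranspose X D ev (Cod A h) g \<cdot> (Id A X \<otimes>\<^sub>a p) = k \<cdot> twist ?P"
      using untranspose_natural[of g "Cod A h" p] untranspose_transpose[of k ?P] g h by simp
    then show "\<exists>u \<in> Arr A. Cod A u = Cod A h \<and> Dom A u = Cod A (Id A X \<otimes>\<^sub>a p) \<and> u \<cdot> (Id A X \<otimes>\<^sub>a p) = h"
      using g h by (intro bexI[of _ "untranspose X D ev (Cod A h) g"]) simp_all
  qed simp_all
qed

end

end

lemma (in rigid_tensor_category) Ten_cokernel:
  assumes "is_cokernel A p i" "X \<in> Ob A"
  shows "is_cokernel A (Id A X \<otimes>\<^sub>a p) (Id A X \<otimes>\<^sub>a i)"
  using rigid[OF assms(2)] Ten_cokernel_if_dual[OF _ assms(1)] by blast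

context rigid_tensor_category
begin

lemma Ten_epi_right:
  assumes "is_cokernel A p i" "X \<in> Ob A"
  shows "is_epi A (p \<otimes>\<^sub>a Id A X)"
proof -
  note p = is_cokernelD(1-3)[OF assms(1)]
  let ?S = "Sym A (Dom A p) X" and ?T = "Sym A X (Cod A p)"
  have e: "is_epi A (Id A X \<otimes>\<^sub>a p)" using is_cokernelD(5)[OF Ten_cokernel[OF assms]] .
  have "?T \<cdot> ((Id A X \<otimes>\<^sub>a p) \<cdot> ?S) = (?T \<cdot> (Id A X \<otimes>\<^sub>a p)) \<cdot> ?S"
    using p assms(2) by (simp add: Comp_assoc)
  also have "?T \<cdot> (Id A X \<otimes>\<^sub>a p) = (p \<otimes>\<^sub>a Id A X) \<cdot> Sym A X (Dom A p)"
    using Sym_natural[of "Id A X" p] p assms(2) by simp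
  also have "\<dots> \<cdot> ?S = p \<otimes>\<^sub>a Id A X" using p assms(2) by (simp add: Comp_assoc sym_sym)
  finally show ?thesis
    using is_epi_Comp[OF iso_is_epi[of ?T] is_epi_Comp[OF e iso_is_epi[of ?S]]] p assms(2) by simp
qed

lemma Ten_Zero_Ten:
  assumes "X \<in> Ob A" "Y \<in> Ob A" "i \<in> Arr A"
    "Id A X \<otimes>\<^sub>a i = Zero A (X \<otimes>\<^sub>o Dom A i) (X \<otimes>\<^sub>o Cod A i)"
  shows "Id A (Y \<otimes>\<^sub>o X) \<otimes>\<^sub>a i = Zero A (Y \<otimes>\<^sub>o X \<otimes>\<^sub>o Dom A i) (Y \<otimes>\<^sub>o X \<otimes>\<^sub>o Cod A i)"
proof -
  let ?\<alpha> = "Assoc A Y X (Cod A i)"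
  have "?\<alpha> \<cdot> (Id A (Y \<otimes>\<^sub>o X) \<otimes>\<^sub>a i) = Zero A (Y \<otimes>\<^sub>o X \<otimes>\<^sub>o Dom A i) (Y \<otimes>\<^sub>o (X \<otimes>\<^sub>o Cod A i))"
    using Assoc_natural[of "Id A Y" "Id A X" i] assms by (simp add: Ten_Zero)
  then show ?thesis
    using is_mono_Zero[OF iso_is_mono[of ?\<alpha>], of "Id A (Y \<otimes>\<^sub>o X) \<otimes>\<^sub>a i"] assms by simp
qed

text \<open>Together with \<open>Ten_Zero_Ten\<close>, this transports vanishing of
  \<open>V \<otimes> i\<close> to the dual of \<open>V\<close>, which is a retract of a tensor
  product containing \<open>V\<close>.\<close>

lemma Ten_Zero_retract:
  assumes "i \<in> Arr A" "Id A X \<otimes>\<^sub>a i = Zero A (X \<otimes>\<^sub>o Dom A i) (X \<otimes>\<^sub>o Cod A i)"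
    "g \<in> Arr A" "r \<in> Arr A" "Dom A r = X" "Cod A g = X" "r \<cdot> g = Id A Y" "Dom A g = Y" "Cod A r = Y"
  shows "Id A Y \<otimes>\<^sub>a i = Zero A (Y \<otimes>\<^sub>o Dom A i) (Y \<otimes>\<^sub>o Cod A i)"
proof -
  have [simp]: "X \<in> Ob A" "Y \<in> Ob A" using assms by auto
  have "Id A Y \<otimes>\<^sub>a i = (r \<otimes>\<^sub>a Id A (Cod A i)) \<cdot> ((Id A X \<otimes>\<^sub>a i) \<cdot> (g \<otimes>\<^sub>a Id A (Dom A i)))"
    using assms(1,3-) by (simp add: Ten_Comp)
  also have "\<dots> = Zero A (Y \<otimes>\<^sub>o Dom A i) (Y \<otimes>\<^sub>o Cod A i)"
    unfolding assms(2) using assms(1,3-) by simp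
  finally show ?thesis .
qed

end

section \<open>Subobjects of the unit object and supports\<close>

context rigid_abelian_category
begin

text \<open>If \<open>i\<close> is the kernel of \<open>p : 1 \<rightarrow> V\<close>, then \<open>V \<otimes> i = 0\<close>, hence \<open>D \<otimes> i = 0\<close> for the dual \<open>D\<close> of
  \<open>V\<close>, and \<open>D \<otimes> p\<close> is an isomorphism by right exactness. So \<open>1 \<rightarrow> D \<otimes> V\<close> lifts along \<open>D \<otimes> p\<close>, and
  the transpose of the lift is a section of \<open>p\<close>.\<close>

lemma epi_from_unit_split:
  assumes p: "is_epi A p" and p1: "Dom A p = Unit A"
  obtains s where "s \<in> Arr A" "Dom A s = Cod A p" "Cod A s = Unit A" "p \<cdot> s = Id A (Cod A p)"
proof -
  let ?V = "Cod A p" and ?I = "Id A (Unit A)"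
  have [simp]: "p \<in> Arr A" using p by (simp add: is_epi_def)
  obtain i where i: "is_kernel A i p" using has_kernel by force
  have pi: "is_cokernel A p i" by (rule epi_cokernel_of_kernel[OF p i])
  note i' [simp] = is_kernelD(2)[OF i] is_kernelD(3)[OF i, unfolded p1]
  let ?U = "Dom A i" and ?r = "RUnit A (Unit A)" and ?l = "LUnit A (Unit A)"
  have [simp]: "?V \<in> Ob A" "?U \<in> Ob A" by simp_all
  \<comment> \<open>By interchange, \<open>V \<otimes> i\<close> after \<open>p \<otimes> U\<close>
    is \<open>p \<otimes> 1\<close> after \<open>1 \<otimes> i\<close>. Up to unit constraints the
    latter is \<open>p i = 0\<close>, and \<open>p \<otimes> U\<close> is epi.\<close>
  have Vi: "Id A ?V \<otimes>\<^sub>a i = Zero A (?V \<otimes>\<^sub>o ?U) (?V \<otimes>\<^sub>o Unit A)"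
  proof -
    \<comment> \<open>The possible discrepancy of the two unit constraints at the unit object is a
      scalar and is pulled out of the composite as such.\<close>
    have c: "?r \<cdot> inv_arr A ?l \<in> scalars A" by (intro scalarsI) simp_all
    have 1: "?I \<otimes>\<^sub>a i = inv_arr A ?l \<cdot> (i \<cdot> LUnit A ?U)"
      using LUnit_natural[of i] LUnit_cancel(1)[of "Unit A" "?I \<otimes>\<^sub>a i"] by simp
    have "RUnit A ?V \<cdot> ((p \<otimes>\<^sub>a ?I) \<cdot> (?I \<otimes>\<^sub>a i)) = (p \<cdot> ?r) \<cdot> (?I \<otimes>\<^sub>a i)"
      using RUnit_natural[of p] p1 by (simp flip: Comp_assoc)
    also have "\<dots> = p \<cdot> ((?r \<cdot> inv_arr A ?l) \<cdot> (i \<cdot> LUnit A ?U))"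
      unfolding 1 using p1 by (simp add: Comp_assoc)
    also have "\<dots> = (?r \<cdot> inv_arr A ?l) \<star> ((p \<cdot> i) \<cdot> LUnit A ?U)"
      using c p1 by (simp add: scalar_Comp scal_Comp_right Comp_assoc)
    also have "\<dots> = Zero A (Unit A \<otimes>\<^sub>o ?U) ?V"
      using c is_kernelD(4)[OF i] by simp
    finally have "(p \<otimes>\<^sub>a ?I) \<cdot> (?I \<otimes>\<^sub>a i) = Zero A (Unit A \<otimes>\<^sub>o ?U) (?V \<otimes>\<^sub>o Unit A)"
      using is_mono_Zero[OF iso_is_mono[of "RUnit A ?V"], of "(p \<otimes>\<^sub>a ?I) \<cdot> (?I \<otimes>\<^sub>a i)"] p1 by simp
    then have "(Id A ?V \<otimes>\<^sub>a i) \<cdot> (p \<otimes>\<^sub>a Id A ?U) = Zero A (Unit A \<otimes>\<^sub>o ?U) (?V \<otimes>\<^sub>o Unit A)"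
      using p1 by (simp add: Ten_Comp)
    then show ?thesis
      using is_epi_Zero[OF Ten_epi_right[OF pi, of ?U], of "Id A ?V \<otimes>\<^sub>a i"] p1 by simp
  qed
  obtain D ev coev where d: "is_dual A ?V D ev coev" using rigid[of ?V] by auto
  note d' [simp] = is_dualD(1-8)[OF d]
  have "Id A (D \<otimes>\<^sub>o (?V \<otimes>\<^sub>o D)) \<otimes>\<^sub>a i
    = Zero A (D \<otimes>\<^sub>o (?V \<otimes>\<^sub>o D) \<otimes>\<^sub>o ?U) (D \<otimes>\<^sub>o (?V \<otimes>\<^sub>o D) \<otimes>\<^sub>o Unit A)"
  proof -
    have "Id A (?V \<otimes>\<^sub>o D) \<otimes>\<^sub>a i = Zero A (?V \<otimes>\<^sub>o D \<otimes>\<^sub>o ?U) (?V \<otimes>\<^sub>o D \<otimes>\<^sub>o Unit A)"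
      using Ten_Zero_retract[of i "D \<otimes>\<^sub>o ?V" "Sym A ?V D" "Sym A D ?V" "?V \<otimes>\<^sub>o D"]
        Ten_Zero_Ten[of ?V D i] Vi by (simp add: sym_sym)
    then show ?thesis using Ten_Zero_Ten[of "?V \<otimes>\<^sub>o D" D i] by simp
  qed
  \<comment> \<open>The triangle identity exhibits \<open>D\<close> as a retract of
    \<open>D \<otimes> (V \<otimes> D)\<close>, for which the vanishing has just been shown.\<close>
  then have Di: "Id A D \<otimes>\<^sub>a i = Zero A (D \<otimes>\<^sub>o ?U) (D \<otimes>\<^sub>o Unit A)"
    using is_dualD(10)[OF d]
      Ten_Zero_retract[of i "D \<otimes>\<^sub>o (?V \<otimes>\<^sub>o D)"
        "Assoc A D ?V D \<cdot> ((coev \<otimes>\<^sub>a Id A D) \<cdot> inv_arr A (LUnit A D))" "RUnit A D \<cdot> (Id A D \<otimes>\<^sub>a ev)" D]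
      Comp_assoc_eq[of "RUnit A D" "(Id A D \<otimes>\<^sub>a ev) \<cdot> (Assoc A D ?V D \<cdot> (coev \<otimes>\<^sub>a Id A D))"
        "LUnit A D" "inv_arr A (LUnit A D)"]
    by (simp add: Comp_assoc)
  have Dp: "is_cokernel A (Id A D \<otimes>\<^sub>a p) (Id A D \<otimes>\<^sub>a i)" by (rule Ten_cokernel[OF pi]) simp
  \<comment> \<open>\<open>D \<otimes> p\<close> is a cokernel of a zero arrow, so the identity
    factors through it; \<open>r\<close> turns out to be a two-sided inverse.\<close>
  obtain r where r: "r \<in> Arr A" "Cod A r = D \<otimes>\<^sub>o Unit A" "Dom A r = D \<otimes>\<^sub>o ?V"
    "r \<cdot> (Id A D \<otimes>\<^sub>a p) = Id A (D \<otimes>\<^sub>o Unit A)"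
    using is_cokernel_factor[OF Dp, of "Id A (D \<otimes>\<^sub>o Unit A)"] Di p1 by auto
  have r': "(Id A D \<otimes>\<^sub>a p) \<cdot> r = Id A (D \<otimes>\<^sub>o ?V)"
    by (rule is_epiD[OF is_cokernelD(5)[OF Dp]]) (use r p1 in \<open>simp_all add: Comp_assoc\<close>)
  define s where "s = untranspose ?V D ev (Unit A) (r \<cdot> coev)"
  have s [simp]: "s \<in> Arr A" "Dom A s = ?V \<otimes>\<^sub>o Unit A" "Cod A s = Unit A"
    unfolding s_def using r untranspose_simps[OF d, of "r \<cdot> coev"] by simp_all
  have "p \<cdot> s = untranspose ?V D ev ?V ((Id A D \<otimes>\<^sub>a p) \<cdot> (r \<cdot> coev))"
    using untranspose_Comp[OF d, of "r \<cdot> coev" p] r p1 by (simp add: s_def)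
  also have "\<dots> = untranspose ?V D ev ?V coev"
    using Comp_assoc_eq[OF r', of coev] r p1 by simp
  also have "\<dots> = RUnit A ?V"
    using is_dualD(9)[OF d] by (simp add: untranspose_def)
  finally have ps: "p \<cdot> s = RUnit A ?V" .
  show thesis
    by (rule that[of "s \<cdot> inv_arr A (RUnit A ?V)"])
      (use p1 in \<open>simp_all add: Comp_assoc_eq[OF ps]\<close>)
qed

text \<open>The cokernel \<open>c\<close> of \<open>m\<close> starts at the unit object and has a
  section \<open>s\<close>. The projector \<open>1 - s c\<close> is killed by \<open>c\<close>,
  hence factors through \<open>m\<close>, and it fixes \<open>m\<close>; the factor is the
  retraction.\<close>

lemma mono_into_unit_split:
  assumes m: "is_mono A m" and m1: "Cod A m = Unit A"
  obtains r where "r \<in> Arr A" "Dom A r = Unit A" "Cod A r = Dom A m" "r \<cdot> m = Id A (Dom A m)"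
proof -
  let ?I = "Id A (Unit A)"
  have [simp]: "m \<in> Arr A" using m by (simp add: is_mono_def)
  obtain c where c: "is_cokernel A c m" using has_cokernel by force
  note c' [simp] = is_cokernelD(2)[OF c] is_cokernelD(3)[OF c, unfolded m1]
  have k: "is_kernel A m c" by (rule mono_kernel_of_cokernel[OF m c])
  obtain s where s [simp]: "s \<in> Arr A" "Dom A s = Cod A c" "Cod A s = Unit A" "c \<cdot> s = Id A (Cod A c)"
    using epi_from_unit_split[OF is_cokernelD(5)[OF c]] by auto
  define d where "d = Sub A ?I (s \<cdot> c)"
  have d [simp]: "d \<in> Arr A" "Dom A d = Unit A" "Cod A d = Unit A" by (simp_all add: d_def)
  have "c \<cdot> d = Zero A (Unit A) (Cod A c)"
    by (simp add: d_def Comp_Sub Comp_assoc_eq Sub_eq_Zero_iff)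
  then obtain r where r: "r \<in> Arr A" "Dom A r = Unit A" "Cod A r = Dom A m" "m \<cdot> r = d"
    using is_kernel_factor[OF k, of d] by auto
  have "d \<cdot> m = m"
    using is_kernelD(4)[OF k] m1 by (simp add: d_def Sub_Comp Comp_assoc Sub_eq_iff)
  then have "m \<cdot> (r \<cdot> m) = m \<cdot> Id A (Dom A m)"
    using Comp_assoc_eq[OF r(4), of m] r m1 by simp
  then have "r \<cdot> m = Id A (Dom A m)"
    by (rule is_monoD[OF m]) (use r m1 in simp_all)
  with r that show thesis by blast
qed

text \<open>Both halves of the image factorization \<open>z = m p\<close> split. A retraction of
  \<open>m\<close> followed by a section of \<open>p\<close> is the quasi-inverse.\<close>

lemma scalar_regular:
  assumes "z \<in> scalars A"
  obtains x where "x \<in> scalars A" "z \<cdot> (x \<cdot> z) = z"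
proof -
  obtain m p where f: "z = m \<cdot> p" "is_mono A m" "is_epi A p" "Dom A m = Cod A p"
    "Dom A p = Unit A" "Cod A m = Unit A"
    using assms image_factorization[of z] by (metis scalarsD)
  have [simp]: "m \<in> Arr A" "p \<in> Arr A" using f by (simp_all add: is_mono_def is_epi_def)
  obtain s where s: "s \<in> Arr A" "Dom A s = Cod A p" "Cod A s = Unit A" "p \<cdot> s = Id A (Cod A p)"
    using epi_from_unit_split f by blast
  obtain r where r: "r \<in> Arr A" "Dom A r = Unit A" "Cod A r = Dom A m" "r \<cdot> m = Id A (Dom A m)"
    using mono_into_unit_split f by blast
  show thesis
    by (rule that[of "s \<cdot> r"])
      (use r s f in \<open>auto intro!: scalarsI simp: Comp_assoc Comp_assoc_eq[OF r(4)] Comp_assoc_eq[OF s(4)]\<close>)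
qed

text \<open>\<open>coev\<close> and the identity of \<open>X\<close> are adjoint to each other, and
  the action of \<open>w\<close> commutes with passing from one to the other. This translates the
  kernel of \<open>coev\<close>, in terms of which supports are defined, into the annihilator of
  \<open>X\<close>.\<close>

lemma coev_scalar_Zero_iff:
  assumes d: "is_dual A X D ev coev" and w: "w \<in> scalars A"
  shows "coev \<cdot> w = Zero A (Unit A) (D \<otimes>\<^sub>o X) \<longleftrightarrow> w \<star> Id A X = Zero A X X"
proof
  note [simp] = is_dualD(1-8)[OF d]
  assume 0: "coev \<cdot> w = Zero A (Unit A) (D \<otimes>\<^sub>o X)"
  have "w \<star> RUnit A X
    = w \<star> (LUnit A X \<cdot> ((ev \<otimes>\<^sub>a Id A X) \<cdot> (inv_arr A (Assoc A X D X) \<cdot> (Id A X \<otimes>\<^sub>a coev))))"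
    by (simp add: is_dualD(9)[OF d])
  also have "\<dots> = LUnit A X \<cdot> ((ev \<otimes>\<^sub>a Id A X) \<cdot> (inv_arr A (Assoc A X D X) \<cdot> (Id A X \<otimes>\<^sub>a (w \<star> coev))))"
    using w by (simp add: scal_Comp_right scal_Ten_right)
  also have "w \<star> coev = Zero A (Unit A) (D \<otimes>\<^sub>o X)"
    using w 0 by (simp add: Comp_scalar)
  also have "LUnit A X \<cdot> ((ev \<otimes>\<^sub>a Id A X) \<cdot> (inv_arr A (Assoc A X D X) \<cdot> (Id A X \<otimes>\<^sub>a Zero A (Unit A) (D \<otimes>\<^sub>o X))))
    = Zero A (X \<otimes>\<^sub>o Unit A) X"
    by (simp add: Ten_Zero)
  finally have "(w \<star> Id A X) \<cdot> RUnit A X = Zero A (X \<otimes>\<^sub>o Unit A) X"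
    using w by (simp add: scal_Comp_left)
  then show "w \<star> Id A X = Zero A X X"
    using is_epi_Zero[OF iso_is_epi[of "RUnit A X"], of "w \<star> Id A X"] w by simp
next
  note [simp] = is_dualD(1-8)[OF d]
  assume 0: "w \<star> Id A X = Zero A X X"
  have "coev \<cdot> w = (Id A D \<otimes>\<^sub>a (w \<star> Id A X)) \<cdot> coev"
    using w by (simp add: Comp_scalar scal_Ten_right scal_Comp_left)
  then show "coev \<cdot> w = Zero A (Unit A) (D \<otimes>\<^sub>o X)"
    by (simp add: 0 Ten_Zero)
qed

text \<open>Says that the annihilator of \<open>f\<close> in \<open>Z\<close> is the ideal generated
  by \<open>1 - e\<close>. It characterizes the support without reference to a dual, a kernel or a
  complement.\<close>

definition annihilator_idem :: "'b \<Rightarrow> 'b \<Rightarrow> bool" where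
  "annihilator_idem f e \<longleftrightarrow> e \<in> scalars A \<and> e \<cdot> e = e \<and>
     (\<forall>w \<in> scalars A. w \<cdot> e = Zero A (Unit A) (Unit A) \<longleftrightarrow> w \<star> f = Zero A (Dom A f) (Cod A f))"

text \<open>\<open>1 - e\<close> kills \<open>e\<close>, hence \<open>f\<close>, hence
  \<open>e'\<close>, so that \<open>e' = e e'\<close>; exchanging the roles gives equality by
  commutativity.\<close>

lemma annihilator_idem_unique:
  assumes "annihilator_idem f e" "annihilator_idem f e'"
  shows "e = e'"
proof -
  have *: "e' = e \<cdot> e'" if "annihilator_idem f e" "annihilator_idem f e'" for e e'
  proof -
    have s: "e \<in> scalars A" "e' \<in> scalars A" using that by (auto simp: annihilator_idem_def)
    have "Sub A (Id A (Unit A)) e \<cdot> e = Zero A (Unit A) (Unit A)"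
      using that s by (simp add: Sub_Comp Sub_eq_Zero_iff annihilator_idem_def)
    then have "Sub A (Id A (Unit A)) e \<cdot> e' = Zero A (Unit A) (Unit A)"
      using that s by (auto simp: annihilator_idem_def)
    then show ?thesis using s by (simp add: Sub_Comp Sub_eq_Zero_iff)
  qed
  have "e \<in> scalars A" "e' \<in> scalars A" using assms by (auto simp: annihilator_idem_def)
  then show ?thesis using *[OF assms] *[OF assms(2,1)] scalars_commute by metis
qed

text \<open>\<open>e\<close> and \<open>coev\<close> share the kernel \<open>k\<close>, so each of
  them kills \<open>w\<close> exactly when \<open>w\<close> factors through \<open>k\<close>; for
  \<open>coev\<close> this means that \<open>w\<close> kills \<open>X\<close>.\<close>

lemma annihilator_idem_if_kernels:
  assumes d: "is_dual A X D ev coev" and k: "is_kernel A k coev" and e: "is_kernel A k e"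
    "e \<in> scalars A" "e \<cdot> e = e"
  shows "annihilator_idem (Id A X) e"
  unfolding annihilator_idem_def
proof (intro conjI ballI e(2,3))
  fix w assume w: "w \<in> scalars A"
  note [simp] = is_dualD(1-8)[OF d]
  have "w \<cdot> e = Zero A (Unit A) (Unit A) \<longleftrightarrow> e \<cdot> w = Zero A (Unit A) (Unit A)"
    using scalars_commute[OF w e(2)] by simp
  also have "\<dots> \<longleftrightarrow> coev \<cdot> w = Zero A (Unit A) (D \<otimes>\<^sub>o X)"
  proof
    assume "e \<cdot> w = Zero A (Unit A) (Unit A)"
    then obtain u where u: "u \<in> Arr A" "Dom A u = Unit A" "Cod A u = Dom A k" "k \<cdot> u = w"
      using is_kernel_factor[OF e(1), of w] w e(2) by auto
    then show "coev \<cdot> w = Zero A (Unit A) (D \<otimes>\<^sub>o X)"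
      using is_kernelD[OF k] Comp_assoc[of u k coev] by auto
  next
    assume "coev \<cdot> w = Zero A (Unit A) (D \<otimes>\<^sub>o X)"
    then obtain u where u: "u \<in> Arr A" "Dom A u = Unit A" "Cod A u = Dom A k" "k \<cdot> u = w"
      using is_kernel_factor[OF k, of w] w by auto
    then show "e \<cdot> w = Zero A (Unit A) (Unit A)"
      using is_kernelD[OF e(1)] e(2) Comp_assoc[of u k e] by auto
  qed
  also have "\<dots> \<longleftrightarrow> w \<star> Id A X = Zero A (Dom A (Id A X)) (Cod A (Id A X))"
    using coev_scalar_Zero_iff[OF d w] by simp
  finally show "w \<cdot> e = Zero A (Unit A) (Unit A) \<longleftrightarrow>
    w \<star> Id A X = Zero A (Dom A (Id A X)) (Cod A (Id A X))" .
qed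

text \<open>A suitable idempotent is constructed for one dual and one kernel of \<open>coev\<close>.
  Any other candidate in the definite description has the same annihilator property and therefore
  agrees with it, whichever dual it comes from.\<close>

lemma annihilator_idem_supp_idem:
  assumes X: "X \<in> Ob A"
  shows "annihilator_idem (Id A X) (supp_idem A X)"
proof -
  let ?I = "Id A (Unit A)"
  obtain D ev coev where d: "is_dual A X D ev coev" using rigid[OF X] by blast
  note [simp] = is_dualD(1-8)[OF d]
  obtain k where k: "is_kernel A k coev" using has_kernel by force
  note k' [simp] = is_kernelD(2)[OF k] is_kernelD(3)[OF k, simplified]
  obtain r where r [simp]: "r \<in> Arr A" "Dom A r = Unit A" "Cod A r = Dom A k" "r \<cdot> k = Id A (Dom A k)"
    using mono_into_unit_split[OF is_kernelD(5)[OF k]] by auto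
  \<comment> \<open>\<open>k r\<close> projects onto the kernel of \<open>coev\<close>; the
    complementary projector projects onto the support.\<close>
  define e where "e = Sub A ?I (k \<cdot> r)"
  have e [simp]: "e \<in> Arr A" "Dom A e = Unit A" "Cod A e = Unit A" by (simp_all add: e_def)
  have re: "r \<cdot> e = Zero A (Unit A) (Dom A k)"
    by (simp add: e_def Comp_Sub Comp_assoc_eq Sub_eq_Zero_iff)
  have ek: "e \<cdot> k = Zero A (Dom A k) (Unit A)"
    by (simp add: e_def Sub_Comp Comp_assoc Sub_eq_Zero_iff)
  have ee: "e \<cdot> e = e"
  proof -
    have "e \<cdot> e = Sub A e (k \<cdot> (r \<cdot> e))"
      by (subst (1) e_def) (simp add: Sub_Comp Comp_assoc)
    then show ?thesis by (simp add: re Sub_eq_iff)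
  qed
  obtain s q where f: "e = s \<cdot> q" "is_mono A s" "is_epi A q" "Dom A s = Cod A q"
    "Dom A q = Unit A" "Cod A s = Unit A"
    using image_factorization[of e] e by metis
  have [simp]: "s \<in> Arr A" "q \<in> Arr A" using f by (simp_all add: is_mono_def is_epi_def)
  note [simp] = f(4-6)
  \<comment> \<open>Idempotence reads \<open>s q s q = s q\<close>, where \<open>s\<close> can be
    cancelled on the left and \<open>q\<close> on the right.\<close>
  have qs: "q \<cdot> s = Id A (Cod A q)"
  proof -
    have "s \<cdot> ((q \<cdot> s) \<cdot> q) = s \<cdot> q" using ee by (simp add: f(1) Comp_assoc)
    then have "s \<cdot> ((q \<cdot> s) \<cdot> q) = s \<cdot> (Id A (Cod A q) \<cdot> q)" by simp
    then have "(q \<cdot> s) \<cdot> q = Id A (Cod A q) \<cdot> q"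
      by (rule is_monoD[OF f(2)]) simp_all
    then show ?thesis by (rule is_epiD[OF f(3)]) simp_all
  qed
  have rs: "r \<cdot> s = Zero A (Dom A s) (Dom A k)"
  proof -
    have "(r \<cdot> s) \<cdot> q = Zero A (Dom A q) (Cod A (r \<cdot> s))"
      using re[unfolded f(1)] by (simp add: Comp_assoc)
    from is_epi_Zero[OF f(3) _ _ this] show ?thesis by simp
  qed
  have qk: "q \<cdot> k = Zero A (Dom A k) (Dom A s)"
  proof -
    have "s \<cdot> (q \<cdot> k) = Zero A (Dom A (q \<cdot> k)) (Cod A s)"
      using ek[unfolded f(1)] by (simp add: Comp_assoc)
    from is_mono_Zero[OF f(2) _ _ this] show ?thesis by simp
  qed
  have "k \<cdot> r \<oplus>\<^sub>a s \<cdot> q = ?I"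
    unfolding f(1)[symmetric] by (simp add: e_def Sub_Add)
  then have "complementary A k s"
    unfolding complementary_def is_biproduct_def
    by (intro conjI exI[of _ r] exI[of _ q]) (simp_all add: Hom_iff qs rs qk)
  moreover have "is_image A s e"
    unfolding is_image_def using f by (auto simp: Hom_iff)
  moreover have ke: "is_kernel A k e"
  proof (rule is_kernelI)
    fix g assume g: "g \<in> Arr A" "Cod A g = Dom A e" "e \<cdot> g = Zero A (Dom A g) (Cod A e)"
    then have "g = k \<cdot> (r \<cdot> g)"
      by (simp add: e_def Sub_Comp Sub_eq_Zero_iff Comp_assoc)
    then show "\<exists>u \<in> Arr A. Dom A u = Dom A g \<and> Cod A u = Dom A k \<and> k \<cdot> u = g"
      using g by (intro bexI[of _ "r \<cdot> g"]) simp_all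
  qed (simp_all add: ek is_kernelD(5)[OF k])
  ultimately have "\<exists>D ev coev k s. is_dual A X D ev coev \<and> is_kernel A k coev \<and>
      complementary A k s \<and> is_image A s e \<and> is_kernel A k e"
    using d k by blast
  moreover have es: "e \<in> scalars A" by (simp add: scalarsI)
  ultimately have *: "e \<in> carrier (Z_ring A) \<and> e \<cdot> e = e \<and>
     (\<exists>D ev coev k s. is_dual A X D ev coev \<and> is_kernel A k coev \<and> complementary A k s \<and>
        is_image A s e \<and> is_kernel A k e)"
    using ee by simp
  have "supp_idem A X = e"
    unfolding supp_idem_def
  proof (rule the_equality)
    fix e' assume e': "e' \<in> carrier (Z_ring A) \<and> e' \<cdot> e' = e' \<and>
     (\<exists>D ev coev k s. is_dual A X D ev coev \<and> is_kernel A k coev \<and> complementary A k s \<and>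
        is_image A s e' \<and> is_kernel A k e')"
    then have "annihilator_idem (Id A X) e'"
      by (auto intro: annihilator_idem_if_kernels)
    then show "e' = e"
      using annihilator_idem_unique annihilator_idem_if_kernels[OF d k ke es ee] by blast
  qed (fact *)
  then show ?thesis using annihilator_idem_if_kernels[OF d k ke es ee] by simp
qed

end

section \<open>Serre quotients as quotients by a congruence\<close>

text \<open>Isolates the input for the comparison of Serre quotients with congruences: a
  multiplicative set \<open>W\<close> of idempotents, and as \<open>S\<close> the objects killed by
  some member of \<open>W\<close>. For an ideal \<open>M\<close>, the set \<open>W\<close> will
  consist of the idempotents congruent to 1 modulo \<open>M\<close>.\<close>

locale scalar_localization = rigid_abelian_category A
  for A :: "('o, 'm) tcat" (structure) +
  fixes W :: "'m set" and S :: "'o set"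
  assumes W_scalars [simp]: "w \<in> W \<Longrightarrow> w \<in> scalars A"
    and W_idem [simp]: "w \<in> W \<Longrightarrow> w \<cdot> w = w"
    and W_Id [simp]: "Id A (Unit A) \<in> W"
    and W_Comp [simp]: "v \<in> W \<Longrightarrow> w \<in> W \<Longrightarrow> v \<cdot> w \<in> W"
    and S_iff: "X \<in> S \<longleftrightarrow> X \<in> Ob A \<and> (\<exists>w \<in> W. w \<star> Id A X = Zero A X X)"
begin

definition cong (infix "\<approx>" 50) where
  "f \<approx> g \<longleftrightarrow> f \<in> Arr A \<and> g \<in> Arr A \<and> Dom A f = Dom A g \<and> Cod A f = Cod A g \<and>
     (\<exists>w \<in> W. w \<star> f = w \<star> g)"

lemma congI:
  assumes "w \<in> W" "w \<star> f = w \<star> g" "f \<in> Arr A" "g \<in> Arr A" "Dom A f = Dom A g" "Cod A f = Cod A g"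
  shows "f \<approx> g"
  using assms unfolding cong_def by blast

lemma congD:
  assumes "f \<approx> g"
  shows "f \<in> Arr A" "g \<in> Arr A" "Dom A g = Dom A f" "Cod A g = Cod A f"
  using assms by (auto simp: cong_def)

lemma congE:
  assumes "f \<approx> g"
  obtains w where "w \<in> W" "w \<star> f = w \<star> g"
  using assms unfolding cong_def by blast

lemma cong_refl [simp]: "f \<in> Arr A \<Longrightarrow> f \<approx> f"
  by (rule congI[of "Id A (Unit A)"]) simp_all

lemma cong_sym: "f \<approx> g \<Longrightarrow> g \<approx> f"
  by (auto simp: cong_def) metis

text \<open>Allows finitely many witnesses in \<open>W\<close> to be replaced by their
  product.\<close>

lemma scal_W_mult:
  assumes "v \<in> W" "w \<in> W" "w \<star> f = w \<star> g" "f \<in> Arr A" "g \<in> Arr A"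
  shows "(v \<cdot> w) \<star> f = (v \<cdot> w) \<star> g" "(w \<cdot> v) \<star> f = (w \<cdot> v) \<star> g"
  using assms scal_scal[of v w f] scal_scal[of v w g] scalars_commute[of v w] by simp_all

lemma cong_trans [trans]:
  assumes "f \<approx> g" "g \<approx> h"
  shows "f \<approx> h"
proof -
  obtain w v where *: "w \<in> W" "w \<star> f = w \<star> g" "v \<in> W" "v \<star> g = v \<star> h"
    using assms by (blast elim: congE)
  note t = congD[OF assms(1)] congD[OF assms(2)]
  have "(v \<cdot> w) \<star> f = (v \<cdot> w) \<star> h"
    using * t scal_W_mult(1)[of v w f g] scal_W_mult(2)[of w v g h] by simp
  then show ?thesis using * t by (intro congI[of "v \<cdot> w"]) simp_all
qed

lemma cong_scal:
  assumes "w \<in> W" "f \<in> Arr A"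
  shows "w \<star> f \<approx> f"
  using assms by (intro congI[of w]) (simp_all add: scal_scal)

lemma cong_Comp:
  assumes "f \<approx> f'" "g \<approx> g'" "Dom A g = Cod A f"
  shows "g \<cdot> f \<approx> g' \<cdot> f'"
proof -
  obtain w v where *: "w \<in> W" "w \<star> f = w \<star> f'" "v \<in> W" "v \<star> g = v \<star> g'"
    using assms by (blast elim: congE)
  note t = congD[OF assms(1)] congD[OF assms(2)] assms(3)
  have "(v \<star> g) \<cdot> (w \<star> f) = (v \<star> g') \<cdot> (w \<star> f')" using * by simp
  then have "(w \<cdot> v) \<star> (g \<cdot> f) = (w \<cdot> v) \<star> (g' \<cdot> f')"
    using *(1,3) t by (simp add: scal_Comp_left scal_Comp_right scal_scal)
  then show ?thesis using * t by (intro congI[of "w \<cdot> v"]) simp_all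
qed

lemma cong_Ten:
  assumes "f \<approx> f'" "g \<approx> g'"
  shows "f \<otimes>\<^sub>a g \<approx> f' \<otimes>\<^sub>a g'"
proof -
  obtain w v where *: "w \<in> W" "w \<star> f = w \<star> f'" "v \<in> W" "v \<star> g = v \<star> g'"
    using assms by (blast elim: congE)
  note t = congD[OF assms(1)] congD[OF assms(2)]
  have "(w \<star> f) \<otimes>\<^sub>a (v \<star> g) = (w \<star> f') \<otimes>\<^sub>a (v \<star> g')" using * by simp
  then have "(v \<cdot> w) \<star> (f \<otimes>\<^sub>a g) = (v \<cdot> w) \<star> (f' \<otimes>\<^sub>a g')"
    using *(1,3) t by (simp add: scal_Ten_left scal_Ten_right scal_scal)
  then show ?thesis using * t by (intro congI[of "v \<cdot> w"]) simp_all
qed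

lemma cong_Add:
  assumes "f \<approx> f'" "g \<approx> g'" "Dom A g = Dom A f" "Cod A g = Cod A f"
  shows "f \<oplus>\<^sub>a g \<approx> f' \<oplus>\<^sub>a g'"
proof -
  obtain w v where *: "w \<in> W" "w \<star> f = w \<star> f'" "v \<in> W" "v \<star> g = v \<star> g'"
    using assms by (blast elim: congE)
  note t = congD[OF assms(1)] congD[OF assms(2)] assms(3,4)
  have "(w \<cdot> v) \<star> (f \<oplus>\<^sub>a g) = (w \<cdot> v) \<star> (f' \<oplus>\<^sub>a g')"
    using * t scal_W_mult(2)[of v w f f'] scal_W_mult(1)[of w v g g'] by (simp add: scal_Add_right)
  then show ?thesis using * t by (intro congI[of "w \<cdot> v"]) simp_all
qed

lemma cong_cancel_right_mod:
  assumes "s \<cdot> t \<approx> Id A (Cod A s)" "h \<cdot> s \<approx> h' \<cdot> s"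
    "s \<in> Arr A" "t \<in> Arr A" "Cod A t = Dom A s" "Dom A t = Cod A s"
    "h \<in> Arr A" "h' \<in> Arr A" "Dom A h = Cod A s" "Dom A h' = Cod A s" "Cod A h' = Cod A h"
  shows "h \<approx> h'"
proof -
  have 1: "h \<cdot> (s \<cdot> t) \<approx> h" if "h \<in> Arr A" "Dom A h = Cod A s" for h
    using cong_Comp[OF assms(1) cong_refl[of h]] that assms by simp
  have "h \<cdot> (s \<cdot> t) \<approx> h' \<cdot> (s \<cdot> t)"
    using cong_Comp[OF cong_refl[of t] assms(2)] assms by (simp add: Comp_assoc)
  then show ?thesis using 1[of h] 1[of h'] assms by (meson cong_sym cong_trans)
qed

text \<open>Invertibility of the class of \<open>s\<close>, stated on representatives so that it is
  available before the quotient is known to be a category.\<close>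

definition mod_inverse where
  "mod_inverse s t \<longleftrightarrow> s \<in> Arr A \<and> t \<in> Arr A \<and> Dom A t = Cod A s \<and> Cod A t = Dom A s \<and>
     t \<cdot> s \<approx> Id A (Dom A s) \<and> s \<cdot> t \<approx> Id A (Cod A s)"

lemma mod_inverse_Comp:
  assumes "mod_inverse f f'" "mod_inverse g g'" "Dom A g = Cod A f"
  shows "mod_inverse (g \<cdot> f) (f' \<cdot> g')"
proof -
  note t = assms[unfolded mod_inverse_def]
  have "f' \<cdot> ((g' \<cdot> g) \<cdot> f) \<approx> f' \<cdot> (Id A (Dom A g) \<cdot> f)"
    using t by (intro cong_Comp) simp_all
  also have "f' \<cdot> (Id A (Dom A g) \<cdot> f) \<approx> Id A (Dom A f)" using t by simp
  finally have 1: "f' \<cdot> ((g' \<cdot> g) \<cdot> f) \<approx> Id A (Dom A f)" .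
  have "g \<cdot> ((f \<cdot> f') \<cdot> g') \<approx> g \<cdot> (Id A (Cod A f) \<cdot> g')"
    using t by (intro cong_Comp) simp_all
  also have "g \<cdot> (Id A (Cod A f) \<cdot> g') \<approx> Id A (Cod A g)" using t by simp
  finally have 2: "g \<cdot> ((f \<cdot> f') \<cdot> g') \<approx> Id A (Cod A g)" .
  from 1 2 t show ?thesis by (simp add: mod_inverse_def Comp_assoc)
qed

lemma mod_inverse_Ten:
  assumes "mod_inverse f f'" "mod_inverse g g'"
  shows "mod_inverse (f \<otimes>\<^sub>a g) (f' \<otimes>\<^sub>a g')"
proof -
  note t = assms[unfolded mod_inverse_def]
  have "(f' \<cdot> f) \<otimes>\<^sub>a (g' \<cdot> g) \<approx> Id A (Dom A f) \<otimes>\<^sub>a Id A (Dom A g)"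
    "(f \<cdot> f') \<otimes>\<^sub>a (g \<cdot> g') \<approx> Id A (Cod A f) \<otimes>\<^sub>a Id A (Cod A g)"
    using t by (simp_all only: cong_Ten)
  with t show ?thesis by (simp add: mod_inverse_def Ten_Comp)
qed

text \<open>An idempotent \<open>w\<close> killing both the kernel and the cokernel of \<open>s = m p\<close> lifts along both
  \<open>m\<close> and \<open>p\<close>; composing the two lifts gives the inverse.\<close>

lemma serre_weq_mod_inverse:
  assumes "s \<in> serre_weq A S"
  obtains t where "mod_inverse s t"
proof -
  obtain k' c' where k': "is_kernel A k' s" "Dom A k' \<in> S" and c': "is_cokernel A c' s" "Cod A c' \<in> S"
    and s: "s \<in> Arr A"
    using assms by (auto simp: serre_weq_def)
  obtain k p m c where f: "s = m \<cdot> p" "is_mono A m" "is_epi A p" "Dom A m = Cod A p"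
    "Dom A p = Dom A s" "Cod A m = Cod A s"
    "is_kernel A k s" "is_kernel A k p" "is_cokernel A p k"
    "is_cokernel A c s" "is_cokernel A c m" "is_kernel A m c"
    using image_factorization[OF s] by metis
  have [simp]: "m \<in> Arr A" "p \<in> Arr A" using f by (simp_all add: is_mono_def is_epi_def)
  note c [simp] = is_cokernelD(2)[OF f(10)] is_cokernelD(3)[OF f(10)]
  note k [simp] = is_kernelD(2)[OF f(7)] is_kernelD(3)[OF f(7)]
  note ck' = is_cokernelD(2,3)[OF c'(1)] is_kernelD(2,3)[OF k'(1)]
  obtain w1 where w1: "w1 \<in> W" "w1 \<star> Id A (Dom A k') = Zero A (Dom A k') (Dom A k')"
    using k'(2) S_iff by blast
  obtain w2 where w2: "w2 \<in> W" "w2 \<star> Id A (Cod A c') = Zero A (Cod A c') (Cod A c')"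
    using c'(2) S_iff by blast
  have "w1 \<star> k' = k' \<cdot> (w1 \<star> Id A (Dom A k'))" "w2 \<star> c' = (w2 \<star> Id A (Cod A c')) \<cdot> c'"
    using w1(1) w2(1) ck' by (simp_all add: scal_Comp_left scal_Comp_right)
  then have kc': "w1 \<star> k' = Zero A (Dom A k') (Dom A s)" "w2 \<star> c' = Zero A (Cod A s) (Cod A c')"
    using w1 w2 ck' by simp_all
  obtain b where b: "b \<in> Arr A" "Dom A b = Dom A k" "Cod A b = Dom A k'" "k' \<cdot> b = k"
    using is_kernel_factor[OF k'(1), of k] is_kernelD[OF f(7)] by auto
  obtain d where d: "d \<in> Arr A" "Cod A d = Cod A c" "Dom A d = Cod A c'" "d \<cdot> c' = c"
    using is_cokernel_factor[OF c'(1), of c] is_cokernelD[OF f(10)] by auto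
  define w where "w = w2 \<cdot> w1"
  have w [simp]: "w \<in> W" using w1 w2 by (simp add: w_def)
  have kw: "w \<star> k = Zero A (Dom A k) (Dom A s)"
  proof -
    have "w1 \<star> k = (w1 \<star> k') \<cdot> b" using b w1(1) ck' by (simp add: scal_Comp_left)
    then have "w1 \<star> k = Zero A (Dom A k) (Dom A s)" using kc'(1) b s by simp
    then show ?thesis using w1(1) w2(1) s by (simp add: w_def flip: scal_scal)
  qed
  have cw: "w \<star> c = Zero A (Cod A s) (Cod A c)"
  proof -
    have "w2 \<star> c = d \<cdot> (w2 \<star> c')" using d w2(1) ck' by (simp add: scal_Comp_right)
    then have "w2 \<star> c = Zero A (Cod A s) (Cod A c)" using kc'(2) d s by simp
    moreover have "w \<star> c = w1 \<star> (w2 \<star> c)"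
      using w1(1) w2(1) scalars_commute[of w1 w2] by (simp add: w_def scal_scal)
    ultimately show ?thesis using w1(1) s by simp
  qed
  have "(w \<star> Id A (Dom A p)) \<cdot> k = w \<star> k"
    using f(5) s by (simp add: scal_Comp_left)
  then obtain v where v: "v \<in> Arr A" "Cod A v = Dom A s" "Dom A v = Cod A p" "v \<cdot> p = w \<star> Id A (Dom A p)"
    using is_cokernel_factor[OF f(9), of "w \<star> Id A (Dom A p)"] kw f(5) s by auto
  have "c \<cdot> (w \<star> Id A (Cod A m)) = w \<star> c"
    using f(6) s by (simp add: scal_Comp_right)
  then obtain u where u: "u \<in> Arr A" "Dom A u = Cod A s" "Cod A u = Dom A m" "m \<cdot> u = w \<star> Id A (Cod A m)"
    using is_kernel_factor[OF f(12), of "w \<star> Id A (Cod A m)"] cw f(6) s by auto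
  have "p \<cdot> v = w \<star> Id A (Cod A p)"
  proof (rule is_epiD[OF f(3)])
    have "p \<cdot> (v \<cdot> p) = w \<star> p" unfolding v(4) by (simp add: scal_Comp_right)
    then show "(p \<cdot> v) \<cdot> p = (w \<star> Id A (Cod A p)) \<cdot> p"
      using v f(5) by (simp add: Comp_assoc scal_Comp_left)
  qed (use v f(5) in simp_all)
  note pv = this
  have "u \<cdot> m = w \<star> Id A (Dom A m)"
  proof (rule is_monoD[OF f(2)])
    have "(m \<cdot> u) \<cdot> m = w \<star> m" unfolding u(4) by (simp add: scal_Comp_left)
    then show "m \<cdot> (u \<cdot> m) = m \<cdot> (w \<star> Id A (Dom A m))"
      using Comp_assoc[of m u m] u f(6) by (simp add: scal_Comp_right)
  qed (use u f(6) in simp_all)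
  note um = this
  have "s \<cdot> (v \<cdot> u) = m \<cdot> ((p \<cdot> v) \<cdot> u)"
    by (subst f(1)) (use u v f(4,5) in \<open>simp add: Comp_assoc\<close>)
  also have "\<dots> = w \<star> (m \<cdot> u)"
    unfolding pv using u f(4) by (simp add: scal_Comp_left scal_Comp_right)
  finally have 1: "s \<cdot> (v \<cdot> u) = w \<star> (w \<star> Id A (Cod A s))"
    by (simp only: u(4) f(6))
  have "(v \<cdot> u) \<cdot> s = v \<cdot> ((u \<cdot> m) \<cdot> p)"
    by (subst f(1)) (use u v f(4,6) in \<open>simp add: Comp_assoc\<close>)
  also have "\<dots> = w \<star> (v \<cdot> p)"
    unfolding um using v f(4) by (simp add: scal_Comp_left scal_Comp_right)
  finally have 2: "(v \<cdot> u) \<cdot> s = w \<star> (w \<star> Id A (Dom A s))"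
    by (simp only: v(4) f(5))
  have "mod_inverse s (v \<cdot> u)"
    unfolding mod_inverse_def 1 2 using s u v f(4)
    by (simp add: scal_scal cong_scal)
  then show thesis by (rule that)
qed

text \<open>An idempotent witnessing \<open>t s \<approx> 1\<close> kills the kernel of
  \<open>s\<close>, and one witnessing \<open>s t \<approx> 1\<close> kills its cokernel. So the
  class inverted in the Serre quotient consists of the arrows invertible modulo the congruence, and
  inherits closure under composition and tensor product.\<close>

lemma mod_inverse_serre_weq:
  assumes "mod_inverse s t"
  shows "s \<in> serre_weq A S"
proof -
  note t = assms[unfolded mod_inverse_def]
  have s: "s \<in> Arr A" using t by simp
  obtain w1 w2 where w: "w1 \<in> W" "w1 \<star> (t \<cdot> s) = w1 \<star> Id A (Dom A s)"
    "w2 \<in> W" "w2 \<star> (s \<cdot> t) = w2 \<star> Id A (Cod A s)"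
    using t by (blast elim: congE)
  obtain k where k: "is_kernel A k s" using has_kernel[OF s] by blast
  obtain c where c: "is_cokernel A c s" using has_cokernel[OF s] by blast
  note k' = is_kernelD[OF k] and c' = is_cokernelD[OF c]
  have "k \<cdot> (w1 \<star> Id A (Dom A k)) = (w1 \<star> (t \<cdot> s)) \<cdot> k"
    using w k' by (simp add: scal_Comp_left scal_Comp_right)
  also have "\<dots> = Zero A (Dom A k) (Dom A s)"
    using w(1) k' t by (simp add: scal_Comp_left Comp_assoc)
  finally have "w1 \<star> Id A (Dom A k) = Zero A (Dom A k) (Dom A k)"
    using is_mono_Zero[OF k'(5), of "w1 \<star> Id A (Dom A k)"] w(1) k' by simp
  then have 1: "Dom A k \<in> S" using S_iff w(1) k' by auto
  have "(w2 \<star> Id A (Cod A c)) \<cdot> c = c \<cdot> (w2 \<star> (s \<cdot> t))"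
    using w c' by (simp add: scal_Comp_left scal_Comp_right)
  also have "\<dots> = w2 \<star> ((c \<cdot> s) \<cdot> t)"
    using w(3) c'(1-3) t by (simp add: scal_Comp_right Comp_assoc)
  also have "\<dots> = Zero A (Cod A s) (Cod A c)"
    using w(3) c' t by simp
  finally have "w2 \<star> Id A (Cod A c) = Zero A (Cod A c) (Cod A c)"
    using is_epi_Zero[OF c'(5), of "w2 \<star> Id A (Cod A c)"] w(3) c' by simp
  then have 2: "Cod A c \<in> S" using S_iff w(3) c' by auto
  show ?thesis using s k c 1 2 by (auto simp: serre_weq_def)
qed

lemma mod_inverse_scal_Id:
  assumes "w \<in> W" "X \<in> Ob A"
  shows "mod_inverse (w \<star> Id A X) (Id A X)"
  using assms cong_scal[of w "Id A X"] by (simp add: mod_inverse_def)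

lemma Id_serre_weq [simp]: "X \<in> Ob A \<Longrightarrow> Id A X \<in> serre_weq A S"
  by (rule mod_inverse_serre_weq[of _ "Id A X"]) (simp add: mod_inverse_def)

lemma serre_weq_Arr: "s \<in> serre_weq A S \<Longrightarrow> s \<in> Arr A"
  by (simp add: serre_weq_def)

lemma serre_weq_Comp:
  assumes "s \<in> serre_weq A S" "t \<in> serre_weq A S" "Dom A s = Cod A t"
  shows "s \<cdot> t \<in> serre_weq A S"
  using assms mod_inverse_Comp mod_inverse_serre_weq serre_weq_mod_inverse by metis

lemma serre_weq_Ten:
  assumes "s \<in> serre_weq A S" "t \<in> serre_weq A S"
  shows "s \<otimes>\<^sub>a t \<in> serre_weq A S"
  using assms mod_inverse_Ten mod_inverse_serre_weq serre_weq_mod_inverse by metis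

lemma serre_weq_cancel_right:
  assumes "s \<in> serre_weq A S" "h \<cdot> s \<approx> h' \<cdot> s" "h \<in> Arr A" "h' \<in> Arr A"
    "Dom A h = Cod A s" "Dom A h' = Cod A s" "Cod A h' = Cod A h"
  shows "h \<approx> h'"
proof -
  obtain t where "mod_inverse s t" using serre_weq_mod_inverse[OF assms(1)] by blast
  then show ?thesis
    using cong_cancel_right_mod[of s t h h'] assms by (simp add: mod_inverse_def)
qed

text \<open>\<open>h\<close> is a value of the roof \<open>(s, f)\<close> if \<open>h\<close> represents the fraction \<open>f s\<^sup>-\<^sup>1\<close>.\<close>

definition roof_value where
  "roof_value s f h \<longleftrightarrow> s \<in> serre_weq A S \<and> h \<in> Arr A \<and> Dom A h = Cod A s \<and> h \<cdot> s \<approx> f"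

lemma roof_valueD:
  assumes "roof_value s f h"
  shows "(s, f) \<in> roofs A S" "s \<in> Arr A" "f \<in> Arr A" "h \<in> Arr A" "Dom A s = Dom A f"
    "Dom A h = Cod A s" "Cod A h = Cod A f" "s \<in> serre_weq A S"
  using assms congD[of "h \<cdot> s" f] serre_weq_Arr[of s] by (auto simp: roof_value_def roofs_def)

text \<open>If \<open>t\<close> inverts \<open>s\<close> modulo the congruence, then
  \<open>f t\<close> represents the fraction. This is the fullness of the projection.\<close>

lemma ex_roof_value:
  assumes "(s, f) \<in> roofs A S"
  obtains h where "roof_value s f h"
proof -
  have s: "s \<in> serre_weq A S" "f \<in> Arr A" "Dom A s = Dom A f" using assms by (auto simp: roofs_def)
  obtain t where t: "mod_inverse s t" using serre_weq_mod_inverse s by blast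
  note t' = t[unfolded mod_inverse_def]
  have "f \<cdot> (t \<cdot> s) \<approx> f \<cdot> Id A (Dom A s)"
    using t' s by (intro cong_Comp cong_refl) simp_all
  then have "roof_value s f (f \<cdot> t)"
    using s t by (simp add: roof_value_def mod_inverse_def Comp_assoc)
  then show thesis by (rule that)
qed

lemma roof_value_unique:
  assumes "roof_value s f h" "roof_value s f h'"
  shows "h \<approx> h'"
proof -
  note t = roof_valueD[OF assms(1)] roof_valueD[OF assms(2)]
  have "h \<cdot> s \<approx> f" "f \<approx> h' \<cdot> s" using assms by (auto simp: roof_value_def intro: cong_sym)
  then have "h \<cdot> s \<approx> h' \<cdot> s" by (rule cong_trans)
  then show ?thesis by (rule serre_weq_cancel_right[rotated]) (use t in simp_all)
qed

lemma roof_value_cong: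
  assumes "roof_value s f h" "h \<approx> h'"
  shows "roof_value s f h'"
  using assms congD[OF assms(2)] cong_Comp[OF cong_refl[of s] cong_sym[OF assms(2)]]
    roof_valueD(2,6)[OF assms(1)] unfolding roof_value_def
  by (metis cong_trans)

text \<open>Replaces the common refinement of two roofs by a common value. From left to right, the
  refined denominator \<open>s u\<close> is cancelled. From right to left, inverses of both
  denominators modulo the congruence, multiplied by a sufficiently divisible idempotent, give a
  refinement that commutes on the nose.\<close>

lemma roof_rel_iff:
  "((s, f), (s', f')) \<in> roof_rel A S \<longleftrightarrow> (\<exists>h. roof_value s f h \<and> roof_value s' f' h)"
proof
  assume "((s, f), (s', f')) \<in> roof_rel A S"
  then obtain u v where r: "(s, f) \<in> roofs A S" "(s', f') \<in> roofs A S" "Cod A s = Cod A s'"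
    "Cod A f = Cod A f'" "u \<in> Arr A" "v \<in> Arr A" "Dom A u = Dom A v" "Cod A u = Dom A s"
    "Cod A v = Dom A s'" "s \<cdot> u = s' \<cdot> v" "s \<cdot> u \<in> serre_weq A S" "f \<cdot> u = f' \<cdot> v"
    by (auto simp: roof_rel_def Hom_iff)
  obtain h where h: "roof_value s f h" using ex_roof_value r(1) by blast
  obtain h' where h': "roof_value s' f' h'" using ex_roof_value r(2) by blast
  note t = roof_valueD[OF h] roof_valueD[OF h']
  have "(h \<cdot> s) \<cdot> u \<approx> f \<cdot> u"
    using h t r(5-9) by (intro cong_Comp) (simp_all add: roof_value_def)
  also have "f \<cdot> u = f' \<cdot> v" by fact
  also have "f' \<cdot> v \<approx> (h' \<cdot> s') \<cdot> v"
    using h' t r(5-9) by (intro cong_Comp cong_sym[of "h' \<cdot> s'" f']) (simp_all add: roof_value_def)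
  also have "(h' \<cdot> s') \<cdot> v = h' \<cdot> (s \<cdot> u)"
    using t r by (simp add: Comp_assoc)
  finally have "h \<cdot> (s \<cdot> u) \<approx> h' \<cdot> (s \<cdot> u)"
    using t r(5-9) by (simp add: Comp_assoc)
  then have "h \<approx> h'"
    by (rule serre_weq_cancel_right[OF r(11)]) (use r(3-9) t in simp_all)
  then have "roof_value s' f' h" using roof_value_cong[OF h' cong_sym] by blast
  with h show "\<exists>h. roof_value s f h \<and> roof_value s' f' h" by blast
next
  assume "\<exists>h. roof_value s f h \<and> roof_value s' f' h"
  then obtain h where h: "roof_value s f h" and h': "roof_value s' f' h" by blast
  note t = roof_valueD[OF h] roof_valueD[OF h']
  obtain t1 where t1: "mod_inverse s t1" using serre_weq_mod_inverse[OF t(8)] by blast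
  obtain t2 where t2: "mod_inverse s' t2" using serre_weq_mod_inverse[OF t(16)] by blast
  note ti = t1 t2
  have cc: "s \<cdot> t1 \<approx> Id A (Cod A s)" "s' \<cdot> t2 \<approx> Id A (Cod A s')" "h \<cdot> s \<approx> f" "h \<cdot> s' \<approx> f'"
    using ti h h' by (simp_all add: mod_inverse_def roof_value_def)
  obtain w1 where w1: "w1 \<in> W" "w1 \<star> (s \<cdot> t1) = w1 \<star> Id A (Cod A s)" using congE[OF cc(1)] .
  obtain w2 where w2: "w2 \<in> W" "w2 \<star> (s' \<cdot> t2) = w2 \<star> Id A (Cod A s')" using congE[OF cc(2)] .
  obtain v1 where v1: "v1 \<in> W" "v1 \<star> (h \<cdot> s) = v1 \<star> f" using congE[OF cc(3)] .
  obtain v2 where v2: "v2 \<in> W" "v2 \<star> (h \<cdot> s') = v2 \<star> f'" using congE[OF cc(4)] .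
  note w = w1 w2 v1 v2
  \<comment> \<open>Collects the witnesses of four congruences: two inverting the denominators and
    two expressing that \<open>h\<close> is a value of both roofs.\<close>
  define w where "w = w1 \<cdot> (w2 \<cdot> (v1 \<cdot> v2))"
  have wW [simp]: "w \<in> W" using w by (simp add: w_def)
  note ti' = ti[unfolded mod_inverse_def]
  note sc = scal_W_mult
  have e1: "w \<star> (s \<cdot> t1) = w \<star> Id A (Cod A s)"
    unfolding w_def using w t ti' by (intro sc(2)[OF _ w1]) simp_all
  have e2: "w \<star> (s' \<cdot> t2) = w \<star> Id A (Cod A s')"
    unfolding w_def using w t ti' by (intro sc(1)[OF _ _ sc(2)[OF _ w2]]) simp_all
  have e3: "w \<star> (h \<cdot> s) = w \<star> f"
    unfolding w_def using w t ti' by (intro sc(1)[OF _ _ sc(1)[OF _ _ sc(2)[OF _ v1]]]) simp_all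
  have e4: "w \<star> (h \<cdot> s') = w \<star> f'"
    unfolding w_def using w t ti' by (intro sc(1)[OF _ _ sc(1)[OF _ _ sc(1)[OF _ v2]]]) simp_all
  \<comment> \<open>With these legs both refined denominators become multiplication by
    \<open>w\<close>, which is again a weak equivalence.\<close>
  let ?u = "w \<star> t1" and ?v = "w \<star> t2"
  have su: "s \<cdot> ?u = w \<star> Id A (Cod A s)" "s' \<cdot> ?v = w \<star> Id A (Cod A s)"
    using t ti' by (simp_all add: scal_Comp_right e1 e2)
  have "f \<cdot> ?u = (w \<star> f) \<cdot> t1" using t ti' by (simp add: scal_Comp_right scal_Comp_left)
  also have "\<dots> = h \<cdot> (w \<star> (s \<cdot> t1))" unfolding e3[symmetric]
    using t ti' by (simp add: scal_Comp_right scal_Comp_left Comp_assoc)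
  also have "\<dots> = h \<cdot> (w \<star> (s' \<cdot> t2))" using t by (simp add: e1 e2)
  also have "\<dots> = (w \<star> f') \<cdot> t2" unfolding e4[symmetric]
    using t ti' by (simp add: scal_Comp_right scal_Comp_left Comp_assoc)
  also have "\<dots> = f' \<cdot> ?v" using t ti' by (simp add: scal_Comp_right scal_Comp_left)
  finally have fu: "f \<cdot> ?u = f' \<cdot> ?v" .
  have "s \<cdot> ?u \<in> serre_weq A S"
    unfolding su using mod_inverse_serre_weq[OF mod_inverse_scal_Id[of w "Cod A s"]] t by simp
  moreover have "?u \<in> Hom A (Cod A s) (Dom A s)" "?v \<in> Hom A (Cod A s) (Dom A s')"
    using t ti' by (simp_all add: Hom_iff)
  moreover have "s \<cdot> ?u = s' \<cdot> ?v" using su by simp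
  moreover have "Cod A s = Cod A s'" "Cod A f = Cod A f'" using t by simp_all
  ultimately show "((s, f), (s', f')) \<in> roof_rel A S"
    unfolding roof_rel_def using t(1,9) fu by blast
qed

lemma fraction_iff: "(s', f') \<in> fraction A S s f \<longleftrightarrow> (\<exists>h. roof_value s f h \<and> roof_value s' f' h)"
  by (simp add: fraction_def roof_rel_iff)

abbreviation "Q \<equiv> quot_arr A S"

lemma roof_value_Id_iff:
  assumes "f \<in> Arr A"
  shows "roof_value (Id A (Dom A f)) f h \<longleftrightarrow> h \<approx> f"
  using assms congD[of h f] by (auto simp: roof_value_def)

lemma quot_arr_iff:
  assumes "f \<in> Arr A"
  shows "(s, g) \<in> Q f \<longleftrightarrow> roof_value s g f"
  using assms unfolding quot_arr_def fraction_iff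
  by (auto simp: roof_value_Id_iff intro: roof_value_cong cong_refl)

text \<open>Evaluates the operations on classes: every fraction occurring in one of the defining
  unions has the same value, so the union collapses to a single class.\<close>

lemma fraction_eq:
  assumes "roof_value s g f"
  shows "fraction A S s g = Q f"
proof -
  have "(s', g') \<in> fraction A S s g \<longleftrightarrow> (s', g') \<in> Q f" for s' g'
    using assms roof_valueD(4)[OF assms] roof_value_unique[OF assms]
    by (auto simp: fraction_iff quot_arr_iff intro: roof_value_cong cong_sym)
  then show ?thesis by (auto simp: set_eq_iff)
qed

lemma quot_arr_self: "f \<in> Arr A \<Longrightarrow> (Id A (Dom A f), f) \<in> Q f"
  by (simp add: quot_arr_iff roof_value_Id_iff)

lemma quot_arr_eq_iff:
  assumes "f \<in> Arr A" "g \<in> Arr A"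
  shows "Q f = Q g \<longleftrightarrow> f \<approx> g"
proof
  assume "Q f = Q g"
  then have g: "roof_value (Id A (Dom A f)) f g"
    using quot_arr_self assms quot_arr_iff by blast
  then show "f \<approx> g"
    using roof_value_unique[OF _ g] assms by (simp add: roof_value_Id_iff)
next
  assume "f \<approx> g"
  then show "Q f = Q g"
    using assms by (auto simp: set_eq_iff quot_arr_iff intro: roof_value_cong cong_sym)
qed

section \<open>The operations of the Serre quotient on representatives\<close>

abbreviation "AS \<equiv> serre_quotient A S"

lemma quot_simps [simp]:
  "Ob AS = Ob A" "Unit AS = Unit A" "TenO AS = TenO A" "Id AS X = Q (Id A X)"
  "Zero AS X Y = Q (Zero A X Y)" "Assoc AS X Y Z = Q (Assoc A X Y Z)"
  "LUnit AS X = Q (LUnit A X)" "RUnit AS X = Q (RUnit A X)" "Sym AS X Y = Q (Sym A X Y)"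
  by (simp_all add: serre_quotient_def)

lemma quot_Arr [simp]: "Arr AS = Q ` Arr A"
proof -
  have "roof_rel A S `` {(s, f)} = Q h" if "roof_value s f h" for s f h
    using fraction_eq[OF that] by (simp add: fraction_def)
  then have "roofs A S // roof_rel A S \<subseteq> Q ` Arr A"
    by (auto simp: quotient_def elim!: ex_roof_value) (use roof_valueD(4) in blast)
  moreover have "Q f \<in> roofs A S // roof_rel A S" if "f \<in> Arr A" for f
  proof -
    have "(Id A (Dom A f), f) \<in> roofs A S" using that by (simp add: roofs_def)
    then show ?thesis unfolding quot_arr_def fraction_def by (rule quotientI)
  qed
  ultimately show ?thesis by (auto simp: serre_quotient_def)
qed

lemma quot_Dom [simp]:
  assumes "f \<in> Arr A" shows "Dom AS (Q f) = Dom A f"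
proof -
  have "(THE X. \<exists>(s, g) \<in> Q f. X = Cod A s) = Dom A f"
  proof (rule the_equality)
    show "\<exists>(s, g) \<in> Q f. Dom A f = Cod A s"
      using assms by (intro bexI[OF _ quot_arr_self[of f]]) simp_all
    fix X assume "\<exists>(s, g) \<in> Q f. X = Cod A s"
    then obtain s g where "roof_value s g f" "X = Cod A s" using assms by (auto simp: quot_arr_iff)
    then show "X = Dom A f" using roof_valueD(6)[of s g f] by simp
  qed
  then show ?thesis by (simp add: serre_quotient_def)
qed

lemma quot_Cod [simp]:
  assumes "f \<in> Arr A" shows "Cod AS (Q f) = Cod A f"
proof -
  have "(THE X. \<exists>(s, g) \<in> Q f. X = Cod A g) = Cod A f"
  proof (rule the_equality)
    show "\<exists>(s, g) \<in> Q f. Cod A f = Cod A g"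
      using assms by (intro bexI[OF _ quot_arr_self[of f]]) simp_all
    fix X assume "\<exists>(s, g) \<in> Q f. X = Cod A g"
    then obtain s g where "roof_value s g f" "X = Cod A g" using assms by (auto simp: quot_arr_iff)
    then show "X = Cod A f" using roof_valueD(7)[of s g f] by simp
  qed
  then show ?thesis by (simp add: serre_quotient_def)
qed

lemma quot_Hom: "Hom AS X Y = Q ` Hom A X Y"
  by (auto simp: Hom_def)

lemma quot_Comp [simp]:
  assumes "f \<in> Arr A" "g \<in> Arr A" "Dom A g = Cod A f"
  shows "Q g \<cdot>\<^bsub>AS\<^esub> Q f = Q (g \<cdot> f)"
proof -
  have "fraction A S (s \<cdot> t') (g1 \<cdot> f') = Q (g \<cdot> f)"
    if a: "(s, f1) \<in> Q f" "(t, g1) \<in> Q g" "t' \<in> Hom A V (Dom A s)" "t' \<in> serre_weq A S"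
      "f' \<in> Hom A V (Dom A t)" "f1 \<cdot> t' = t \<cdot> f'" for s f1 t g1 t' f' V
  proof (rule fraction_eq)
    have r: "roof_value s f1 f" "roof_value t g1 g" using a assms by (simp_all add: quot_arr_iff)
    note T = roof_valueD[OF r(1)] roof_valueD[OF r(2)]
    have t: "t' \<in> Arr A" "f' \<in> Arr A" "Dom A t' = Dom A f'" "Cod A t' = Dom A s" "Cod A f' = Dom A t"
      using a by (auto simp: Hom_iff)
    have "g \<cdot> ((f \<cdot> s) \<cdot> t') \<approx> g \<cdot> (f1 \<cdot> t')"
      using r(1) T t assms by (intro cong_Comp cong_refl) (simp_all add: roof_value_def)
    also have "g \<cdot> (f1 \<cdot> t') = (g \<cdot> t) \<cdot> f'"
      unfolding a(6) using T t assms by (simp add: Comp_assoc)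
    also have "(g \<cdot> t) \<cdot> f' \<approx> g1 \<cdot> f'"
      using r(2) T t assms by (intro cong_Comp cong_refl) (simp_all add: roof_value_def)
    finally have "(g \<cdot> f) \<cdot> (s \<cdot> t') \<approx> g1 \<cdot> f'"
      using T t assms by (simp add: Comp_assoc)
    moreover have "s \<cdot> t' \<in> serre_weq A S" using T t a by (intro serre_weq_Comp) simp_all
    ultimately show "roof_value (s \<cdot> t') (g1 \<cdot> f') (g \<cdot> f)"
      using T t assms by (simp add: roof_value_def)
  qed
  \<comment> \<open>Roofs with identity denominators admit an Ore square, so the union is not
    empty.\<close>
  moreover have "(Id A (Dom A f), f) \<in> Q f" "(Id A (Dom A g), g) \<in> Q g"
    by (rule quot_arr_self, fact)+
  moreover have "Id A (Dom A f) \<in> Hom A (Dom A f) (Dom A (Id A (Dom A f)))" "Id A (Dom A f) \<in> serre_weq A S"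
    "f \<in> Hom A (Dom A f) (Dom A (Id A (Dom A g)))" "f \<cdot> Id A (Dom A f) = Id A (Dom A g) \<cdot> f"
    using assms by (simp_all add: Hom_iff)
  ultimately have "{fraction A S (s \<cdot> t') (g1 \<cdot> f') | s f1 t g1 t' f' V.
     (s, f1) \<in> Q f \<and> (t, g1) \<in> Q g \<and> t' \<in> Hom A V (Dom A s) \<and> t' \<in> serre_weq A S \<and>
     f' \<in> Hom A V (Dom A t) \<and> f1 \<cdot> t' = t \<cdot> f'} = {Q (g \<cdot> f)}"
    by (intro equalityI subsetI; clarsimp) (metis (no_types, lifting))+
  then show ?thesis by (simp add: serre_quotient_def quot_comp_def)
qed

lemma quot_Add [simp]:
  assumes "f \<in> Arr A" "g \<in> Arr A" "Dom A g = Dom A f" "Cod A g = Cod A f"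
  shows "Q f \<oplus>\<^sub>a\<^bsub>AS\<^esub> Q g = Q (f \<oplus>\<^sub>a g)"
proof -
  have "fraction A S (s \<cdot> u) ((f1 \<cdot> u) \<oplus>\<^sub>a (g1 \<cdot> v)) = Q (f \<oplus>\<^sub>a g)"
    if a: "(s, f1) \<in> Q f" "(t, g1) \<in> Q g" "u \<in> Hom A V (Dom A s)" "v \<in> Hom A V (Dom A t)"
      "s \<cdot> u = t \<cdot> v" "s \<cdot> u \<in> serre_weq A S" for s f1 t g1 u v V
  proof (rule fraction_eq)
    have r: "roof_value s f1 f" "roof_value t g1 g" using a assms by (simp_all add: quot_arr_iff)
    note T = roof_valueD[OF r(1)] roof_valueD[OF r(2)]
    have t: "u \<in> Arr A" "v \<in> Arr A" "Dom A v = Dom A u" "Cod A u = Dom A s" "Cod A v = Dom A t"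
      using a by (auto simp: Hom_iff)
    have "(f \<oplus>\<^sub>a g) \<cdot> (s \<cdot> u) = (f \<cdot> (s \<cdot> u)) \<oplus>\<^sub>a (g \<cdot> (t \<cdot> v))"
      using T t assms a(5) by (simp add: Comp_Add_left)
    also have "\<dots> = ((f \<cdot> s) \<cdot> u) \<oplus>\<^sub>a ((g \<cdot> t) \<cdot> v)"
      using T t assms by (simp add: Comp_assoc)
    also have "((f \<cdot> s) \<cdot> u) \<oplus>\<^sub>a ((g \<cdot> t) \<cdot> v) \<approx> (f1 \<cdot> u) \<oplus>\<^sub>a (g1 \<cdot> v)"
      using r T t assms by (intro cong_Add cong_Comp cong_refl) (simp_all add: roof_value_def)
    finally show "roof_value (s \<cdot> u) ((f1 \<cdot> u) \<oplus>\<^sub>a (g1 \<cdot> v)) (f \<oplus>\<^sub>a g)"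
      using T t assms a(6) by (simp add: roof_value_def)
  qed
  moreover have "(Id A (Dom A f), f) \<in> Q f" "(Id A (Dom A f), g) \<in> Q g"
    using quot_arr_self[OF assms(1)] quot_arr_self[OF assms(2)] unfolding assms(3) .
  moreover have "Id A (Dom A f) \<in> Hom A (Dom A f) (Dom A (Id A (Dom A f)))"
    "Id A (Dom A f) \<cdot> Id A (Dom A f) = Id A (Dom A f) \<cdot> Id A (Dom A f)"
    "Id A (Dom A f) \<cdot> Id A (Dom A f) \<in> serre_weq A S"
    using assms by (simp_all add: Hom_iff)
  ultimately have "{fraction A S (s \<cdot> u) ((f1 \<cdot> u) \<oplus>\<^sub>a (g1 \<cdot> v)) | s f1 t g1 u v V.
     (s, f1) \<in> Q f \<and> (t, g1) \<in> Q g \<and> u \<in> Hom A V (Dom A s) \<and> v \<in> Hom A V (Dom A t) \<and>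
     s \<cdot> u = t \<cdot> v \<and> s \<cdot> u \<in> serre_weq A S} = {Q (f \<oplus>\<^sub>a g)}"
    by (intro equalityI subsetI; clarsimp) (metis (no_types, lifting))+
  then show ?thesis by (simp add: serre_quotient_def quot_add_def)
qed

lemma quot_Ten [simp]:
  assumes "f \<in> Arr A" "g \<in> Arr A"
  shows "Q f \<otimes>\<^sub>a\<^bsub>AS\<^esub> Q g = Q (f \<otimes>\<^sub>a g)"
proof -
  have "fraction A S (s \<otimes>\<^sub>a t) (f1 \<otimes>\<^sub>a g1) = Q (f \<otimes>\<^sub>a g)"
    if a: "(s, f1) \<in> Q f" "(t, g1) \<in> Q g" for s f1 t g1
  proof (rule fraction_eq)
    have r: "roof_value s f1 f" "roof_value t g1 g" using a assms by (simp_all add: quot_arr_iff)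
    note T = roof_valueD[OF r(1)] roof_valueD[OF r(2)]
    have "(f \<otimes>\<^sub>a g) \<cdot> (s \<otimes>\<^sub>a t) \<approx> f1 \<otimes>\<^sub>a g1"
      using r T assms by (simp add: Ten_Comp cong_Ten roof_value_def)
    then show "roof_value (s \<otimes>\<^sub>a t) (f1 \<otimes>\<^sub>a g1) (f \<otimes>\<^sub>a g)"
      using T assms by (simp add: roof_value_def serre_weq_Ten)
  qed
  then have "{fraction A S (s \<otimes>\<^sub>a t) (f1 \<otimes>\<^sub>a g1) | s f1 t g1. (s, f1) \<in> Q f \<and> (t, g1) \<in> Q g}
    = {Q (f \<otimes>\<^sub>a g)}"
    using quot_arr_self[of f] quot_arr_self[of g] assms
    by (intro equalityI subsetI; clarsimp) (metis (no_types, lifting))+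
  then show ?thesis by (simp add: serre_quotient_def quot_ten_def)
qed

end

section \<open>Exactness of the projection to the quotient\<close>

lemma (in additive_category) kernel_of_Zero_iso:
  assumes "is_kernel A k (Zero A X Y)" "X \<in> Ob A" "Y \<in> Ob A"
  shows "is_iso A k"
proof -
  note k = is_kernelD[OF assms(1)]
  have [simp]: "k \<in> Arr A" "Cod A k = X" using k assms by simp_all
  obtain r where r: "r \<in> Arr A" "Dom A r = X" "Cod A r = Dom A k" "k \<cdot> r = Id A X"
    using is_kernel_factor[OF assms(1), of "Id A X"] assms by auto
  have "r \<cdot> k = Id A (Dom A k)"
    by (rule is_monoD[OF k(5)]) (use r in \<open>simp_all add: Comp_assoc_eq\<close>)
  with r show ?thesis by (intro is_isoI[of k r]) simp_all
qed

lemma (in additive_category) cokernel_of_Zero_iso: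
  assumes "is_cokernel A c (Zero A X Y)" "X \<in> Ob A" "Y \<in> Ob A"
  shows "is_iso A c"
  using additive_category.kernel_of_Zero_iso[OF additive_category_opp, of c Y X] assms by simp

context scalar_localization
begin

lemma quot_category: "category AS"
  by unfold_locales (auto simp: quot_Hom Hom_iff Comp_assoc)

lemma quot_zero_object: "\<exists>Z. is_zero_object AS Z"
proof -
  obtain Z where Z: "Z \<in> Ob A" "\<And>X. X \<in> Ob A \<Longrightarrow> \<exists>f. Hom A X Z = {f}"
    "\<And>X. X \<in> Ob A \<Longrightarrow> \<exists>f. Hom A Z X = {f}"
    using zero_object unfolding is_zero_object_def by (metis (no_types, lifting) is_singletonI' is_singleton_def ex1_implies_ex empty_iff)
  have "(\<exists>!f. f \<in> Hom AS X Z) \<and> (\<exists>!f. f \<in> Hom AS Z X)" if "X \<in> Ob A" for X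
    using Z(2,3)[OF that] by (auto simp: quot_Hom)
  with Z(1) have "is_zero_object AS Z" by (simp add: is_zero_object_def)
  then show ?thesis by blast
qed

lemma quot_additive_category: "additive_category AS"
proof (intro additive_category.intro additive_category_axioms.intro quot_category quot_zero_object)
  fix X Y assume XY: "X \<in> Ob AS" "Y \<in> Ob AS"
  have "\<exists>g \<in> Q ` Hom A X Y. g \<oplus>\<^sub>a\<^bsub>AS\<^esub> Q f = Q (Zero A X Y)" if "f \<in> Hom A X Y" for f
    using that by (intro bexI[of _ "Q (Neg A f)"] imageI) (auto simp: Hom_iff)
  then show "comm_group (hom_group AS X Y)"
    using XY by (intro comm_groupI) (auto simp: hom_group_def quot_Hom Hom_iff Add_ac)
  obtain P i j p q where "is_biproduct A X Y P i j p q"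
    using biproduct[of X Y] XY by auto
  then have "is_biproduct AS X Y P (Q i) (Q j) (Q p) (Q q)"
    by (auto simp: is_biproduct_def quot_Hom Hom_iff)
  then show "\<exists>S i j p q. is_biproduct AS X Y S i j p q" by blast
qed (auto simp: quot_Hom Hom_iff Comp_Add_left Comp_Add_right)

lemma quot_is_iso: "is_iso A f \<Longrightarrow> is_iso AS (Q f)"
  by (rule category.is_isoI[OF quot_category, of "Q f" "Q (inv_arr A f)"])
    (simp_all add: is_iso_Arr)

lemma quot_tensor_category: "tensor_category AS"
  by (intro tensor_category.intro tensor_category_axioms.intro quot_additive_category)
    (auto simp: quot_Hom Hom_iff Ten_Comp Ten_Add_left Ten_Add_right quot_is_iso Assoc_natural
      LUnit_natural RUnit_natural Sym_natural sym_sym pentagon triangle hexagon)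

lemma quot_is_dual: "is_dual A X D ev coev \<Longrightarrow> is_dual AS X D (Q ev) (Q coev)"
  unfolding is_dual_def
  by (auto simp: quot_Hom Hom_iff) (rule_tac x = a in bexI; simp add: Hom_iff)

lemma quot_rigid_tensor_category: "rigid_tensor_category AS"
  using rigid quot_is_dual
  by (intro rigid_tensor_category.intro rigid_tensor_category_axioms.intro quot_tensor_category)
    (simp, blast)

interpretation B: rigid_tensor_category AS by (rule quot_rigid_tensor_category)

lemma quot_Zero_iff:
  assumes "f \<in> Arr A" "X = Dom A f" "Y = Cod A f"
  shows "Q f = Q (Zero A X Y) \<longleftrightarrow> (\<exists>w \<in> W. w \<star> f = Zero A X Y)"
  using assms by (auto simp: quot_arr_eq_iff cong_def)

lemma quot_scal:
  assumes "w \<in> W" "f \<in> Arr A" shows "Q (w \<star> f) = Q f"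
  using cong_scal[OF assms] assms by (simp add: quot_arr_eq_iff)

text \<open>An equation in the quotient holds in \<open>A\<close> after multiplication by some
  \<open>w\<close>. The kernel property then factors \<open>w \<star> g\<close> through
  \<open>k\<close>, and \<open>w \<star> g\<close> has the same class as \<open>g\<close>.\<close>

lemma quot_is_kernel:
  assumes k: "is_kernel A k f"
  shows "is_kernel AS (Q k) (Q f)"
proof -
  note k' [simp] = is_kernelD(1-3)[OF k]
  show ?thesis
  proof (rule B.is_kernelI)
    show "Q f \<cdot>\<^bsub>AS\<^esub> Q k = Zero AS (Dom AS (Q k)) (Cod AS (Q f))"
      by (simp add: is_kernelD(4)[OF k])
    show "is_mono AS (Q k)"
    proof (rule B.is_monoI)
      fix g' assume g': "g' \<in> Arr AS" "Cod AS g' = Dom AS (Q k)"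
        "Q k \<cdot>\<^bsub>AS\<^esub> g' = Zero AS (Dom AS g') (Cod AS (Q k))"
      then obtain g where g: "g \<in> Arr A" "g' = Q g" by auto
      with g' have g1: "Cod A g = Dom A k" "Q (k \<cdot> g) = Q (Zero A (Dom A g) (Dom A f))" by simp_all
      then obtain w where w: "w \<in> W" "w \<star> (k \<cdot> g) = Zero A (Dom A g) (Dom A f)"
        using quot_Zero_iff[of "k \<cdot> g"] g by auto
      then have "k \<cdot> (w \<star> g) = Zero A (Dom A (w \<star> g)) (Cod A k)"
        using g g1 by (simp add: scal_Comp_right)
      from is_mono_Zero[OF is_kernelD(5)[OF k] _ _ this]
      have "w \<star> g = Zero A (Dom A g) (Dom A k)" using w g g1 by simp
      then show "g' = Zero AS (Dom AS g') (Dom AS (Q k))"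
        using quot_Zero_iff[of g] g g1 w(1) by auto
    qed simp
    fix g' assume g': "g' \<in> Arr AS" "Cod AS g' = Dom AS (Q f)"
      "Q f \<cdot>\<^bsub>AS\<^esub> g' = Zero AS (Dom AS g') (Cod AS (Q f))"
    then obtain g where g: "g \<in> Arr A" "g' = Q g" by auto
    with g' have g1: "Cod A g = Dom A f" "Q (f \<cdot> g) = Q (Zero A (Dom A g) (Cod A f))" by simp_all
    then obtain w where w: "w \<in> W" "w \<star> (f \<cdot> g) = Zero A (Dom A g) (Cod A f)"
      using quot_Zero_iff[of "f \<cdot> g"] g by auto
    then have "f \<cdot> (w \<star> g) = Zero A (Dom A (w \<star> g)) (Cod A f)"
      using g g1 by (simp add: scal_Comp_right)
    then obtain u where u: "u \<in> Arr A" "Dom A u = Dom A g" "Cod A u = Dom A k" "k \<cdot> u = w \<star> g"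
      using is_kernel_factor[OF k, of "w \<star> g"] w(1) g g1 by auto
    have "Q (k \<cdot> u) = Q g" unfolding u(4) by (rule quot_scal[OF w(1) g(1)])
    then show "\<exists>u \<in> Arr AS. Dom AS u = Dom AS g' \<and> Cod AS u = Dom AS (Q k) \<and> Q k \<cdot>\<^bsub>AS\<^esub> u = g'"
      using u g by (intro bexI[of _ "Q u"]) simp_all
  qed simp_all
qed

lemma quot_is_cokernel:
  assumes c: "is_cokernel A c f"
  shows "is_cokernel AS (Q c) (Q f)"
proof -
  note c' [simp] = is_cokernelD(1-3)[OF c]
  show ?thesis
  proof (rule B.is_cokernelI)
    show "Q c \<cdot>\<^bsub>AS\<^esub> Q f = Zero AS (Dom AS (Q f)) (Cod AS (Q c))"
      by (simp add: is_cokernelD(4)[OF c])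
    show "is_epi AS (Q c)"
    proof (rule B.is_epiI)
      fix g' assume g': "g' \<in> Arr AS" "Dom AS g' = Cod AS (Q c)"
        "g' \<cdot>\<^bsub>AS\<^esub> Q c = Zero AS (Dom AS (Q c)) (Cod AS g')"
      then obtain g where g: "g \<in> Arr A" "g' = Q g" by auto
      with g' have g1: "Dom A g = Cod A c" "Q (g \<cdot> c) = Q (Zero A (Cod A f) (Cod A g))" by simp_all
      then obtain w where w: "w \<in> W" "w \<star> (g \<cdot> c) = Zero A (Cod A f) (Cod A g)"
        using quot_Zero_iff[of "g \<cdot> c"] g by auto
      then have "(w \<star> g) \<cdot> c = Zero A (Dom A c) (Cod A (w \<star> g))"
        using g g1 by (simp add: scal_Comp_left)
      from is_epi_Zero[OF is_cokernelD(5)[OF c] _ _ this]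
      have "w \<star> g = Zero A (Cod A c) (Cod A g)" using w g g1 by simp
      then show "g' = Zero AS (Cod AS (Q c)) (Cod AS g')"
        using quot_Zero_iff[of g] g g1 w(1) by auto
    qed simp
    fix g' assume g': "g' \<in> Arr AS" "Dom AS g' = Cod AS (Q f)"
      "g' \<cdot>\<^bsub>AS\<^esub> Q f = Zero AS (Dom AS (Q f)) (Cod AS g')"
    then obtain g where g: "g \<in> Arr A" "g' = Q g" by auto
    with g' have g1: "Dom A g = Cod A f" "Q (g \<cdot> f) = Q (Zero A (Dom A f) (Cod A g))" by simp_all
    then obtain w where w: "w \<in> W" "w \<star> (g \<cdot> f) = Zero A (Dom A f) (Cod A g)"
      using quot_Zero_iff[of "g \<cdot> f"] g by auto
    then have "(w \<star> g) \<cdot> f = Zero A (Dom A f) (Cod A (w \<star> g))"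
      using g g1 by (simp add: scal_Comp_left)
    then obtain u where u: "u \<in> Arr A" "Cod A u = Cod A g" "Dom A u = Cod A c" "u \<cdot> c = w \<star> g"
      using is_cokernel_factor[OF c, of "w \<star> g"] w(1) g g1 by auto
    have "Q (u \<cdot> c) = Q g" unfolding u(4) by (rule quot_scal[OF w(1) g(1)])
    then show "\<exists>u \<in> Arr AS. Cod AS u = Cod AS g' \<and> Dom AS u = Cod AS (Q c) \<and> u \<cdot>\<^bsub>AS\<^esub> Q c = g'"
      using u g by (intro bexI[of _ "Q u"]) simp_all
  qed simp_all
qed

text \<open>Factor a representative as \<open>n p\<close> in \<open>A\<close>, with \<open>p\<close>
  a cokernel of the kernel \<open>k\<close>. If the class is mono, the class of \<open>k\<close>
  vanishes, so that of \<open>p\<close> is a cokernel of a zero arrow and thus invertible. What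
  remains is the class of \<open>n\<close>, a kernel already in \<open>A\<close>.\<close>

lemma quot_mono_normal:
  assumes "is_mono AS m'"
  shows "\<exists>f. is_kernel AS m' f"
proof -
  obtain m where m: "m \<in> Arr A" "m' = Q m" using assms by (auto simp: is_mono_def)
  obtain k p n c where f: "m = n \<cdot> p" "Dom A n = Cod A p" "is_kernel A k m" "is_cokernel A p k"
    "is_kernel A n c"
    using image_factorization[OF m(1)] by metis
  note k [simp] = is_kernelD(2,3)[OF f(3)]
  note p [simp] = is_cokernelD(2,3)[OF f(4)] and n [simp] = is_kernelD(2)[OF f(5)]
  have "Q m \<cdot>\<^bsub>AS\<^esub> Q k = Zero AS (Dom AS (Q k)) (Cod AS (Q m))"
    using m is_kernelD(4)[OF f(3)] by simp
  from B.is_mono_Zero[OF assms[unfolded m(2)] _ _ this]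
  have "Q k = Q (Zero A (Dom A k) (Dom A m))" using m(1) by simp
  then have "is_cokernel AS (Q p) (Zero AS (Dom A k) (Dom A m))"
    using quot_is_cokernel[OF f(4)] by simp
  from B.cokernel_of_Zero_iso[OF this] have "is_iso AS (Q p)" using m(1) by simp
  from B.is_kernel_iso_left[OF quot_is_kernel[OF f(5)] this]
  have "is_kernel AS (Q n \<cdot>\<^bsub>AS\<^esub> Q p) (Q c)" using f(2) by simp
  moreover have "Q n \<cdot>\<^bsub>AS\<^esub> Q p = m'" using f(1,2) m(2) by simp
  ultimately show ?thesis by auto
qed

lemma quot_epi_normal:
  assumes "is_epi AS e'"
  shows "\<exists>f. is_cokernel AS e' f"
proof -
  obtain e where e: "e \<in> Arr A" "e' = Q e" using assms by (auto simp: is_epi_def)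
  obtain k p n c where f: "e = n \<cdot> p" "Dom A n = Cod A p" "is_cokernel A c e" "is_cokernel A p k"
    "is_kernel A n c"
    using image_factorization[OF e(1)] by metis
  note c [simp] = is_cokernelD(2,3)[OF f(3)]
  note p [simp] = is_cokernelD(2)[OF f(4)] and n [simp] = is_kernelD(2)[OF f(5)]
  have "Q c \<cdot>\<^bsub>AS\<^esub> Q e = Zero AS (Dom AS (Q e)) (Cod AS (Q c))"
    using e is_cokernelD(4)[OF f(3)] by simp
  from B.is_epi_Zero[OF assms[unfolded e(2)] _ _ this]
  have "Q c = Q (Zero A (Cod A e) (Cod A c))" using e(1) by simp
  then have "is_kernel AS (Q n) (Zero AS (Cod A e) (Cod A c))"
    using quot_is_kernel[OF f(5)] by simp
  from B.kernel_of_Zero_iso[OF this] have "is_iso AS (Q n)" using e(1) by simp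
  from B.is_cokernel_iso_right[OF quot_is_cokernel[OF f(4)] this]
  have "is_cokernel AS (Q n \<cdot>\<^bsub>AS\<^esub> Q p) (Q k)" using f(2) by simp
  moreover have "Q n \<cdot>\<^bsub>AS\<^esub> Q p = e'" using f(1,2) e(2) by simp
  ultimately show ?thesis by auto
qed

lemma quot_rigid_abelian_category: "rigid_abelian_category AS"
proof (intro rigid_abelian_category.intro rigid_abelian_category_axioms.intro
    quot_rigid_tensor_category quot_mono_normal quot_epi_normal)
  fix f' assume "f' \<in> Arr AS"
  then obtain f where f: "f \<in> Arr A" "f' = Q f" by auto
  show "\<exists>k. is_kernel AS k f'" "\<exists>c. is_cokernel AS c f'"
    using has_kernel[OF f(1)] has_cokernel[OF f(1)] quot_is_kernel quot_is_cokernel f(2) by blast+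
qed

lemma serre_proj_simps [simp]:
  "FOb (serre_proj A S) X = X" "FArr (serre_proj A S) = Q"
  "FMu (serre_proj A S) X Y = Q (Id A (X \<otimes>\<^sub>o Y))" "FEps (serre_proj A S) = Q (Id A (Unit A))"
  by (simp_all add: serre_proj_def)

lemma serre_proj_tensor_functor: "tensor_functor A AS (serre_proj A S)"
  by (intro tensor_functor.intro tensor_functor_axioms.intro quot_tensor_category
      tensor_category_axioms)
    (auto simp: Hom_iff quot_is_iso is_iso_Id)

lemma serre_proj_exact: "exact_tensor_functor A AS (serre_proj A S)"
  by (intro exact_tensor_functor.intro exact_tensor_functor_axioms.intro
      quot_rigid_abelian_category serre_proj_tensor_functor rigid_abelian_category_axioms)
    (auto intro: quot_is_kernel quot_is_cokernel)

end

section \<open>Tensor functors and natural isomorphisms\<close>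

context tensor_functor
begin

lemma FOb_Ob [simp]: "X \<in> Ob A \<Longrightarrow> FOb F X \<in> Ob B"
  by (rule ob)

lemma FArr_simps [simp]:
  assumes "f \<in> Arr A"
  shows "FArr F f \<in> Arr B" "Dom B (FArr F f) = FOb F (Dom A f)" "Cod B (FArr F f) = FOb F (Cod A f)"
  using arr[of f "Dom A f" "Cod A f"] assms by (auto simp: Hom_iff)

lemmas [simp] = pres_id

lemma FArr_Comp:
  assumes "f \<in> Arr A" "g \<in> Arr A" "Dom A g = Cod A f"
  shows "FArr F (g \<cdot>\<^bsub>A\<^esub> f) = FArr F g \<cdot>\<^bsub>B\<^esub> FArr F f"
  using assms by (intro pres_comp) (auto simp: Hom_iff)

lemma FArr_Add:
  assumes "f \<in> Arr A" "g \<in> Arr A" "Dom A g = Dom A f" "Cod A g = Cod A f"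
  shows "FArr F (f \<oplus>\<^sub>a\<^bsub>A\<^esub> g) = FArr F f \<oplus>\<^sub>a\<^bsub>B\<^esub> FArr F g"
  using assms by (intro pres_add[of _ "Dom A f" "Cod A f"]) (auto simp: Hom_iff)

lemma FArr_Zero [simp]:
  assumes "X \<in> Ob A" "Y \<in> Ob A"
  shows "FArr F (Zero A X Y) = Zero B (FOb F X) (FOb F Y)"
proof -
  have "FArr F (Zero A X Y) \<oplus>\<^sub>a\<^bsub>B\<^esub> FArr F (Zero A X Y) = FArr F (Zero A X Y)"
    using assms by (simp flip: FArr_Add)
  from B.Add_idem_Zero[OF _ this] show ?thesis using assms by simp
qed

lemma FArr_Sub:
  assumes "f \<in> Arr A" "g \<in> Arr A" "Dom A g = Dom A f" "Cod A g = Cod A f"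
  shows "FArr F (Sub A f g) = Sub B (FArr F f) (FArr F g)"
proof -
  have "FArr F g \<oplus>\<^sub>a\<^bsub>B\<^esub> FArr F (Sub A f g) = FArr F f"
    using assms by (simp add: A.Sub_Add flip: FArr_Add)
  then have "Sub B (FArr F f) (FArr F g) = FArr F (Sub A f g)"
    using assms by (subst B.Sub_eq_iff) simp_all
  then show ?thesis by simp
qed

lemma FArr_iso:
  assumes "is_iso A f" shows "is_iso B (FArr F f)"
  using assms A.is_iso_Arr[OF assms]
  by (intro B.is_isoI[of "FArr F f" "FArr F (inv_arr A f)"]) (simp_all flip: FArr_Comp)

lemma FMu_simps [simp]:
  assumes "X \<in> Ob A" "Y \<in> Ob A"
  shows "FMu F X Y \<in> Arr B" "Dom B (FMu F X Y) = FOb F X \<otimes>\<^sub>o\<^bsub>B\<^esub> FOb F Y"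
    "Cod B (FMu F X Y) = FOb F (X \<otimes>\<^sub>o\<^bsub>A\<^esub> Y)" "is_iso B (FMu F X Y)"
  using mu_hom[OF assms] mu_iso[OF assms] by (auto simp: Hom_iff)

lemma FEps_simps [simp]:
  "FEps F \<in> Arr B" "Dom B (FEps F) = Unit B" "Cod B (FEps F) = FOb F (Unit A)" "is_iso B (FEps F)"
  using eps_hom eps_iso by (auto simp: Hom_iff)

lemma FMu_natural:
  assumes "f \<in> Arr A" "g \<in> Arr A"
  shows "FMu F (Cod A f) (Cod A g) \<cdot>\<^bsub>B\<^esub> (FArr F f \<otimes>\<^sub>a\<^bsub>B\<^esub> FArr F g)
    = FArr F (f \<otimes>\<^sub>a\<^bsub>A\<^esub> g) \<cdot>\<^bsub>B\<^esub> FMu F (Dom A f) (Dom A g)"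
  using assms by (intro mu_natural) (auto simp: Hom_iff)

text \<open>The ring homomorphism induced on endomorphisms of the unit objects; conjugation by
  \<open>FEps F\<close> accounts for \<open>F\<close> preserving the unit only up to
  isomorphism.\<close>

definition FZ where
  "FZ z = inv_arr B (FEps F) \<cdot>\<^bsub>B\<^esub> (FArr F z \<cdot>\<^bsub>B\<^esub> FEps F)"

lemma FZ_scalars [simp]: "z \<in> scalars A \<Longrightarrow> FZ z \<in> scalars B"
  by (intro scalarsI) (simp_all add: FZ_def)

lemma FZ_Comp:
  assumes "z \<in> scalars A" "w \<in> scalars A"
  shows "FZ (z \<cdot>\<^bsub>A\<^esub> w) = FZ z \<cdot>\<^bsub>B\<^esub> FZ w"
  using assms by (simp add: FZ_def FArr_Comp B.Comp_assoc)

lemma FZ_Id [simp]: "FZ (Id A (Unit A)) = Id B (Unit B)"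
  by (simp add: FZ_def)

lemma FZ_Add:
  assumes "z \<in> scalars A" "w \<in> scalars A"
  shows "FZ (z \<oplus>\<^sub>a\<^bsub>A\<^esub> w) = FZ z \<oplus>\<^sub>a\<^bsub>B\<^esub> FZ w"
  using assms by (simp add: FZ_def FArr_Add B.Comp_Add_left B.Comp_Add_right)

lemma FZ_Zero_iff:
  assumes "z \<in> scalars A"
  shows "FZ z = Zero B (Unit B) (Unit B) \<longleftrightarrow> FArr F z = Zero B (FOb F (Unit A)) (FOb F (Unit A))"
proof
  assume "FZ z = Zero B (Unit B) (Unit B)"
  then have "FEps F \<cdot>\<^bsub>B\<^esub> FZ z \<cdot>\<^bsub>B\<^esub> inv_arr B (FEps F) = Zero B (FOb F (Unit A)) (FOb F (Unit A))"
    by simp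
  then show "FArr F z = Zero B (FOb F (Unit A)) (FOb F (Unit A))"
    using assms by (simp add: FZ_def B.Comp_assoc)
qed (simp add: FZ_def)

lemma FZ_Sub:
  assumes "z \<in> scalars A" "w \<in> scalars A"
  shows "FZ (Sub A z w) = Sub B (FZ z) (FZ w)"
  using assms by (simp add: FZ_def FArr_Sub B.Comp_Sub B.Sub_Comp)

text \<open>Unit coherence expresses the left unit constraint of \<open>B\<close> at
  \<open>F X\<close> through the image of that of \<open>A\<close>, \<open>FMu\<close> and
  \<open>FEps\<close>. Naturality of \<open>FMu\<close> then moves the scalar from one side to the
  other.\<close>

lemma FArr_scal:
  assumes z: "z \<in> scalars A" and f: "f \<in> Arr A"
  shows "FArr F (z \<star>\<^bsub>A\<^esub> f) = FZ z \<star>\<^bsub>B\<^esub> FArr F f"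
proof -
  let ?X = "Cod A f" and ?e = "FEps F"
  let ?FX = "FOb F ?X" and ?l = "LUnit A ?X"
  let ?I = "Id B ?FX" and ?m = "FMu F (Unit A) ?X"
  have X [simp]: "?X \<in> Ob A" using f by simp
  have L: "LUnit B ?FX = FArr F ?l \<cdot>\<^bsub>B\<^esub> (?m \<cdot>\<^bsub>B\<^esub> (?e \<otimes>\<^sub>a\<^bsub>B\<^esub> ?I))"
    by (simp add: B.Comp_assoc flip: mu_lunit)
  have e: "?e \<cdot>\<^bsub>B\<^esub> FZ z = FArr F z \<cdot>\<^bsub>B\<^esub> ?e" using z by (simp add: FZ_def)
  have "(FZ z \<star>\<^bsub>B\<^esub> ?I) \<cdot>\<^bsub>B\<^esub> LUnit B ?FX = LUnit B ?FX \<cdot>\<^bsub>B\<^esub> (FZ z \<otimes>\<^sub>a\<^bsub>B\<^esub> ?I)"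
    using z by (simp add: scal_def B.Comp_assoc)
  also have "\<dots> = FArr F ?l \<cdot>\<^bsub>B\<^esub> (?m \<cdot>\<^bsub>B\<^esub> ((?e \<cdot>\<^bsub>B\<^esub> FZ z) \<otimes>\<^sub>a\<^bsub>B\<^esub> ?I))"
    unfolding L using z by (simp add: B.Comp_assoc B.Ten_Comp)
  also have "(?e \<cdot>\<^bsub>B\<^esub> FZ z) \<otimes>\<^sub>a\<^bsub>B\<^esub> ?I = (FArr F z \<otimes>\<^sub>a\<^bsub>B\<^esub> FArr F (Id A ?X)) \<cdot>\<^bsub>B\<^esub> (?e \<otimes>\<^sub>a\<^bsub>B\<^esub> ?I)"
    unfolding e using z by (simp add: B.Ten_Comp)
  also have "FArr F ?l \<cdot>\<^bsub>B\<^esub> (?m \<cdot>\<^bsub>B\<^esub> \<dots>)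
    = FArr F ?l \<cdot>\<^bsub>B\<^esub> ((?m \<cdot>\<^bsub>B\<^esub> (FArr F z \<otimes>\<^sub>a\<^bsub>B\<^esub> FArr F (Id A ?X))) \<cdot>\<^bsub>B\<^esub> (?e \<otimes>\<^sub>a\<^bsub>B\<^esub> ?I))"
    using z by (simp add: B.Comp_assoc)
  also have "?m \<cdot>\<^bsub>B\<^esub> (FArr F z \<otimes>\<^sub>a\<^bsub>B\<^esub> FArr F (Id A ?X)) = FArr F (z \<otimes>\<^sub>a\<^bsub>A\<^esub> Id A ?X) \<cdot>\<^bsub>B\<^esub> ?m"
    using FMu_natural[of z "Id A ?X"] z by simp
  also have "FArr F ?l \<cdot>\<^bsub>B\<^esub> (FArr F (z \<otimes>\<^sub>a\<^bsub>A\<^esub> Id A ?X) \<cdot>\<^bsub>B\<^esub> ?m \<cdot>\<^bsub>B\<^esub> (?e \<otimes>\<^sub>a\<^bsub>B\<^esub> ?I))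
    = FArr F (?l \<cdot>\<^bsub>A\<^esub> (z \<otimes>\<^sub>a\<^bsub>A\<^esub> Id A ?X)) \<cdot>\<^bsub>B\<^esub> (?m \<cdot>\<^bsub>B\<^esub> (?e \<otimes>\<^sub>a\<^bsub>B\<^esub> ?I))"
    using z by (simp add: FArr_Comp B.Comp_assoc)
  also have "?l \<cdot>\<^bsub>A\<^esub> (z \<otimes>\<^sub>a\<^bsub>A\<^esub> Id A ?X) = (z \<star>\<^bsub>A\<^esub> Id A ?X) \<cdot>\<^bsub>A\<^esub> ?l"
    using z by (simp add: scal_def A.Comp_assoc)
  also have "FArr F \<dots> \<cdot>\<^bsub>B\<^esub> (?m \<cdot>\<^bsub>B\<^esub> (?e \<otimes>\<^sub>a\<^bsub>B\<^esub> ?I)) = FArr F (z \<star>\<^bsub>A\<^esub> Id A ?X) \<cdot>\<^bsub>B\<^esub> LUnit B ?FX"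
    unfolding L using z by (simp add: FArr_Comp B.Comp_assoc)
  finally have *: "FZ z \<star>\<^bsub>B\<^esub> ?I = FArr F (z \<star>\<^bsub>A\<^esub> Id A ?X)"
    using B.iso_cancel_right[of "LUnit B ?FX"] z by simp
  have "z \<star>\<^bsub>A\<^esub> f = (z \<star>\<^bsub>A\<^esub> Id A ?X) \<cdot>\<^bsub>A\<^esub> f" "FZ z \<star>\<^bsub>B\<^esub> FArr F f = (FZ z \<star>\<^bsub>B\<^esub> ?I) \<cdot>\<^bsub>B\<^esub> FArr F f"
    using z f by (simp_all add: A.scal_Comp_left B.scal_Comp_left)
  then show ?thesis using z f by (simp add: FArr_Comp *)
qed

end

section \<open>Composition of tensor functors and of their natural isomorphisms\<close>

lemma comp_tfun_simps [simp]:
  "FOb (comp_tfun D G F) X = FOb G (FOb F X)" "FArr (comp_tfun D G F) f = FArr G (FArr F f)"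
  "FMu (comp_tfun D G F) X Y = FArr G (FMu F X Y) \<cdot>\<^bsub>D\<^esub> FMu G (FOb F X) (FOb F Y)"
  "FEps (comp_tfun D G F) = FArr G (FEps F) \<cdot>\<^bsub>D\<^esub> FEps G"
  by (simp_all add: comp_tfun_def)

text \<open>Each coherence condition is pasted from the image under \<open>G\<close> of the
  condition for \<open>F\<close> and the condition for \<open>G\<close> at the images under
  \<open>F\<close>; naturality of \<open>FMu G\<close> joins the two.\<close>

lemma tensor_functor_comp:
  assumes F: "tensor_functor A B F" and G: "tensor_functor B D G"
  shows "tensor_functor A D (comp_tfun D G F)"
proof -
  interpret F: tensor_functor A B F by (rule F)
  interpret G: tensor_functor B D G by (rule G)
  let ?H = "comp_tfun D G F"
  have mu_hom: "FMu ?H X Y \<in> Hom D (FOb ?H X \<otimes>\<^sub>o\<^bsub>D\<^esub> FOb ?H Y) (FOb ?H (X \<otimes>\<^sub>o\<^bsub>A\<^esub> Y))"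
    and mu_iso: "is_iso D (FMu ?H X Y)" if "X \<in> Ob A" "Y \<in> Ob A" for X Y
    using that by (auto simp: Hom_iff intro!: G.B.is_iso_Comp G.FArr_iso)
  have eps: "FEps ?H \<in> Hom D (Unit D) (FOb ?H (Unit A))" "is_iso D (FEps ?H)"
    by (auto simp: Hom_iff intro!: G.B.is_iso_Comp G.FArr_iso)
  have nat: "FMu ?H (Cod A f) (Cod A g) \<cdot>\<^bsub>D\<^esub> (FArr ?H f \<otimes>\<^sub>a\<^bsub>D\<^esub> FArr ?H g)
    = FArr ?H (f \<otimes>\<^sub>a\<^bsub>A\<^esub> g) \<cdot>\<^bsub>D\<^esub> FMu ?H (Dom A f) (Dom A g)" if "f \<in> Arr A" "g \<in> Arr A" for f g
  proof -
    have "FMu ?H (Cod A f) (Cod A g) \<cdot>\<^bsub>D\<^esub> (FArr ?H f \<otimes>\<^sub>a\<^bsub>D\<^esub> FArr ?H g)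
      = FArr G (FMu F (Cod A f) (Cod A g) \<cdot>\<^bsub>B\<^esub> (FArr F f \<otimes>\<^sub>a\<^bsub>B\<^esub> FArr F g))
        \<cdot>\<^bsub>D\<^esub> FMu G (FOb F (Dom A f)) (FOb F (Dom A g))"
      using that G.FMu_natural[of "FArr F f" "FArr F g"] by (simp add: G.B.Comp_assoc G.FArr_Comp)
    then show ?thesis using that by (simp add: F.FMu_natural G.FArr_Comp G.B.Comp_assoc)
  qed
  have assoc: "FArr ?H (Assoc A X Y Z) \<cdot>\<^bsub>D\<^esub> FMu ?H (X \<otimes>\<^sub>o\<^bsub>A\<^esub> Y) Z \<cdot>\<^bsub>D\<^esub> (FMu ?H X Y \<otimes>\<^sub>a\<^bsub>D\<^esub> Id D (FOb ?H Z))
        = FMu ?H X (Y \<otimes>\<^sub>o\<^bsub>A\<^esub> Z) \<cdot>\<^bsub>D\<^esub> (Id D (FOb ?H X) \<otimes>\<^sub>a\<^bsub>D\<^esub> FMu ?H Y Z)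
            \<cdot>\<^bsub>D\<^esub> Assoc D (FOb ?H X) (FOb ?H Y) (FOb ?H Z)"
    if [simp]: "X \<in> Ob A" "Y \<in> Ob A" "Z \<in> Ob A" for X Y Z
  proof -
    let ?x = "FOb F X" and ?y = "FOb F Y" and ?z = "FOb F Z"
    let ?I = "Id D (FOb G ?z)" and ?J = "Id D (FOb G ?x)"
    have "FMu G (FOb F (X \<otimes>\<^sub>o\<^bsub>A\<^esub> Y)) ?z \<cdot>\<^bsub>D\<^esub> (FMu ?H X Y \<otimes>\<^sub>a\<^bsub>D\<^esub> ?I)
      = (FMu G (FOb F (X \<otimes>\<^sub>o\<^bsub>A\<^esub> Y)) ?z \<cdot>\<^bsub>D\<^esub> (FArr G (FMu F X Y) \<otimes>\<^sub>a\<^bsub>D\<^esub> FArr G (Id B ?z))) \<cdot>\<^bsub>D\<^esub> (FMu G ?x ?y \<otimes>\<^sub>a\<^bsub>D\<^esub> ?I)"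
      by (simp add: G.B.Comp_assoc G.B.Ten_Comp)
    also have "\<dots> = FArr G (FMu F X Y \<otimes>\<^sub>a\<^bsub>B\<^esub> Id B ?z) \<cdot>\<^bsub>D\<^esub> (FMu G (?x \<otimes>\<^sub>o\<^bsub>B\<^esub> ?y) ?z \<cdot>\<^bsub>D\<^esub> (FMu G ?x ?y \<otimes>\<^sub>a\<^bsub>D\<^esub> ?I))"
      using G.FMu_natural[of "FMu F X Y" "Id B ?z"] by (simp add: G.B.Comp_assoc)
    finally have 1: "FMu G (FOb F (X \<otimes>\<^sub>o\<^bsub>A\<^esub> Y)) ?z \<cdot>\<^bsub>D\<^esub> (FMu ?H X Y \<otimes>\<^sub>a\<^bsub>D\<^esub> ?I) = \<dots>" .
    have "FMu G ?x (FOb F (Y \<otimes>\<^sub>o\<^bsub>A\<^esub> Z)) \<cdot>\<^bsub>D\<^esub> (?J \<otimes>\<^sub>a\<^bsub>D\<^esub> FMu ?H Y Z)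
      = (FMu G ?x (FOb F (Y \<otimes>\<^sub>o\<^bsub>A\<^esub> Z)) \<cdot>\<^bsub>D\<^esub> (FArr G (Id B ?x) \<otimes>\<^sub>a\<^bsub>D\<^esub> FArr G (FMu F Y Z))) \<cdot>\<^bsub>D\<^esub> (?J \<otimes>\<^sub>a\<^bsub>D\<^esub> FMu G ?y ?z)"
      by (simp add: G.B.Comp_assoc G.B.Ten_Comp)
    also have "\<dots> = FArr G (Id B ?x \<otimes>\<^sub>a\<^bsub>B\<^esub> FMu F Y Z) \<cdot>\<^bsub>D\<^esub> (FMu G ?x (?y \<otimes>\<^sub>o\<^bsub>B\<^esub> ?z) \<cdot>\<^bsub>D\<^esub> (?J \<otimes>\<^sub>a\<^bsub>D\<^esub> FMu G ?y ?z))"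
      using G.FMu_natural[of "Id B ?x" "FMu F Y Z"] by (simp add: G.B.Comp_assoc)
    finally have 2: "FMu G ?x (FOb F (Y \<otimes>\<^sub>o\<^bsub>A\<^esub> Z)) \<cdot>\<^bsub>D\<^esub> (?J \<otimes>\<^sub>a\<^bsub>D\<^esub> FMu ?H Y Z) = \<dots>" .
    have "FArr ?H (Assoc A X Y Z) \<cdot>\<^bsub>D\<^esub> FMu ?H (X \<otimes>\<^sub>o\<^bsub>A\<^esub> Y) Z \<cdot>\<^bsub>D\<^esub> (FMu ?H X Y \<otimes>\<^sub>a\<^bsub>D\<^esub> ?I)
      = FArr G (FArr F (Assoc A X Y Z) \<cdot>\<^bsub>B\<^esub> FMu F (X \<otimes>\<^sub>o\<^bsub>A\<^esub> Y) Z \<cdot>\<^bsub>B\<^esub> (FMu F X Y \<otimes>\<^sub>a\<^bsub>B\<^esub> Id B ?z))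
        \<cdot>\<^bsub>D\<^esub> (FMu G (?x \<otimes>\<^sub>o\<^bsub>B\<^esub> ?y) ?z \<cdot>\<^bsub>D\<^esub> (FMu G ?x ?y \<otimes>\<^sub>a\<^bsub>D\<^esub> ?I))"
      using 1 by (simp add: G.B.Comp_assoc G.FArr_Comp)
    also have "\<dots> = FArr G (FMu F X (Y \<otimes>\<^sub>o\<^bsub>A\<^esub> Z) \<cdot>\<^bsub>B\<^esub> (Id B ?x \<otimes>\<^sub>a\<^bsub>B\<^esub> FMu F Y Z))
      \<cdot>\<^bsub>D\<^esub> (FArr G (Assoc B ?x ?y ?z) \<cdot>\<^bsub>D\<^esub> FMu G (?x \<otimes>\<^sub>o\<^bsub>B\<^esub> ?y) ?z \<cdot>\<^bsub>D\<^esub> (FMu G ?x ?y \<otimes>\<^sub>a\<^bsub>D\<^esub> ?I))"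
      by (simp add: F.mu_assoc G.FArr_Comp G.B.Comp_assoc)
    also have "\<dots> = FArr G (FMu F X (Y \<otimes>\<^sub>o\<^bsub>A\<^esub> Z)) \<cdot>\<^bsub>D\<^esub> (FArr G (Id B ?x \<otimes>\<^sub>a\<^bsub>B\<^esub> FMu F Y Z)
      \<cdot>\<^bsub>D\<^esub> (FMu G ?x (?y \<otimes>\<^sub>o\<^bsub>B\<^esub> ?z) \<cdot>\<^bsub>D\<^esub> (?J \<otimes>\<^sub>a\<^bsub>D\<^esub> FMu G ?y ?z))) \<cdot>\<^bsub>D\<^esub> Assoc D (FOb G ?x) (FOb G ?y) (FOb G ?z)"
      using G.mu_assoc[of ?x ?y ?z] by (simp add: G.FArr_Comp G.B.Comp_assoc)
    also have "\<dots> = FMu ?H X (Y \<otimes>\<^sub>o\<^bsub>A\<^esub> Z) \<cdot>\<^bsub>D\<^esub> (?J \<otimes>\<^sub>a\<^bsub>D\<^esub> FMu ?H Y Z) \<cdot>\<^bsub>D\<^esub> Assoc D (FOb G ?x) (FOb G ?y) (FOb G ?z)"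
      unfolding 2[symmetric] by (simp add: G.B.Comp_assoc)
    finally show ?thesis by simp
  qed
  have lunit: "FArr ?H (LUnit A X) \<cdot>\<^bsub>D\<^esub> FMu ?H (Unit A) X \<cdot>\<^bsub>D\<^esub> (FEps ?H \<otimes>\<^sub>a\<^bsub>D\<^esub> Id D (FOb ?H X))
        = LUnit D (FOb ?H X)" if [simp]: "X \<in> Ob A" for X
  proof -
    let ?x = "FOb F X"
    have "FMu G (FOb F (Unit A)) ?x \<cdot>\<^bsub>D\<^esub> (FEps ?H \<otimes>\<^sub>a\<^bsub>D\<^esub> Id D (FOb G ?x))
      = (FMu G (FOb F (Unit A)) ?x \<cdot>\<^bsub>D\<^esub> (FArr G (FEps F) \<otimes>\<^sub>a\<^bsub>D\<^esub> FArr G (Id B ?x))) \<cdot>\<^bsub>D\<^esub> (FEps G \<otimes>\<^sub>a\<^bsub>D\<^esub> Id D (FOb G ?x))"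
      by (simp add: G.B.Comp_assoc G.B.Ten_Comp)
    also have "\<dots> = FArr G (FEps F \<otimes>\<^sub>a\<^bsub>B\<^esub> Id B ?x) \<cdot>\<^bsub>D\<^esub> (FMu G (Unit B) ?x \<cdot>\<^bsub>D\<^esub> (FEps G \<otimes>\<^sub>a\<^bsub>D\<^esub> Id D (FOb G ?x)))"
      using G.FMu_natural[of "FEps F" "Id B ?x"] by (simp add: G.B.Comp_assoc)
    finally have "FArr ?H (LUnit A X) \<cdot>\<^bsub>D\<^esub> FMu ?H (Unit A) X \<cdot>\<^bsub>D\<^esub> (FEps ?H \<otimes>\<^sub>a\<^bsub>D\<^esub> Id D (FOb ?H X))
      = FArr G (FArr F (LUnit A X) \<cdot>\<^bsub>B\<^esub> FMu F (Unit A) X \<cdot>\<^bsub>B\<^esub> (FEps F \<otimes>\<^sub>a\<^bsub>B\<^esub> Id B ?x))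
        \<cdot>\<^bsub>D\<^esub> (FMu G (Unit B) ?x \<cdot>\<^bsub>D\<^esub> (FEps G \<otimes>\<^sub>a\<^bsub>D\<^esub> Id D (FOb G ?x)))"
      by (simp add: G.B.Comp_assoc G.FArr_Comp)
    then show ?thesis by (simp add: F.mu_lunit flip: G.mu_lunit G.B.Comp_assoc)
  qed
  have runit: "FArr ?H (RUnit A X) \<cdot>\<^bsub>D\<^esub> FMu ?H X (Unit A) \<cdot>\<^bsub>D\<^esub> (Id D (FOb ?H X) \<otimes>\<^sub>a\<^bsub>D\<^esub> FEps ?H)
        = RUnit D (FOb ?H X)" if [simp]: "X \<in> Ob A" for X
  proof -
    let ?x = "FOb F X"
    have "FMu G ?x (FOb F (Unit A)) \<cdot>\<^bsub>D\<^esub> (Id D (FOb G ?x) \<otimes>\<^sub>a\<^bsub>D\<^esub> FEps ?H)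
      = (FMu G ?x (FOb F (Unit A)) \<cdot>\<^bsub>D\<^esub> (FArr G (Id B ?x) \<otimes>\<^sub>a\<^bsub>D\<^esub> FArr G (FEps F))) \<cdot>\<^bsub>D\<^esub> (Id D (FOb G ?x) \<otimes>\<^sub>a\<^bsub>D\<^esub> FEps G)"
      by (simp add: G.B.Comp_assoc G.B.Ten_Comp)
    also have "\<dots> = FArr G (Id B ?x \<otimes>\<^sub>a\<^bsub>B\<^esub> FEps F) \<cdot>\<^bsub>D\<^esub> (FMu G ?x (Unit B) \<cdot>\<^bsub>D\<^esub> (Id D (FOb G ?x) \<otimes>\<^sub>a\<^bsub>D\<^esub> FEps G))"
      using G.FMu_natural[of "Id B ?x" "FEps F"] by (simp add: G.B.Comp_assoc)
    finally have "FArr ?H (RUnit A X) \<cdot>\<^bsub>D\<^esub> FMu ?H X (Unit A) \<cdot>\<^bsub>D\<^esub> (Id D (FOb ?H X) \<otimes>\<^sub>a\<^bsub>D\<^esub> FEps ?H)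
      = FArr G (FArr F (RUnit A X) \<cdot>\<^bsub>B\<^esub> FMu F X (Unit A) \<cdot>\<^bsub>B\<^esub> (Id B ?x \<otimes>\<^sub>a\<^bsub>B\<^esub> FEps F))
        \<cdot>\<^bsub>D\<^esub> (FMu G ?x (Unit B) \<cdot>\<^bsub>D\<^esub> (Id D (FOb G ?x) \<otimes>\<^sub>a\<^bsub>D\<^esub> FEps G))"
      by (simp add: G.B.Comp_assoc G.FArr_Comp)
    then show ?thesis by (simp add: F.mu_runit flip: G.mu_runit G.B.Comp_assoc)
  qed
  have sym: "FArr ?H (Sym A X Y) \<cdot>\<^bsub>D\<^esub> FMu ?H X Y = FMu ?H Y X \<cdot>\<^bsub>D\<^esub> Sym D (FOb ?H X) (FOb ?H Y)"
    if [simp]: "X \<in> Ob A" "Y \<in> Ob A" for X Y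
  proof -
    have "FArr ?H (Sym A X Y) \<cdot>\<^bsub>D\<^esub> FMu ?H X Y
      = FArr G (FArr F (Sym A X Y) \<cdot>\<^bsub>B\<^esub> FMu F X Y) \<cdot>\<^bsub>D\<^esub> FMu G (FOb F X) (FOb F Y)"
      by (simp add: G.B.Comp_assoc G.FArr_Comp)
    also have "\<dots> = FArr G (FMu F Y X) \<cdot>\<^bsub>D\<^esub> (FArr G (Sym B (FOb F X) (FOb F Y)) \<cdot>\<^bsub>D\<^esub> FMu G (FOb F X) (FOb F Y))"
      by (simp add: F.mu_sym G.B.Comp_assoc G.FArr_Comp)
    finally show ?thesis by (simp add: G.mu_sym G.B.Comp_assoc)
  qed
  show ?thesis
    by (intro tensor_functor.intro tensor_functor_axioms.intro F.A.tensor_category_axioms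
        G.B.tensor_category_axioms mu_hom mu_iso eps assoc lunit runit sym)
      (use nat in \<open>auto simp: Hom_iff F.FArr_Comp G.FArr_Comp F.FArr_Add G.FArr_Add\<close>)
qed

context tensor_nat_iso
begin

lemma component_simps [simp]:
  assumes "X \<in> Ob A"
  shows "\<eta> X \<in> Arr B" "Dom B (\<eta> X) = FOb F X" "Cod B (\<eta> X) = FOb G X" "is_iso B (\<eta> X)"
  using component[OF assms] component_iso[OF assms] by (auto simp: Hom_iff)

lemma component_natural:
  assumes "f \<in> Arr A"
  shows "\<eta> (Cod A f) \<cdot>\<^bsub>B\<^esub> FArr F f = FArr G f \<cdot>\<^bsub>B\<^esub> \<eta> (Dom A f)"
  using assms by (intro natural) (auto simp: Hom_iff)

text \<open>Used to transfer faithfulness, and the kernel of the induced map on \<open>Z\<close>,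
  between isomorphic functors.\<close>

lemma FArr_eq_iff:
  assumes "f \<in> Arr A" "g \<in> Arr A" "Dom A f = Dom A g" "Cod A f = Cod A g"
  shows "FArr F f = FArr F g \<longleftrightarrow> FArr G f = FArr G g"
proof
  assume "FArr F f = FArr F g"
  then have "FArr G f \<cdot>\<^bsub>B\<^esub> \<eta> (Dom A f) = FArr G g \<cdot>\<^bsub>B\<^esub> \<eta> (Dom A f)"
    using component_natural[OF assms(1)] component_natural[OF assms(2)] assms(3,4) by simp
  then show "FArr G f = FArr G g"
    by (subst (asm) F.B.iso_cancel_right) (use assms in simp_all)
next
  assume "FArr G f = FArr G g"
  then have "\<eta> (Cod A f) \<cdot>\<^bsub>B\<^esub> FArr F f = \<eta> (Cod A f) \<cdot>\<^bsub>B\<^esub> FArr F g"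
    using component_natural[OF assms(1)] component_natural[OF assms(2)] assms(3,4) by simp
  then show "FArr F f = FArr F g"
    by (subst (asm) F.B.iso_cancel_left) (use assms in simp_all)
qed

end

lemma tensor_nat_iso_comp:
  assumes "tensor_nat_iso A B F G \<eta>" "tensor_nat_iso A B G H \<theta>"
  shows "tensor_nat_iso A B F H (\<lambda>X. \<theta> X \<cdot>\<^bsub>B\<^esub> \<eta> X)"
proof -
  interpret \<eta>: tensor_nat_iso A B F G \<eta> by fact
  interpret \<theta>: tensor_nat_iso A B G H \<theta> by fact
  show ?thesis
  proof (intro tensor_nat_iso.intro tensor_nat_iso_axioms.intro \<eta>.F.tensor_functor_axioms
      \<theta>.G.tensor_functor_axioms)
    fix X Y f assume f: "f \<in> Hom A X Y"
    then have f' [simp]: "f \<in> Arr A" "X \<in> Ob A" "Y \<in> Ob A" and [simp]: "Dom A f = X" "Cod A f = Y"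
      by (auto simp: Hom_iff)
    have "\<theta> Y \<cdot>\<^bsub>B\<^esub> \<eta> Y \<cdot>\<^bsub>B\<^esub> FArr F f = (\<theta> Y \<cdot>\<^bsub>B\<^esub> FArr G f) \<cdot>\<^bsub>B\<^esub> \<eta> X"
      using \<eta>.component_natural[of f] by (simp add: \<eta>.F.B.Comp_assoc)
    also have "\<theta> Y \<cdot>\<^bsub>B\<^esub> FArr G f = FArr H f \<cdot>\<^bsub>B\<^esub> \<theta> X"
      using \<theta>.component_natural[of f] by simp
    finally show "\<theta> Y \<cdot>\<^bsub>B\<^esub> \<eta> Y \<cdot>\<^bsub>B\<^esub> FArr F f = FArr H f \<cdot>\<^bsub>B\<^esub> (\<theta> X \<cdot>\<^bsub>B\<^esub> \<eta> X)"
      by (simp add: \<eta>.F.B.Comp_assoc)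
  next
    fix X Y assume [simp]: "X \<in> Ob A" "Y \<in> Ob A"
    let ?XY = "X \<otimes>\<^sub>o\<^bsub>A\<^esub> Y"
    have "\<theta> ?XY \<cdot>\<^bsub>B\<^esub> \<eta> ?XY \<cdot>\<^bsub>B\<^esub> FMu F X Y = (\<theta> ?XY \<cdot>\<^bsub>B\<^esub> FMu G X Y) \<cdot>\<^bsub>B\<^esub> (\<eta> X \<otimes>\<^sub>a\<^bsub>B\<^esub> \<eta> Y)"
      by (simp add: \<eta>.F.B.Comp_assoc \<eta>.monoidal)
    also have "\<dots> = FMu H X Y \<cdot>\<^bsub>B\<^esub> ((\<theta> X \<cdot>\<^bsub>B\<^esub> \<eta> X) \<otimes>\<^sub>a\<^bsub>B\<^esub> (\<theta> Y \<cdot>\<^bsub>B\<^esub> \<eta> Y))"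
      by (simp add: \<eta>.F.B.Comp_assoc \<theta>.monoidal \<eta>.F.B.Ten_Comp)
    finally show "\<theta> ?XY \<cdot>\<^bsub>B\<^esub> \<eta> ?XY \<cdot>\<^bsub>B\<^esub> FMu F X Y = FMu H X Y \<cdot>\<^bsub>B\<^esub> ((\<theta> X \<cdot>\<^bsub>B\<^esub> \<eta> X) \<otimes>\<^sub>a\<^bsub>B\<^esub> (\<theta> Y \<cdot>\<^bsub>B\<^esub> \<eta> Y))"
      .
  qed (simp_all add: Hom_iff \<eta>.F.B.is_iso_Comp \<eta>.F.B.Comp_assoc \<eta>.unital \<theta>.unital)
qed

lemma tensor_nat_iso_inv:
  assumes "tensor_nat_iso A B F G \<eta>"
  shows "tensor_nat_iso A B G F (\<lambda>X. inv_arr B (\<eta> X))"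
proof -
  interpret \<eta>: tensor_nat_iso A B F G \<eta> by fact
  show ?thesis
  proof (intro tensor_nat_iso.intro tensor_nat_iso_axioms.intro \<eta>.F.tensor_functor_axioms
      \<eta>.G.tensor_functor_axioms)
    fix X Y f assume f: "f \<in> Hom A X Y"
    then have f' [simp]: "f \<in> Arr A" "X \<in> Ob A" "Y \<in> Ob A" and [simp]: "Dom A f = X" "Cod A f = Y"
      by (auto simp: Hom_iff)
    have "inv_arr B (\<eta> Y) \<cdot>\<^bsub>B\<^esub> FArr G f = inv_arr B (\<eta> Y) \<cdot>\<^bsub>B\<^esub> ((FArr G f \<cdot>\<^bsub>B\<^esub> \<eta> X) \<cdot>\<^bsub>B\<^esub> inv_arr B (\<eta> X))"
      by (simp add: \<eta>.F.B.Comp_assoc)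
    also have "FArr G f \<cdot>\<^bsub>B\<^esub> \<eta> X = \<eta> Y \<cdot>\<^bsub>B\<^esub> FArr F f"
      using \<eta>.component_natural[of f] by simp
    also have "inv_arr B (\<eta> Y) \<cdot>\<^bsub>B\<^esub> (\<eta> Y \<cdot>\<^bsub>B\<^esub> FArr F f \<cdot>\<^bsub>B\<^esub> inv_arr B (\<eta> X)) = FArr F f \<cdot>\<^bsub>B\<^esub> inv_arr B (\<eta> X)"
      by (simp add: \<eta>.F.B.Comp_assoc)
    finally show "inv_arr B (\<eta> Y) \<cdot>\<^bsub>B\<^esub> FArr G f = FArr F f \<cdot>\<^bsub>B\<^esub> inv_arr B (\<eta> X)" .
  next
    fix X Y assume [simp]: "X \<in> Ob A" "Y \<in> Ob A"
    let ?XY = "X \<otimes>\<^sub>o\<^bsub>A\<^esub> Y" and ?i = "inv_arr B (\<eta> X) \<otimes>\<^sub>a\<^bsub>B\<^esub> inv_arr B (\<eta> Y)"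
    have "inv_arr B (\<eta> ?XY) \<cdot>\<^bsub>B\<^esub> FMu G X Y = inv_arr B (\<eta> ?XY) \<cdot>\<^bsub>B\<^esub> ((FMu G X Y \<cdot>\<^bsub>B\<^esub> (\<eta> X \<otimes>\<^sub>a\<^bsub>B\<^esub> \<eta> Y)) \<cdot>\<^bsub>B\<^esub> ?i)"
      by (simp add: \<eta>.F.B.Comp_assoc \<eta>.F.B.Ten_Comp)
    also have "FMu G X Y \<cdot>\<^bsub>B\<^esub> (\<eta> X \<otimes>\<^sub>a\<^bsub>B\<^esub> \<eta> Y) = \<eta> ?XY \<cdot>\<^bsub>B\<^esub> FMu F X Y"
      by (simp add: \<eta>.monoidal)
    also have "inv_arr B (\<eta> ?XY) \<cdot>\<^bsub>B\<^esub> (\<eta> ?XY \<cdot>\<^bsub>B\<^esub> FMu F X Y \<cdot>\<^bsub>B\<^esub> ?i) = FMu F X Y \<cdot>\<^bsub>B\<^esub> ?i"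
      by (simp add: \<eta>.F.B.Comp_assoc)
    finally show "inv_arr B (\<eta> ?XY) \<cdot>\<^bsub>B\<^esub> FMu G X Y = FMu F X Y \<cdot>\<^bsub>B\<^esub> ?i" .
  next
    show "inv_arr B (\<eta> (Unit A)) \<cdot>\<^bsub>B\<^esub> FEps G = FEps F"
      by (simp flip: \<eta>.unital)
  qed (simp_all add: Hom_iff \<eta>.F.B.is_iso_inv_arr)
qed

section \<open>Exact tensor functors and the arrows they kill\<close>

context exact_tensor_functor
begin

text \<open>Exactness speaks of short exact sequences only; a mono becomes part of one by adjoining
  its cokernel.\<close>

lemma FArr_mono:
  assumes "is_mono A m" shows "is_mono B (FArr F m)"
proof -
  have "m \<in> Arr A" using assms by (simp add: is_mono_def)
  then obtain c where c: "is_cokernel A c m" using A.has_cokernel by blast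
  show ?thesis
    using exact[OF A.mono_kernel_of_cokernel[OF assms c] c] B.is_kernelD(5) by blast
qed

lemma FArr_epi:
  assumes "is_epi A p" shows "is_epi B (FArr F p)"
proof -
  have "p \<in> Arr A" using assms by (simp add: is_epi_def)
  then obtain k where k: "is_kernel A k p" using A.has_kernel by blast
  show ?thesis
    using exact[OF k A.epi_cokernel_of_kernel[OF assms k]] B.is_cokernelD(5) by blast
qed

lemma FArr_epi_part_Zero:
  assumes "is_mono A m" "p \<in> Arr A" "Dom A m = Cod A p"
    "FArr F (m \<cdot>\<^bsub>A\<^esub> p) = Zero B (FOb F (Dom A p)) (FOb F (Cod A m))"
  shows "FArr F p = Zero B (FOb F (Dom A p)) (FOb F (Cod A p))"
proof -
  have m: "m \<in> Arr A" using assms(1) by (simp add: is_mono_def)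
  then have "FArr F m \<cdot>\<^bsub>B\<^esub> FArr F p = Zero B (Dom B (FArr F p)) (Cod B (FArr F m))"
    using assms by (simp flip: FArr_Comp)
  from B.is_mono_Zero[OF FArr_mono[OF assms(1)] _ _ this] show ?thesis
    using m assms by simp
qed

text \<open>The idempotent is the support of the image of \<open>f\<close>: if \<open>F\<close> kills \<open>f\<close>, it kills the image \<open>I\<close>
  of \<open>f\<close>, hence \<open>1 \<rightarrow> D \<otimes> I\<close> and the complement of its kernel.\<close>

lemma Zero_FArr_annihilated:
  assumes f: "f \<in> Arr A" and 0: "FArr F f = Zero B (FOb F (Dom A f)) (FOb F (Cod A f))"
  obtains e where "e \<in> scalars A" "e \<cdot>\<^bsub>A\<^esub> e = e" "FZ e = Zero B (Unit B) (Unit B)"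
    "Sub A (Id A (Unit A)) e \<star>\<^bsub>A\<^esub> f = Zero A (Dom A f) (Cod A f)"
proof -
  let ?E = "Id A (Unit A)"
  obtain m p where mp: "f = m \<cdot>\<^bsub>A\<^esub> p" "is_mono A m" "is_epi A p" "Dom A m = Cod A p"
    "Dom A p = Dom A f" "Cod A m = Cod A f"
    using A.image_factorization[OF f] by metis
  have [simp]: "m \<in> Arr A" "p \<in> Arr A" using mp by (simp_all add: is_mono_def is_epi_def)
  define X where "X = Cod A p"
  have X [simp]: "X \<in> Ob A" by (simp add: X_def)
  have Fp: "FArr F p = Zero B (FOb F (Dom A p)) (FOb F X)"
    unfolding X_def using FArr_epi_part_Zero[OF mp(2) _ mp(4)] 0[unfolded mp(1)] mp(4) by simp
  \<comment> \<open>\<open>F p\<close> is epi and zero, so the identity of its target is zero as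
    well.\<close>
  have "Id B (FOb F X) \<cdot>\<^bsub>B\<^esub> FArr F p = Zero B (FOb F X) (FOb F X) \<cdot>\<^bsub>B\<^esub> FArr F p"
    using Fp by (simp add: X_def)
  then have FX: "Id B (FOb F X) = Zero B (FOb F X) (FOb F X)"
    by (rule B.is_epiD[OF FArr_epi[OF mp(3)]]) (simp_all add: X_def)
  obtain D ev coev where d: "is_dual A X D ev coev" using A.rigid[OF X] by blast
  note [simp] = A.is_dualD(1-8)[OF d]
  have "FArr F (Id A D \<otimes>\<^sub>a\<^bsub>A\<^esub> Id A X) \<cdot>\<^bsub>B\<^esub> FMu F D X
    = FMu F D X \<cdot>\<^bsub>B\<^esub> (FArr F (Id A D) \<otimes>\<^sub>a\<^bsub>B\<^esub> FArr F (Id A X))"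
    using FMu_natural[of "Id A D" "Id A X"] by simp
  also have "\<dots> = Zero B (FOb F D \<otimes>\<^sub>o\<^bsub>B\<^esub> FOb F X) (FOb F (D \<otimes>\<^sub>o\<^bsub>A\<^esub> X))"
    by (simp add: FX B.Ten_Zero)
  finally have "Id B (FOb F (D \<otimes>\<^sub>o\<^bsub>A\<^esub> X)) \<cdot>\<^bsub>B\<^esub> FMu F D X
    = Zero B (Dom B (FMu F D X)) (Cod B (Id B (FOb F (D \<otimes>\<^sub>o\<^bsub>A\<^esub> X))))"
    by simp
  from B.is_epi_Zero[OF B.iso_is_epi _ _ this]
  have DX: "Id B (FOb F (D \<otimes>\<^sub>o\<^bsub>A\<^esub> X)) = Zero B (FOb F (D \<otimes>\<^sub>o\<^bsub>A\<^esub> X)) (FOb F (D \<otimes>\<^sub>o\<^bsub>A\<^esub> X))"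
    by simp
  have "FArr F coev = Id B (FOb F (D \<otimes>\<^sub>o\<^bsub>A\<^esub> X)) \<cdot>\<^bsub>B\<^esub> FArr F coev" by simp
  then have Fc: "FArr F coev = Zero B (FOb F (Unit A)) (FOb F (D \<otimes>\<^sub>o\<^bsub>A\<^esub> X))"
    unfolding DX by simp
  obtain k q n where kq: "coev = n \<cdot>\<^bsub>A\<^esub> q" "is_mono A n" "Dom A n = Cod A q" "Dom A q = Unit A"
    "Cod A n = D \<otimes>\<^sub>o\<^bsub>A\<^esub> X" "is_kernel A k coev" "is_cokernel A q k"
    using A.image_factorization[of coev] by (metis \<open>coev \<in> Arr A\<close> \<open>Dom A coev = Unit A\<close> \<open>Cod A coev = D \<otimes>\<^sub>o\<^bsub>A\<^esub> X\<close>)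
  have [simp]: "n \<in> Arr A" "q \<in> Arr A" using kq A.is_cokernelD by (auto simp: is_mono_def)
  note k [simp] = A.is_kernelD(2)[OF kq(6)] A.is_kernelD(3)[OF kq(6), simplified]
  have Fq: "FArr F q = Zero B (FOb F (Unit A)) (FOb F (Cod A q))"
    using FArr_epi_part_Zero[OF kq(2) _ kq(3)] Fc[unfolded kq(1)] kq(4,5) by simp
  obtain r where r [simp]: "r \<in> Arr A" "Dom A r = Unit A" "Cod A r = Dom A k" "r \<cdot>\<^bsub>A\<^esub> k = Id A (Dom A k)"
    using A.mono_into_unit_split[OF A.is_kernelD(5)[OF kq(6)]] by auto
  \<comment> \<open>The projector complementary to the kernel of \<open>coev\<close>, that is, onto
    the support of the image of \<open>f\<close>.\<close>
  define e where "e = Sub A ?E (k \<cdot>\<^bsub>A\<^esub> r)"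
  have e: "e \<in> scalars A" by (intro scalarsI) (simp_all add: e_def)
  have ek: "e \<cdot>\<^bsub>A\<^esub> k = Zero A (Dom A k) (Unit A)"
    by (simp add: e_def A.Sub_Comp A.Comp_assoc A.Sub_eq_Zero_iff)
  have kr: "k \<cdot>\<^bsub>A\<^esub> r \<in> scalars A" by (intro scalarsI) simp_all
  have e1: "Sub A ?E e = k \<cdot>\<^bsub>A\<^esub> r"
  proof -
    have "e \<oplus>\<^sub>a\<^bsub>A\<^esub> k \<cdot>\<^bsub>A\<^esub> r = ?E" by (simp add: e_def A.Sub_Add)
    then show ?thesis using e kr by (simp add: A.Sub_eq_iff)
  qed
  have "e \<cdot>\<^bsub>A\<^esub> Sub A ?E e = Zero A (Unit A) (Unit A)"
    unfolding e1 using e ek A.Comp_assoc_eq[OF ek, of r] by simp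
  then have ee: "e \<cdot>\<^bsub>A\<^esub> e = e" using e by (simp add: A.Comp_Sub A.Sub_eq_Zero_iff)
  \<comment> \<open>\<open>e\<close> kills the kernel of \<open>coev\<close>, so it factors through
    the epi part \<open>q\<close> of \<open>coev\<close>, which \<open>F\<close> kills.\<close>
  obtain e' where e': "e' \<in> Arr A" "Cod A e' = Unit A" "Dom A e' = Cod A q" "e' \<cdot>\<^bsub>A\<^esub> q = e"
    using A.is_cokernel_factor[OF kq(7), of e] e ek by auto
  have "FArr F e = Zero B (FOb F (Unit A)) (FOb F (Unit A))"
    using FArr_Comp[of q e'] e' Fq kq(4) by simp
  then have Fe: "FZ e = Zero B (Unit B) (Unit B)" using FZ_Zero_iff[OF e] by simp
  have "coev \<cdot>\<^bsub>A\<^esub> (k \<cdot>\<^bsub>A\<^esub> r) = Zero A (Unit A) (D \<otimes>\<^sub>o\<^bsub>A\<^esub> X)"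
    using A.Comp_assoc_eq[OF A.is_kernelD(4)[OF kq(6)], of r] by simp
  then have "(k \<cdot>\<^bsub>A\<^esub> r) \<star>\<^bsub>A\<^esub> Id A X = Zero A X X"
    using A.coev_scalar_Zero_iff[OF d kr] by simp
  moreover have "(k \<cdot>\<^bsub>A\<^esub> r) \<star>\<^bsub>A\<^esub> f = m \<cdot>\<^bsub>A\<^esub> (((k \<cdot>\<^bsub>A\<^esub> r) \<star>\<^bsub>A\<^esub> Id A X) \<cdot>\<^bsub>A\<^esub> p)"
    using kr mp(4) by (simp add: A.scal_Comp_left A.scal_Comp_right X_def mp(1))
  ultimately have "(k \<cdot>\<^bsub>A\<^esub> r) \<star>\<^bsub>A\<^esub> f = Zero A (Dom A f) (Cod A f)"
    using mp(4-6) f X by (simp add: X_def)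
  with e ee Fe show thesis by (intro that[of e]) (simp_all add: e1)
qed

end

section \<open>The spectrum and quotients by ideals\<close>

lemma (in cring) ideal_in_maximalideal:
  assumes J: "ideal J R" and 1: "\<one> \<notin> J"
  obtains M where "maximalideal M R" "J \<subseteq> M"
proof -
  let ?A = "{I. ideal I R \<and> J \<subseteq> I \<and> \<one> \<notin> I}"
  have ch: "\<Union>C \<in> ?A" if C: "C \<noteq> {}" "subset.chain ?A C" for C
  proof -
    have "subset.chain {I. ideal I R} C"
      using C(2) by (auto simp: pred_on.chain_def)
    from chain_Union_is_ideal[OF this] C(1) have "ideal (\<Union>C) R" by simp
    then show ?thesis using C by (auto simp: pred_on.chain_def)
  qed
  have ne: "?A \<noteq> {}" using J 1 by auto
  have "\<exists>M \<in> ?A. \<forall>I \<in> ?A. M \<subseteq> I \<longrightarrow> I = M"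
    by (rule subset_Zorn_nonempty[OF ne ch])
  then obtain M where M: "M \<in> ?A" "\<forall>I \<in> ?A. M \<subseteq> I \<longrightarrow> I = M" by (rule bexE)
  have "maximalideal M R"
  proof (rule maximalidealI)
    fix I assume I: "ideal I R" "M \<subseteq> I" "I \<subseteq> carrier R"
    show "I = M \<or> I = carrier R"
    proof (cases "\<one> \<in> I")
      case False
      with M(1) I have "I \<in> ?A" by auto
      with M(2) I(2) show ?thesis by blast
    qed (simp add: ideal.one_imp_carrier[OF I(1)])
  qed (use M in auto)
  moreover have "J \<subseteq> M" using M(1) by simp
  ultimately show thesis by (rule that)
qed

text \<open>The elements whose basic open set \<open>D x\<close> is covered by finitely many members of \<open>\<U>\<close> form an
  ideal, which is contained in no prime ideal.\<close>

lemma compact_space_zariski: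
  fixes R (structure)
  assumes "cring R"
  shows "compact_space (zariski R)"
  unfolding compact_space_alt
proof (intro allI impI, elim conjE)
  interpret cring R by fact
  fix \<U> assume op: "\<forall>U \<in> \<U>. openin (zariski R) U" and cov: "topspace (zariski R) \<subseteq> \<Union>\<U>"
  define cvd where "cvd x \<longleftrightarrow> (\<exists>\<F>. finite \<F> \<and> \<F> \<subseteq> \<U> \<and> (\<forall>P. primeideal P R \<longrightarrow> x \<notin> P \<longrightarrow> P \<in> \<Union>\<F>))" for x
  have cvd_mono: "cvd x"
    if "cvd y" "\<And>P. primeideal P R \<Longrightarrow> x \<notin> P \<Longrightarrow> y \<notin> P" for x y
    using that unfolding cvd_def by meson
  have cvd_add: "cvd (x \<oplus> y)" if xy: "cvd x" "cvd y" for x y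
  proof -
    obtain \<F> \<G> where "finite \<F>" "\<F> \<subseteq> \<U>" "finite \<G>" "\<G> \<subseteq> \<U>"
      "\<And>P. primeideal P R \<Longrightarrow> x \<notin> P \<Longrightarrow> P \<in> \<Union>\<F>" "\<And>P. primeideal P R \<Longrightarrow> y \<notin> P \<Longrightarrow> P \<in> \<Union>\<G>"
      using xy unfolding cvd_def by metis
    moreover have "x \<notin> P \<or> y \<notin> P" if "primeideal P R" "x \<oplus> y \<notin> P" for P
      using that additive_subgroup.a_closed[of P R] primeideal.axioms(1)[of P R] ideal.axioms(1)[of P R]
      by blast
    ultimately have "finite (\<F> \<union> \<G>)" "\<F> \<union> \<G> \<subseteq> \<U>"
      "\<And>P. primeideal P R \<Longrightarrow> x \<oplus> y \<notin> P \<Longrightarrow> P \<in> \<Union>(\<F> \<union> \<G>)"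
      unfolding Union_Un_distrib by blast+
    then show ?thesis unfolding cvd_def by (intro exI[of _ "\<F> \<union> \<G>"]) simp
  qed
  define J where "J = {x \<in> carrier R. cvd x}"
  have zero: "\<zero> \<in> J"
  proof -
    have "\<zero> \<in> P" if "primeideal P R" for P
      using additive_subgroup.zero_closed[OF ideal.axioms(1)[OF primeideal.axioms(1)[OF that]]] .
    then have "cvd \<zero>" unfolding cvd_def by (intro exI[of _ "{}"]) simp
    then show ?thesis by (simp add: J_def)
  qed
  have mult: "x \<otimes> a \<in> J" if "a \<in> J" "x \<in> carrier R" for a x
  proof -
    have "a \<notin> P" if "primeideal P R" "x \<otimes> a \<notin> P" for P
      using that ideal.I_l_closed[OF primeideal.axioms(1)[OF that(1)], of a x] \<open>x \<in> carrier R\<close> by blast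
    then have "cvd (x \<otimes> a)" using cvd_mono[of a "x \<otimes> a"] \<open>a \<in> J\<close> by (simp add: J_def)
    then show ?thesis using that by (simp add: J_def)
  qed
  have "ideal J R"
  proof (rule idealI)
    show "subgroup J (add_monoid R)"
    proof (rule group.subgroupI[OF a_group])
      fix a assume "a \<in> J"
      then have "\<ominus> \<one> \<otimes> a \<in> J" "a \<in> carrier R" using mult by (simp_all add: J_def)
      then have "\<ominus> a \<in> J" using l_minus[of \<one> a] by simp
      then show "inv\<^bsub>add_monoid R\<^esub> a \<in> J" by (simp add: a_inv_def)
    qed (use zero cvd_add in \<open>auto simp: J_def\<close>)
    show "a \<otimes> x \<in> J" if "a \<in> J" "x \<in> carrier R" for a x
      using mult[OF that] that m_comm[of a x] by (simp add: J_def)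
  qed (use mult ring_axioms in auto)
  have "\<one> \<in> J"
  proof (rule ccontr)
    assume "\<one> \<notin> J"
    then obtain M where M: "maximalideal M R" "J \<subseteq> M"
      using ideal_in_maximalideal \<open>ideal J R\<close> by blast
    have P: "primeideal M R" by (rule maximalideal_prime[OF M(1)])
    then obtain U where U: "U \<in> \<U>" "M \<in> U" using cov by (auto simp: topspace_zariski)
    have "openin (zariski R) U" using op U(1) by (rule bspec)
    then obtain I where I: "I \<subseteq> carrier R" "U = prime_nonvanishing R I"
      unfolding openin_zariski_iff by (elim exE conjE)
    then obtain x where x: "x \<in> I" "x \<notin> M" using U by (auto simp: prime_nonvanishing_def)
    \<comment> \<open>The basic open set of \<open>x\<close> lies inside the single member
      \<open>U\<close>, because \<open>x\<close> is one of the elements defining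
      \<open>U\<close>.\<close>
    have "cvd x"
      unfolding cvd_def using U x I by (intro exI[of _ "{U}"]) (auto simp: prime_nonvanishing_def)
    then show False using x I M by (auto simp: J_def)
  qed
  then obtain \<F> where F: "finite \<F>" "\<F> \<subseteq> \<U>" "\<And>P. primeideal P R \<Longrightarrow> \<one> \<notin> P \<Longrightarrow> P \<in> \<Union>\<F>"
    unfolding J_def cvd_def by blast
  moreover have "\<one> \<notin> P" if "primeideal P R" for P
    using that ideal.one_imp_carrier[of P R] primeideal.axioms(1)[OF that] primeideal.I_notcarr[OF that] by blast
  ultimately show "\<exists>\<F>. finite \<F> \<and> \<F> \<subseteq> \<U> \<and> topspace (zariski R) \<subseteq> \<Union>\<F>"
    by (intro exI[of _ \<F>]) (auto simp: topspace_zariski)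
qed

text \<open>The idempotents that become 1 modulo \<open>M\<close>. For a prime ideal these are the
  idempotents outside it.\<close>

definition unit_idems :: "('o, 'm) tcat \<Rightarrow> 'm set \<Rightarrow> 'm set" where
  "unit_idems A M = {w \<in> scalars A. w \<cdot>\<^bsub>A\<^esub> w = w \<and> Sub A (Id A (Unit A)) w \<in> M}"

lemma unit_idemsI:
  "w \<in> scalars A \<Longrightarrow> w \<cdot>\<^bsub>A\<^esub> w = w \<Longrightarrow> Sub A (Id A (Unit A)) w \<in> M \<Longrightarrow> w \<in> unit_idems A M"
  by (simp add: unit_idems_def)

context rigid_abelian_category
begin

lemma ideal_simps:
  assumes "ideal M (Z_ring A)"
  shows "z \<in> M \<Longrightarrow> z \<in> scalars A" "Zero A (Unit A) (Unit A) \<in> M"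
    "z \<in> M \<Longrightarrow> w \<in> M \<Longrightarrow> z \<oplus>\<^sub>a w \<in> M" "z \<in> M \<Longrightarrow> w \<in> scalars A \<Longrightarrow> w \<cdot> z \<in> M"
    "z \<in> M \<Longrightarrow> w \<in> scalars A \<Longrightarrow> z \<cdot> w \<in> M"
proof -
  interpret ideal M "Z_ring A" by fact
  show "z \<in> M \<Longrightarrow> z \<in> scalars A" using a_subset by auto
  show "Zero A (Unit A) (Unit A) \<in> M" using additive_subgroup.zero_closed[OF is_additive_subgroup] by simp
  show "z \<in> M \<Longrightarrow> w \<in> M \<Longrightarrow> z \<oplus>\<^sub>a w \<in> M" 
    using additive_subgroup.a_closed[OF is_additive_subgroup, of z w] by simp
  show "z \<in> M \<Longrightarrow> w \<in> scalars A \<Longrightarrow> w \<cdot> z \<in> M" using I_l_closed[of z w] by simp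
  show "z \<in> M \<Longrightarrow> w \<in> scalars A \<Longrightarrow> z \<cdot> w \<in> M" using I_r_closed[of z w] by simp
qed

lemma complement_idem:
  assumes "e \<in> scalars A" "e \<cdot> e = e"
  defines "w \<equiv> Sub A (Id A (Unit A)) e"
  shows "w \<in> scalars A" "w \<cdot> w = w" "w \<cdot> e = Zero A (Unit A) (Unit A)"
    "e \<cdot> w = Zero A (Unit A) (Unit A)" "Sub A (Id A (Unit A)) w = e" "w \<oplus>\<^sub>a e = Id A (Unit A)"
proof -
  show w: "w \<in> scalars A" unfolding w_def using assms(1) by simp
  show we: "w \<cdot> e = Zero A (Unit A) (Unit A)"
    unfolding w_def using assms(1,2) by (simp add: Sub_Comp Sub_eq_Zero_iff)
  then show "e \<cdot> w = Zero A (Unit A) (Unit A)" using scalars_commute[OF w assms(1)] by simp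
  have "w \<cdot> w = Sub A w (w \<cdot> e)"
    by (subst (2) w_def) (use w assms(1) in \<open>simp add: Comp_Sub\<close>)
  then show "w \<cdot> w = w" unfolding we using w by (simp add: Sub_eq_iff)
  show s: "w \<oplus>\<^sub>a e = Id A (Unit A)" unfolding w_def using assms(1) by (simp add: Sub_Add)
  show "Sub A (Id A (Unit A)) w = e" using s w assms(1) by (simp add: Sub_eq_iff)
qed

text \<open>For \<open>z = z x z\<close> in the ideal, \<open>e = x z\<close> is an idempotent of
  the ideal with \<open>e z = z\<close>, so \<open>1 - e\<close> kills \<open>z\<close>. Conversely,
  \<open>w z = 0\<close> gives \<open>z = (1 - w) z\<close>. Thus inverting these idempotents kills
  exactly \<open>M\<close>.\<close>

lemma mem_ideal_iff:
  assumes M: "ideal M (Z_ring A)" and z: "z \<in> scalars A"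
  shows "z \<in> M \<longleftrightarrow> (\<exists>w \<in> unit_idems A M. w \<cdot> z = Zero A (Unit A) (Unit A))"
proof
  assume zM: "z \<in> M"
  obtain x where x: "x \<in> scalars A" "z \<cdot> (x \<cdot> z) = z" using scalar_regular[OF z] .
  define e where "e = x \<cdot> z"
  have e: "e \<in> scalars A" "e \<in> M" using x z ideal_simps(4)[OF M zM] by (simp_all add: e_def)
  have ee: "e \<cdot> e = e" using x z by (simp add: e_def Comp_assoc)
  note w = complement_idem[OF e(1) ee]
  have "e \<cdot> z = z" using x z scalars_commute[of "x \<cdot> z" z] by (simp add: e_def)
  then have "Sub A (Id A (Unit A)) e \<cdot> z = Zero A (Unit A) (Unit A)"
    using e z by (simp add: Sub_Comp Sub_eq_Zero_iff)
  then show "\<exists>w \<in> unit_idems A M. w \<cdot> z = Zero A (Unit A) (Unit A)"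
    using w e by (intro bexI[of _ "Sub A (Id A (Unit A)) e"]) (simp_all add: unit_idems_def)
next
  assume "\<exists>w \<in> unit_idems A M. w \<cdot> z = Zero A (Unit A) (Unit A)"
  then obtain w where w: "w \<in> scalars A" "w \<cdot> w = w" "Sub A (Id A (Unit A)) w \<in> M"
    "w \<cdot> z = Zero A (Unit A) (Unit A)" by (auto simp: unit_idems_def)
  have "Sub A (Id A (Unit A)) w \<cdot> z = z"
    using w z by (simp add: Sub_Comp Sub_eq_iff)
  then show "z \<in> M" using ideal_simps(5)[OF M w(3) z] by simp
qed

text \<open>The description of the Serre subcategory comes from \<open>mem_ideal_iff\<close> applied
  to the idempotent \<open>e(X)\<close>, because \<open>e(X)\<close> and \<open>X\<close> are killed
  by the same scalars.\<close>

lemma scalar_localization_ideal: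
  assumes M: "ideal M (Z_ring A)"
  shows "scalar_localization A (unit_idems A M) (supp_subcat A M)"
proof (intro scalar_localization.intro scalar_localization_axioms.intro rigid_abelian_category_axioms)
  let ?I = "Id A (Unit A)"
  show "?I \<in> unit_idems A M"
  proof -
    have "Sub A ?I ?I = Zero A (Unit A) (Unit A)" by (simp add: Sub_eq_Zero_iff)
    then show ?thesis using ideal_simps(2)[OF M] by (simp add: unit_idems_def)
  qed
  fix v w assume "v \<in> unit_idems A M" "w \<in> unit_idems A M"
  then have vw: "v \<in> scalars A" "v \<cdot> v = v" "Sub A ?I v \<in> M"
    "w \<in> scalars A" "w \<cdot> w = w" "Sub A ?I w \<in> M"
    by (auto simp: unit_idems_def)
  have "(v \<cdot> w) \<cdot> (v \<cdot> w) = v \<cdot> ((w \<cdot> v) \<cdot> w)" using vw(1,4) by (simp add: Comp_assoc)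
  also have "w \<cdot> v = v \<cdot> w" using scalars_commute vw by blast
  also have "v \<cdot> ((v \<cdot> w) \<cdot> w) = (v \<cdot> v) \<cdot> (w \<cdot> w)" using vw(1,4) by (simp add: Comp_assoc)
  finally have idem: "(v \<cdot> w) \<cdot> (v \<cdot> w) = v \<cdot> w" using vw by simp
  \<comment> \<open>Derives \<open>1 - v w = (1 - v) + v (1 - w)\<close>, which lies in the
    ideal.\<close>
  have "Sub A ?I v \<oplus>\<^sub>a v \<cdot> Sub A ?I w \<oplus>\<^sub>a v \<cdot> w = Sub A ?I v \<oplus>\<^sub>a v"
    using vw(1,4) by (simp add: Add_assoc Comp_Sub Sub_Add)
  also have "\<dots> = ?I" using vw(1) by (simp add: Sub_Add)
  finally have "Sub A ?I (v \<cdot> w) = Sub A ?I v \<oplus>\<^sub>a v \<cdot> Sub A ?I w"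
    using vw(1,4) by (simp add: Sub_eq_iff Add_commute)
  then have "Sub A ?I (v \<cdot> w) \<in> M"
    using ideal_simps(3)[OF M vw(3)] ideal_simps(4)[OF M vw(6,1)] by simp
  then show "v \<cdot> w \<in> unit_idems A M" using vw(1,4) idem by (simp add: unit_idems_def)
next
  fix X
  show "X \<in> supp_subcat A M \<longleftrightarrow> X \<in> Ob A \<and> (\<exists>w \<in> unit_idems A M. w \<star> Id A X = Zero A X X)"
  proof (cases "X \<in> Ob A")
    case True
    let ?e = "supp_idem A X"
    have e: "?e \<in> scalars A"
      "\<And>w. w \<in> scalars A \<Longrightarrow> w \<cdot> ?e = Zero A (Unit A) (Unit A) \<longleftrightarrow> w \<star> Id A X = Zero A X X"
      using annihilator_idem_supp_idem[OF True] True by (simp_all add: annihilator_idem_def)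
    have "w \<in> scalars A" if "w \<in> unit_idems A M" for w using that by (simp add: unit_idems_def)
    then show ?thesis
      using True mem_ideal_iff[OF M e(1)] e(2) by (auto simp: supp_subcat_def)
  qed (simp add: supp_subcat_def)
qed (simp_all add: unit_idems_def)

text \<open>If \<open>z\<close> is in \<open>J\<close> but not in \<open>P\<close>, then
  \<open>z (1 - x z) = 0\<close> puts \<open>1 - x z\<close> into \<open>P\<close> and hence into
  \<open>J\<close>; adding \<open>x z\<close> gives 1 in \<open>J\<close>.\<close>

lemma primeideal_maximal:
  assumes "primeideal P (Z_ring A)"
  shows "maximalideal P (Z_ring A)"
proof -
  interpret P: primeideal P "Z_ring A" by fact
  show ?thesis
  proof (rule maximalidealI[OF P.is_ideal P.I_notcarr])
    fix J assume J: "ideal J (Z_ring A)" "P \<subseteq> J" "J \<subseteq> carrier (Z_ring A)"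
    show "J = P \<or> J = carrier (Z_ring A)"
    proof (rule disjCI)
      assume "J \<noteq> carrier (Z_ring A)"
      have "z \<in> P" if zJ: "z \<in> J" for z
      proof (rule ccontr)
        assume "z \<notin> P"
        have z: "z \<in> scalars A" using J(3) zJ by auto
        obtain x where x: "x \<in> scalars A" "z \<cdot> (x \<cdot> z) = z" using scalar_regular[OF z] .
        have e: "x \<cdot> z \<in> scalars A" "(x \<cdot> z) \<cdot> (x \<cdot> z) = x \<cdot> z"
          using x z by (simp_all add: Comp_assoc)
        note w = complement_idem[OF e]
        have "z \<cdot> Sub A (Id A (Unit A)) (x \<cdot> z) = Zero A (Unit A) (Unit A)"
          using x z by (simp add: Comp_Sub Sub_eq_Zero_iff)
        then have "Sub A (Id A (Unit A)) (x \<cdot> z) \<in> P"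
          using P.I_prime[of z "Sub A (Id A (Unit A)) (x \<cdot> z)"] z w(1) \<open>z \<notin> P\<close>
            ideal_simps(2)[OF P.is_ideal] by simp
        then have "Id A (Unit A) \<in> J"
          using ideal_simps(3)[OF J(1), of "Sub A (Id A (Unit A)) (x \<cdot> z)" "x \<cdot> z"]
            ideal_simps(4)[OF J(1) zJ x(1)] J(2) w(6) by auto
        then show False
          using ideal.one_imp_carrier[OF J(1)] \<open>J \<noteq> carrier (Z_ring A)\<close> by simp
      qed
      with J(2) show "J = P" by blast
    qed
  qed
qed

text \<open>Since the projection is full and kills exactly \<open>P\<close> on scalars, the
  endomorphism ring of the unit becomes \<open>Z\<close> modulo \<open>P\<close>. For
  \<open>z\<close> outside \<open>P\<close>, regularity gives \<open>1 - z x\<close> in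
  \<open>P\<close>, so the class of \<open>x\<close> inverts that of \<open>z\<close>.\<close>

lemma connected_ideal_quotient:
  assumes P: "primeideal P (Z_ring A)"
  shows "connected_rigid_abelian_category (ideal_quotient A P)"
proof -
  interpret P: primeideal P "Z_ring A" by fact
  interpret Q: scalar_localization A "unit_idems A P" "supp_subcat A P"
    by (rule scalar_localization_ideal[OF P.is_ideal])
  interpret B: rigid_abelian_category Q.AS by (rule Q.quot_rigid_abelian_category)
  let ?I = "Id A (Unit A)" and ?O = "Zero A (Unit A) (Unit A)"
  have sc: "scalars Q.AS = Q.Q ` scalars A"
    by (simp add: scalars_def Q.quot_Hom)
  have Q0: "Q.Q z = Q.Q ?O \<longleftrightarrow> z \<in> P" if "z \<in> scalars A" for z
  proof -
    have "Q.Q z = Q.Q ?O \<longleftrightarrow> (\<exists>w \<in> unit_idems A P. w \<star> z = ?O)"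
      using that by (intro Q.quot_Zero_iff) simp_all
    also have "\<dots> \<longleftrightarrow> (\<exists>w \<in> unit_idems A P. w \<cdot> z = ?O)"
      using that by (intro bex_cong refl) (simp add: scal_scalars)
    finally show ?thesis using mem_ideal_iff[OF P.is_ideal that] by simp
  qed
  interpret R: cring "Z_ring Q.AS" by (rule B.Z_ring_cring)
  have "field (Z_ring Q.AS)"
  proof (rule R.cring_fieldI2)
    have "?I \<notin> P" using P.I_notcarr ideal.one_imp_carrier[OF P.is_ideal] by auto
    then show "\<zero>\<^bsub>Z_ring Q.AS\<^esub> \<noteq> \<one>\<^bsub>Z_ring Q.AS\<^esub>" using Q0[of ?I] by auto
    fix a assume "a \<in> carrier (Z_ring Q.AS)" "a \<noteq> \<zero>\<^bsub>Z_ring Q.AS\<^esub>"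
    then obtain z where z: "z \<in> scalars A" "a = Q.Q z" "z \<notin> P" using Q0 by (auto simp: sc)
    obtain x where x: "x \<in> scalars A" "z \<cdot> (x \<cdot> z) = z" using scalar_regular[OF z(1)] .
    have xz: "z \<cdot> x \<in> scalars A" "(z \<cdot> x) \<cdot> (z \<cdot> x) = z \<cdot> x"
    proof -
      show "z \<cdot> x \<in> scalars A" using x z by simp
      have "(z \<cdot> x) \<cdot> (z \<cdot> x) = (z \<cdot> (x \<cdot> z)) \<cdot> x" using x(1) z(1) by (simp add: Comp_assoc)
      then show "(z \<cdot> x) \<cdot> (z \<cdot> x) = z \<cdot> x" using x(2) by simp
    qed
    note w = complement_idem[OF xz]
    have "z \<cdot> x \<cdot> z = z" using x z by (simp add: Comp_assoc)
    then have "Sub A ?I (z \<cdot> x) \<cdot> z = ?O"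
      using x(1) z(1) by (simp add: Sub_Comp Sub_eq_Zero_iff)
    then have "Sub A ?I (z \<cdot> x) \<in> P"
      using P.I_prime[of "Sub A ?I (z \<cdot> x)" z] z w(1) ideal_simps(2)[OF P.is_ideal] by simp
    then have W: "z \<cdot> x \<in> unit_idems A P" using xz by (intro unit_idemsI)
    have "Q.Q (z \<cdot> x) = Q.Q ?I"
      using Q.quot_scal[OF W, of ?I] xz(1) by (simp add: scal_Id_Unit)
    then show "\<exists>b \<in> carrier (Z_ring Q.AS). a \<otimes>\<^bsub>Z_ring Q.AS\<^esub> b = \<one>\<^bsub>Z_ring Q.AS\<^esub>"
      using x z by (intro bexI[of _ "Q.Q x"]) (simp_all add: sc)
  qed
  then show ?thesis
    unfolding ideal_quotient_def
    by (intro connected_rigid_abelian_category.intro connected_rigid_abelian_category_axioms.intro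
        B.rigid_abelian_category_axioms)
qed

end

section \<open>Factorization through the quotients\<close>

lemma (in exact_tensor_functor) kernel_ideal_prime:
  assumes "field (Z_ring B)"
  shows "primeideal {z \<in> scalars A. FZ z = Zero B (Unit B) (Unit B)} (Z_ring A)"
proof -
  interpret ZB: field "Z_ring B" by fact
  interpret ZA: cring "Z_ring A" by (rule A.Z_ring_cring)
  have "FZ \<in> ring_hom (Z_ring A) (Z_ring B)"
    by (rule ring_hom_memI) (simp_all add: FZ_Comp FZ_Add)
  then interpret h: ring_hom_ring "Z_ring A" "Z_ring B" FZ
    by (rule ring_hom_ringI2[OF ZA.ring_axioms ZB.ring_axioms])
  have "ideal (a_kernel (Z_ring A) (Z_ring B) FZ) (Z_ring A)" by (rule h.kernel_is_ideal)
  then have "ideal {z \<in> scalars A. FZ z = Zero B (Unit B) (Unit B)} (Z_ring A)"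
    unfolding a_kernel_def' Z_ring_simps .
  then show ?thesis
  proof (rule primeidealI[OF _ ZA.is_cring])
    show "carrier (Z_ring A) \<noteq> {z \<in> scalars A. FZ z = Zero B (Unit B) (Unit B)}"
    proof
      assume "carrier (Z_ring A) = {z \<in> scalars A. FZ z = Zero B (Unit B) (Unit B)}"
      then have "FZ (Id A (Unit A)) = Zero B (Unit B) (Unit B)"
        using A.scalars_simps(1) by fastforce
      then show False using ZB.one_not_zero by simp
    qed
    fix a b assume "a \<in> carrier (Z_ring A)" "b \<in> carrier (Z_ring A)"
      "a \<otimes>\<^bsub>Z_ring A\<^esub> b \<in> {z \<in> scalars A. FZ z = Zero B (Unit B) (Unit B)}"
    then show "a \<in> {z \<in> scalars A. FZ z = Zero B (Unit B) (Unit B)} \<or>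
        b \<in> {z \<in> scalars A. FZ z = Zero B (Unit B) (Unit B)}"
      using ZB.integral[of "FZ a" "FZ b"] by (auto simp: FZ_Comp)
  qed
qed

text \<open>The first condition makes \<open>F\<close> well defined on classes; the second makes the
  induced functor faithful.\<close>

locale localization_factor = scalar_localization A W S + exact_tensor_functor A B F
  for A :: "('o, 'm) tcat" and W S and B :: "('p, 'q) tcat" and F +
  assumes FZ_W: "w \<in> W \<Longrightarrow> FZ w = Id B (Unit B)"
    and F_Zero: "f \<in> Arr A \<Longrightarrow> FArr F f = Zero B (FOb F (Dom A f)) (FOb F (Cod A f))
      \<Longrightarrow> \<exists>w \<in> W. w \<star>\<^bsub>A\<^esub> f = Zero A (Dom A f) (Cod A f)"
begin

lemma FArr_cong:
  assumes "cong f g" shows "FArr F f = FArr F g"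
proof -
  obtain w where w: "w \<in> W" "w \<star>\<^bsub>A\<^esub> f = w \<star>\<^bsub>A\<^esub> g" using assms by (rule congE)
  note t = congD[OF assms]
  have "FArr F (w \<star>\<^bsub>A\<^esub> f) = FArr F (w \<star>\<^bsub>A\<^esub> g)" using w by simp
  then show ?thesis using w(1) t by (simp add: FArr_scal FZ_W)
qed

lemma FArr_eq_iff_cong:
  assumes "f \<in> Arr A" "g \<in> Arr A" "Dom A g = Dom A f" "Cod A g = Cod A f"
  shows "FArr F f = FArr F g \<longleftrightarrow> cong f g"
proof
  assume "FArr F f = FArr F g"
  then have "FArr F (Sub A f g) = Zero B (FOb F (Dom A (Sub A f g))) (FOb F (Cod A (Sub A f g)))"
    using assms by (simp add: FArr_Sub B.Sub_eq_Zero_iff)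
  then obtain w where w: "w \<in> W" "w \<star>\<^bsub>A\<^esub> Sub A f g = Zero A (Dom A f) (Cod A f)"
    using F_Zero[of "Sub A f g"] assms by auto
  then have "w \<star>\<^bsub>A\<^esub> f = w \<star>\<^bsub>A\<^esub> g"
    using assms by (simp add: scal_Sub Sub_eq_Zero_iff)
  then show "cong f g" using w(1) assms by (intro congI) simp_all
qed (rule FArr_cong)

definition factor where
  "factor = \<lparr>FOb = FOb F, FArr = (\<lambda>c. FArr F (SOME f. f \<in> Arr A \<and> Q f = c)),
     FMu = FMu F, FEps = FEps F\<rparr>"

lemma factor_simps [simp]:
  "FOb factor X = FOb F X" "FMu factor X Y = FMu F X Y" "FEps factor = FEps F"
  by (simp_all add: factor_def)

lemma factor_quot [simp]:
  assumes "f \<in> Arr A" shows "FArr factor (Q f) = FArr F f"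
proof -
  define g where "g = (SOME g. g \<in> Arr A \<and> Q g = Q f)"
  have "g \<in> Arr A \<and> Q g = Q f" unfolding g_def by (rule someI[of _ f]) (simp add: assms)
  then have "cong g f" using assms quot_arr_eq_iff by blast
  then show ?thesis by (simp add: factor_def g_def FArr_cong)
qed

lemma factor_tensor_functor: "tensor_functor AS B factor"
  by (intro tensor_functor.intro tensor_functor_axioms.intro quot_tensor_category
      B.tensor_category_axioms)
    (auto simp: quot_Hom Hom_iff FArr_Comp FArr_Add FMu_natural mu_assoc mu_lunit mu_runit mu_sym)

text \<open>A short exact sequence of the quotient is isomorphic to the image of one of
  \<open>A\<close>: lift the epi, take the kernel of the lift, and use the epi part of the lift.
  Exactness of \<open>F\<close> applies to this sequence, and the isomorphisms do no harm.\<close>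

lemma factor_exact: "exact_tensor_functor AS B factor"
proof (intro exact_tensor_functor.intro exact_tensor_functor_axioms.intro factor_tensor_functor
    quot_rigid_abelian_category B.rigid_abelian_category_axioms)
  interpret AS: rigid_abelian_category AS by (rule quot_rigid_abelian_category)
  interpret H: tensor_functor AS B factor by (rule factor_tensor_functor)
  fix k' p' assume k': "is_kernel AS k' p'" and p': "is_cokernel AS p' k'"
  note k't = AS.is_kernelD[OF k'] and p't = AS.is_cokernelD[OF p']
  obtain p where p: "p \<in> Arr A" "p' = Q p" using k't by auto
  \<comment> \<open>The lift \<open>p\<close> of an epi may fail to be epi in \<open>A\<close>, so
    it is replaced by its epi part \<open>c\<close>, which has the same kernel.\<close>
  obtain k c m where f: "p = m \<cdot>\<^bsub>A\<^esub> c" "is_kernel A k p" "is_kernel A k c" "is_cokernel A c k"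
    using image_factorization[OF p(1)] by metis
  note kt = is_kernelD[OF f(3)] and ct = is_cokernelD[OF f(4)]
  obtain b where b: "is_iso AS b" "Dom AS b = Dom AS k'" "Cod AS b = Dom AS (Q k)" "k' = Q k \<cdot>\<^bsub>AS\<^esub> b"
    using AS.is_kernel_unique[OF quot_is_kernel[OF f(2)]] k' unfolding p(2) by metis
  have bA: "b \<in> Arr AS" using b(1) by (rule AS.is_iso_Arr)
  have "is_cokernel AS p' (Q k)"
    using AS.is_cokernel_cancel_epi[OF p'[unfolded b(4)] AS.iso_is_epi[OF b(1)]] b(3) kt by simp
  then obtain d where d: "is_iso AS d" "Dom AS d = Cod AS (Q c)" "p' = d \<cdot>\<^bsub>AS\<^esub> Q c"
    using AS.is_cokernel_unique[OF quot_is_cokernel[OF f(4)]] by metis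
  have dA: "d \<in> Arr AS" using d(1) by (rule AS.is_iso_Arr)
  note e = exact[OF f(3,4)]
  have Hk: "FArr factor k' = FArr F k \<cdot>\<^bsub>B\<^esub> FArr factor b"
    unfolding b(4) using H.FArr_Comp[of b "Q k"] b(3) bA kt by simp
  have Hp: "FArr factor p' = FArr factor d \<cdot>\<^bsub>B\<^esub> FArr F c"
    unfolding d(3) using H.FArr_Comp[of "Q c" d] d(2) dA ct by simp
  have iso: "is_iso B (FArr factor b)" "is_iso B (FArr factor d)"
    using b(1) d(1) H.FArr_iso by blast+
  have t: "Cod B (FArr factor b) = FOb F (Dom A k)" "Dom B (FArr factor d) = FOb F (Cod A c)"
    "FArr factor b \<in> Arr B" "FArr factor d \<in> Arr B"
    using H.FArr_simps[OF bA] H.FArr_simps[OF dA] b(3) d(2) kt ct by simp_all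
  have "is_kernel B (FArr F k \<cdot>\<^bsub>B\<^esub> FArr factor b) (FArr F c)"
    using B.is_kernel_iso_left[OF conjunct1[OF e] iso(1)] t kt by simp
  from B.is_kernel_Comp_mono[OF this B.iso_is_mono[OF iso(2)]]
  have 1: "is_kernel B (FArr factor k') (FArr factor p')"
    unfolding Hk Hp using t ct by simp
  have "is_cokernel B (FArr factor d \<cdot>\<^bsub>B\<^esub> FArr F c) (FArr F k)"
    using B.is_cokernel_iso_right[OF conjunct2[OF e] iso(2)] t ct by simp
  from B.is_cokernel_Comp_epi[OF this B.iso_is_epi[OF iso(1)]]
  have 2: "is_cokernel B (FArr factor p') (FArr factor k')"
    unfolding Hk Hp using t kt by simp
  from 1 2 show "is_kernel B (FArr factor k') (FArr factor p') \<and>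
      is_cokernel B (FArr factor p') (FArr factor k')" by blast
qed

lemma factor_faithful: "faithful AS factor"
  unfolding faithful_def
proof (intro ballI inj_onI)
  fix X Y c d assume "c \<in> Hom AS X Y" "d \<in> Hom AS X Y" "FArr factor c = FArr factor d"
  moreover from this obtain f g where "f \<in> Hom A X Y" "g \<in> Hom A X Y" "c = Q f" "d = Q g"
    unfolding quot_Hom by blast
  ultimately show "c = d" by (simp add: Hom_iff FArr_eq_iff_cong quot_arr_eq_iff)
qed

lemma factor_tensor_isomorphic:
  "tensor_isomorphic A B F (comp_tfun B factor (serre_proj A S))"
proof -
  have "tensor_functor A B (comp_tfun B factor (serre_proj A S))"
    by (rule tensor_functor_comp[OF serre_proj_tensor_functor factor_tensor_functor])
  then have "tensor_nat_iso A B F (comp_tfun B factor (serre_proj A S)) (\<lambda>X. Id B (FOb F X))"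
    by (intro tensor_nat_iso.intro tensor_nat_iso_axioms.intro tensor_functor_axioms)
      (auto simp: Hom_iff B.is_iso_Id)
  then show ?thesis unfolding tensor_isomorphic_def by blast
qed

end

lemma (in exact_tensor_functor) factors_faithfully_kernel:
  assumes "field (Z_ring B)"
  shows "factors_faithfully A {z \<in> scalars A. FZ z = Zero B (Unit B) (Unit B)} B F"
proof -
  let ?M = "{z \<in> scalars A. FZ z = Zero B (Unit B) (Unit B)}"
  have M: "ideal ?M (Z_ring A)" using kernel_ideal_prime[OF assms] by (rule primeideal.axioms(1))
  interpret L: scalar_localization A "unit_idems A ?M" "supp_subcat A ?M"
    by (rule A.scalar_localization_ideal[OF M])
  interpret L: localization_factor A "unit_idems A ?M" "supp_subcat A ?M" B F
  proof (intro localization_factor.intro localization_factor_axioms.intro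
      L.scalar_localization_axioms exact_tensor_functor_axioms)
    fix w assume "w \<in> unit_idems A ?M"
    then have "w \<in> scalars A" "FZ (Sub A (Id A (Unit A)) w) = Zero B (Unit B) (Unit B)"
      unfolding unit_idems_def by blast+
    then show "FZ w = Id B (Unit B)" by (simp add: FZ_Sub B.Sub_eq_Zero_iff)
  next
    fix f assume "f \<in> Arr A" "FArr F f = Zero B (FOb F (Dom A f)) (FOb F (Cod A f))"
    then obtain e where e: "e \<in> scalars A" "e \<cdot>\<^bsub>A\<^esub> e = e" "FZ e = Zero B (Unit B) (Unit B)"
      "Sub A (Id A (Unit A)) e \<star>\<^bsub>A\<^esub> f = Zero A (Dom A f) (Cod A f)"
      by (rule Zero_FArr_annihilated)
    note w = A.complement_idem[OF e(1,2)]
    \<comment> \<open>Its complement is \<open>e\<close>, which \<open>F\<close> sends to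
      zero.\<close>
    have "Sub A (Id A (Unit A)) e \<in> unit_idems A ?M"
      by (rule unit_idemsI) (use w e in simp_all)
    with e(4) show "\<exists>w \<in> unit_idems A ?M. w \<star>\<^bsub>A\<^esub> f = Zero A (Dom A f) (Cod A f)" by blast
  qed
  show ?thesis
    unfolding factors_faithfully_def ideal_quotient_def ideal_proj_def
    using L.factor_exact L.factor_faithful L.factor_tensor_isomorphic by blast
qed

lemma (in exact_tensor_functor) factors_faithfully_unique:
  assumes M: "maximalideal M (Z_ring A)" and f: "factors_faithfully A M B F"
  shows "M = {z \<in> scalars A. FZ z = Zero B (Unit B) (Unit B)}"
proof -
  have Mi: "ideal M (Z_ring A)" using M by (rule maximalideal.axioms(1))
  interpret L: scalar_localization A "unit_idems A M" "supp_subcat A M"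
    by (rule A.scalar_localization_ideal[OF Mi])
  obtain H where H: "exact_tensor_functor L.AS B H" "faithful L.AS H"
    "tensor_isomorphic A B F (comp_tfun B H (serre_proj A (supp_subcat A M)))"
    using f unfolding factors_faithfully_def ideal_quotient_def ideal_proj_def by blast
  interpret H: exact_tensor_functor L.AS B H by (rule H(1))
  obtain \<eta> where "tensor_nat_iso A B F (comp_tfun B H (serre_proj A (supp_subcat A M))) \<eta>"
    using H(3) unfolding tensor_isomorphic_def by blast
  then interpret \<eta>: tensor_nat_iso A B F "comp_tfun B H (serre_proj A (supp_subcat A M))" \<eta> .
  let ?O = "Zero A (Unit A) (Unit A)"
  have "z \<in> M \<longleftrightarrow> FZ z = Zero B (Unit B) (Unit B)" if z: "z \<in> scalars A" for z
  proof -
    have zO: "z \<in> Arr A" "?O \<in> Arr A" "Dom A z = Dom A ?O" "Cod A z = Cod A ?O" using z by simp_all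
    have "FZ z = Zero B (Unit B) (Unit B) \<longleftrightarrow> FArr F z = FArr F ?O"
      using FZ_Zero_iff[OF z] by simp
    also have "\<dots> \<longleftrightarrow> FArr H (L.Q z) = FArr H (L.Q ?O)"
      using \<eta>.FArr_eq_iff[OF zO] by simp
    also have "\<dots> \<longleftrightarrow> L.Q z = L.Q ?O"
    proof -
      have "inj_on (FArr H) (Hom L.AS (Unit A) (Unit A))"
        using H(2) unfolding faithful_def by simp
      moreover have "L.Q z \<in> Hom L.AS (Unit A) (Unit A)" "L.Q ?O \<in> Hom L.AS (Unit A) (Unit A)"
        using z by (simp_all add: Hom_iff)
      ultimately show ?thesis by (rule inj_on_eq_iff)
    qed
    also have "\<dots> \<longleftrightarrow> (\<exists>w \<in> unit_idems A M. w \<star>\<^bsub>A\<^esub> z = ?O)"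
      using z by (intro L.quot_Zero_iff) simp_all
    also have "\<dots> \<longleftrightarrow> (\<exists>w \<in> unit_idems A M. w \<cdot>\<^bsub>A\<^esub> z = ?O)"
      using z by (intro bex_cong refl) (simp add: A.scal_scalars)
    also have "\<dots> \<longleftrightarrow> z \<in> M" using A.mem_ideal_iff[OF Mi z] by simp
    finally show ?thesis by simp
  qed
  then show ?thesis using A.ideal_simps(1)[OF Mi] by blast
qed

lemma (in tensor_nat_iso) exact_FZ_Zero_iff:
  assumes "z \<in> scalars A"
  shows "F.FZ z = Zero B (Unit B) (Unit B) \<longleftrightarrow> G.FZ z = Zero B (Unit B) (Unit B)"
proof -
  have "FArr F z = FArr F (Zero A (Unit A) (Unit A)) \<longleftrightarrow> FArr G z = FArr G (Zero A (Unit A) (Unit A))"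
    by (rule FArr_eq_iff) (use assms in simp_all)
  then show ?thesis unfolding F.FZ_Zero_iff[OF assms] G.FZ_Zero_iff[OF assms] by simp
qed

text \<open>\<open>\<C> \<rightarrow> T // M\<close> identifies \<open>f\<close> and \<open>g\<close> iff some idempotent outside \<open>M\<close> annihilates the
  difference of their images.\<close>

lemma envelope_ideals_eq:
  assumes T: "rigid_abelian_category T" and L: "tensor_functor C T L"
  defines "K \<equiv> {w \<in> scalars T. w \<cdot>\<^bsub>T\<^esub> w = w \<and> (\<exists>X \<in> Ob C. \<exists>Y \<in> Ob C. \<exists>f \<in> Hom C X Y. \<exists>g \<in> Hom C X Y.
    f \<noteq> g \<and> w \<star>\<^bsub>T\<^esub> FArr L f = w \<star>\<^bsub>T\<^esub> FArr L g)}"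
  shows "envelope_ideals C T L = {P. primeideal P (Z_ring T) \<and> K \<subseteq> P}"
proof -
  interpret T: rigid_abelian_category T by fact
  interpret L: tensor_functor C T L by fact
  interpret R: cring "Z_ring T" by (rule T.Z_ring_cring)
  have iff: "faithful C (local_envelope T L P) \<longleftrightarrow> K \<subseteq> P" if P: "primeideal P (Z_ring T)" for P
  proof -
    interpret P: primeideal P "Z_ring T" by fact
    interpret Q: scalar_localization T "unit_idems T P" "supp_subcat T P"
      by (rule T.scalar_localization_ideal[OF P.is_ideal])
    have env: "FArr (local_envelope T L P) f = Q.Q (FArr L f)" for f
      by (simp add: local_envelope_def ideal_proj_def)
    \<comment> \<open>From \<open>w (1 - w) = 0\<close>, a prime ideal contains \<open>w\<close> or
      \<open>1 - w\<close>; being proper, it does not contain both.\<close>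
    have out: "w \<in> unit_idems T P \<longleftrightarrow> w \<notin> P" if w: "w \<in> scalars T" "w \<cdot>\<^bsub>T\<^esub> w = w" for w
    proof
      assume "w \<in> unit_idems T P"
      then have s: "Sub T (Id T (Unit T)) w \<in> P" unfolding unit_idems_def by blast
      show "w \<notin> P"
      proof
        assume "w \<in> P"
        then have "Id T (Unit T) \<in> P"
          using T.ideal_simps(3)[OF P.is_ideal s, of w] T.complement_idem(6)[OF w] by simp
        then show False using ideal.one_imp_carrier[OF P.is_ideal] P.I_notcarr by simp
      qed
    next
      assume "w \<notin> P"
      then have "Sub T (Id T (Unit T)) w \<in> P"
        using P.I_prime[of w "Sub T (Id T (Unit T)) w"] w T.complement_idem(1,4)[OF w]
          T.ideal_simps(2)[OF P.is_ideal] by simp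
      then show "w \<in> unit_idems T P" using w by (intro unit_idemsI)
    qed
    have W: "w \<in> scalars T \<and> w \<cdot>\<^bsub>T\<^esub> w = w" if "w \<in> unit_idems T P" for w
      using that unfolding unit_idems_def by blast
    have cong: "Q.Q (FArr L f) = Q.Q (FArr L g) \<longleftrightarrow>
      (\<exists>w \<in> unit_idems T P. w \<star>\<^bsub>T\<^esub> FArr L f = w \<star>\<^bsub>T\<^esub> FArr L g)"
      if "f \<in> Hom C X Y" "g \<in> Hom C X Y" for f g X Y
      using that by (auto simp: Hom_iff Q.quot_arr_eq_iff Q.cong_def)
    show ?thesis
    proof
      assume F: "faithful C (local_envelope T L P)"
      show "K \<subseteq> P"
      proof
        fix w assume "w \<in> K"
        then obtain X Y f g where w: "w \<in> scalars T" "w \<cdot>\<^bsub>T\<^esub> w = w" "X \<in> Ob C" "Y \<in> Ob C"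
          "f \<in> Hom C X Y" "g \<in> Hom C X Y" "f \<noteq> g" "w \<star>\<^bsub>T\<^esub> FArr L f = w \<star>\<^bsub>T\<^esub> FArr L g"
          unfolding K_def by blast
        then have "Q.Q (FArr L f) \<noteq> Q.Q (FArr L g)"
          using F unfolding faithful_def env[symmetric] by (meson inj_onD)
        then show "w \<in> P" using cong[OF w(5,6)] w(8) out[OF w(1,2)] by blast
      qed
    next
      assume K: "K \<subseteq> P"
      show "faithful C (local_envelope T L P)"
        unfolding faithful_def
      proof (intro ballI inj_onI)
        fix X Y f g assume a: "X \<in> Ob C" "Y \<in> Ob C" "f \<in> Hom C X Y" "g \<in> Hom C X Y"
          "FArr (local_envelope T L P) f = FArr (local_envelope T L P) g"
        then obtain w where w: "w \<in> unit_idems T P" "w \<star>\<^bsub>T\<^esub> FArr L f = w \<star>\<^bsub>T\<^esub> FArr L g"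
          using cong[OF a(3,4)] unfolding env by blast
        have "w \<notin> K" using K out[of w] W[OF w(1)] w(1) by blast
        then show "f = g" unfolding K_def using W[OF w(1)] w(2) a(1-4) by blast
      qed
    qed
  qed
  show ?thesis
    unfolding envelope_ideals_def
    using iff R.maximalideal_prime T.primeideal_maximal by blast
qed

text \<open>Besides assigning an ideal to each faithful functor, the classification realizes every
  ideal of the set by its local envelope. This half is a separate conjunct because the quotient
  lives in types built from those of \<open>T\<close>, in general different from those of the test
  categories \<open>B\<close>.\<close>

theorem corollary6p2:
  fixes C :: "('a, 'b) tcat" and T :: "('c, 'd) tcat" and L :: "('a, 'b, 'c, 'd) tfun"
  assumes "rigid_tensor_category C"
    and "two_universal TYPE('p) TYPE('q) C T L"
  shows
    "(\<forall>(B :: ('p, 'q) tcat) G.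
        connected_rigid_abelian_category B \<and> tensor_functor C B G \<and> faithful C G \<longrightarrow>
          (\<exists>F. exact_tensor_functor T B F \<and> tensor_isomorphic C B (comp_tfun B F L) G) \<and>
          (\<exists>!M. M \<in> envelope_ideals C T L \<and>
             (\<forall>F. exact_tensor_functor T B F \<and> tensor_isomorphic C B (comp_tfun B F L) G
                \<longrightarrow> factors_faithfully T M B F)))
     \<and> (\<forall>M \<in> envelope_ideals C T L.
          connected_rigid_abelian_category (ideal_quotient T M) \<and>
          exact_tensor_functor T (ideal_quotient T M) (ideal_proj T M) \<and>
          tensor_functor C (ideal_quotient T M) (local_envelope T L M) \<and>
          faithful C (local_envelope T L M))
     \<and> closedin (zariski (Z_ring T)) (envelope_ideals C T L)
     \<and> compactin (zariski (Z_ring T)) (envelope_ideals C T L)"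
proof -
  have T: "rigid_abelian_category T" and L: "tensor_functor C T L"
    and univ: "\<And>B :: ('p, 'q) tcat. rigid_abelian_category B \<Longrightarrow>
      precomp_essentially_surjective C T L B \<and> precomp_fully_faithful C T L B"
    using assms(2) by (auto simp: two_universal_def)
  interpret T: rigid_abelian_category T by (rule T)
  interpret L: tensor_functor C T L by (rule L)
  interpret R: cring "Z_ring T" by (rule T.Z_ring_cring)
  have 1: "(\<exists>F. exact_tensor_functor T B F \<and> tensor_isomorphic C B (comp_tfun B F L) G) \<and>
      (\<exists>!M. M \<in> envelope_ideals C T L \<and>
         (\<forall>F. exact_tensor_functor T B F \<and> tensor_isomorphic C B (comp_tfun B F L) G
            \<longrightarrow> factors_faithfully T M B F))"
    if B: "connected_rigid_abelian_category B" and G: "tensor_functor C B G" and fG: "faithful C G"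
    for B :: "('p, 'q) tcat" and G
  proof -
    interpret B: connected_rigid_abelian_category B by (rule B)
    note u = univ[OF B.rigid_abelian_category_axioms]
    obtain F \<theta> where F: "exact_tensor_functor T B F" and \<theta>: "tensor_nat_iso C B (comp_tfun B F L) G \<theta>"
      using u G unfolding precomp_essentially_surjective_def tensor_isomorphic_def by blast
    interpret F: exact_tensor_functor T B F by (rule F)
    interpret \<theta>: tensor_nat_iso C B "comp_tfun B F L" G \<theta> by (rule \<theta>)
    define M where "M = {z \<in> scalars T. F.FZ z = Zero B (Unit B) (Unit B)}"
    have P: "primeideal M (Z_ring T)" unfolding M_def by (rule F.kernel_ideal_prime[OF B.connected])
    have fF: "factors_faithfully T M B F'"
      if F': "exact_tensor_functor T B F'" and iso: "tensor_isomorphic C B (comp_tfun B F' L) G" for F'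
    proof -
      interpret F': exact_tensor_functor T B F' by (rule F')
      obtain \<theta>' where \<theta>': "tensor_nat_iso C B (comp_tfun B F' L) G \<theta>'"
        using iso unfolding tensor_isomorphic_def by blast
      \<comment> \<open>The comparison of \<open>F\<close> and \<open>F'\<close> over
        \<open>G\<close> lifts to an isomorphism on \<open>T\<close> by full faithfulness, so both
        functors have the kernel \<open>M\<close>.\<close>
      have "tensor_nat_iso C B (comp_tfun B F L) (comp_tfun B F' L)
          (\<lambda>X. inv_arr B (\<theta>' X) \<cdot>\<^bsub>B\<^esub> \<theta> X)"
        by (rule tensor_nat_iso_comp[OF \<theta> tensor_nat_iso_inv[OF \<theta>']])
      then obtain \<eta> where "tensor_nat_iso T B F F' \<eta>"
        using u F F' unfolding precomp_fully_faithful_def by blast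
      then interpret \<eta>: tensor_nat_iso T B F F' \<eta> .
      have "M = {z \<in> scalars T. F'.FZ z = Zero B (Unit B) (Unit B)}"
        unfolding M_def using \<eta>.exact_FZ_Zero_iff by blast
      then show ?thesis using F'.factors_faithfully_kernel[OF B.connected] by simp
    qed
    interpret Q: scalar_localization T "unit_idems T M" "supp_subcat T M"
      by (rule T.scalar_localization_ideal[OF primeideal.axioms(1)[OF P]])
    have "faithful C (local_envelope T L M)"
      unfolding faithful_def
    proof (intro ballI inj_onI)
      fix X Y f g assume a: "X \<in> Ob C" "Y \<in> Ob C" "f \<in> Hom C X Y" "g \<in> Hom C X Y"
        "FArr (local_envelope T L M) f = FArr (local_envelope T L M) g"
      have t: "f \<in> Arr C" "g \<in> Arr C" "Dom C f = Dom C g" "Cod C f = Cod C g"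
        using a(3,4) by (simp_all add: Hom_iff)
      have "Q.Q (FArr L f) = Q.Q (FArr L g)"
        using a(5) by (simp add: local_envelope_def ideal_proj_def)
      then obtain w where w: "w \<in> unit_idems T M" "w \<star>\<^bsub>T\<^esub> FArr L f = w \<star>\<^bsub>T\<^esub> FArr L g"
        using t by (auto simp: Q.quot_arr_eq_iff Q.cong_def)
      \<comment> \<open>\<open>1 - w\<close> lies in the kernel \<open>M\<close>, so
        \<open>F\<close> turns \<open>w\<close> into 1 and the factor \<open>w\<close> disappears
        after applying \<open>F\<close>.\<close>
      have "F.FZ (Sub T (Id T (Unit T)) w) = Zero B (Unit B) (Unit B)" "w \<in> scalars T"
        using w(1) unfolding unit_idems_def M_def by blast+
      then have "F.FZ w = Id B (Unit B)" by (simp add: F.FZ_Sub B.Sub_eq_Zero_iff)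
      moreover have "FArr F (w \<star>\<^bsub>T\<^esub> FArr L f) = FArr F (w \<star>\<^bsub>T\<^esub> FArr L g)" using w(2) by simp
      ultimately have "FArr F (FArr L f) = FArr F (FArr L g)"
        using \<open>w \<in> scalars T\<close> t by (simp add: F.FArr_scal)
      then have "FArr G f = FArr G g" using \<theta>.FArr_eq_iff[OF t] by simp
      then show "f = g" using fG a(1-4) unfolding faithful_def by (meson inj_onD)
    qed
    then have M: "M \<in> envelope_ideals C T L"
      using T.primeideal_maximal[OF P] by (simp add: envelope_ideals_def)
    have FG: "tensor_isomorphic C B (comp_tfun B F L) G"
      using \<theta> unfolding tensor_isomorphic_def by blast
    \<comment> \<open>For uniqueness it suffices to test a competing ideal on the one functor
      \<open>F\<close>, which induces \<open>G\<close>.\<close>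
    have "M' = M" if "M' \<in> envelope_ideals C T L" "factors_faithfully T M' B F" for M'
      unfolding M_def using that by (intro F.factors_faithfully_unique) (simp_all add: envelope_ideals_def)
    with M fF F FG show ?thesis by blast
  qed
  have 2: "connected_rigid_abelian_category (ideal_quotient T M) \<and>
      exact_tensor_functor T (ideal_quotient T M) (ideal_proj T M) \<and>
      tensor_functor C (ideal_quotient T M) (local_envelope T L M) \<and>
      faithful C (local_envelope T L M)" if M: "M \<in> envelope_ideals C T L" for M
  proof -
    have P: "primeideal M (Z_ring T)"
      using M R.maximalideal_prime by (auto simp: envelope_ideals_def)
    interpret Q: scalar_localization T "unit_idems T M" "supp_subcat T M"
      by (rule T.scalar_localization_ideal[OF primeideal.axioms(1)[OF P]])
    show ?thesis
      using T.connected_ideal_quotient[OF P] Q.serre_proj_exact M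
        tensor_functor_comp[OF L Q.serre_proj_tensor_functor]
      by (simp add: envelope_ideals_def local_envelope_def ideal_quotient_def ideal_proj_def)
  qed
  have 3: "closedin (zariski (Z_ring T)) (envelope_ideals C T L)"
  proof -
    obtain K where K: "K \<subseteq> carrier (Z_ring T)"
      "envelope_ideals C T L = {P. primeideal P (Z_ring T) \<and> K \<subseteq> P}"
      by (rule that[OF _ envelope_ideals_eq[OF T L]]) auto
    have "topspace (zariski (Z_ring T)) - envelope_ideals C T L = prime_nonvanishing (Z_ring T) K"
      unfolding topspace_zariski K(2) prime_nonvanishing_def by blast
    then show ?thesis
      unfolding closedin_def openin_zariski_iff using K topspace_zariski by blast
  qed
  have 4: "compactin (zariski (Z_ring T)) (envelope_ideals C T L)"
    by (rule closedin_compact_space[OF compact_space_zariski[OF R.is_cring] 3])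
  from 1 2 3 4 show ?thesis by blast
qed

end
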